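(* Let $\mathcal{X}_t$ be a dynamical system and $(x_k,y_k)_{k\in\mathbb{N}}$ a sequence of sample pairs satisfying the strong law of large numbers described in the context. Let $\mathbb{V}=\bigotimes_{k=1}^p\mathbb{V}^k\subset L^2_{\rho_0}$ and $\mathbb{W}=\bigotimes_{k=1}^p\mathbb{W}^k\subset L^2_{\rho_1}$ be tensor product subspaces with bases $\mathbf{\Psi}=\bigotimes_{k=1}^p\psi_k$ and $\mathbf{\Phi}=\bigotimes_{k=1}^p\phi_k$. For a fixed vector of ranks $\mathbf{r}=[r_1,\dots,r_p]$, denote the multi-linear spectral subspaces of both bases by $\mathbb{G}^{:k}(\mathbf{\Psi})$ and $\mathbb{G}^{:k}(\mathbf{\Phi})$, $1\le k\le p$, and assume they are all well-defined. Then, almost surely, for all $1\le k\le p$, $$\big\|\widehat{\mathcal{K}}_\tau\big(\widehat{\mathbb{G}}^{:k}(\mathbf{\Psi}),\widehat{\mathbb{G}}^{:k}(\mathbf{\Phi})\big)-\mathcal{K}_\tau\big(\mathbb{G}^{:k}(\mathbf{\Psi}),\mathbb{G}^{:k}(\mathbf{\Phi})\big)\big\|_{L(\mathbb{W}^{:k},\mathbb{V}^{:k})}\to 0\quad\text{as } m\to\infty,$$ where $m$ is the number of sample pairs used to form the empirical quantities.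
   Context: **Dynamics and sampling.** $\mathcal{X}_t$ is a (deterministic or stochastic) dynamical system on $\mathbb{R}^d$ with transition kernel $p^\tau$ for a fixed lag time $\tau>0$; the densities of $\mathcal{X}_t$ at times $0$ and $\tau$ are $\rho_0$ and $\rho_1$. The Koopman operator $\mathcal{K}_\tau:L^2_{\rho_1}\to L^2_{\rho_0}$ is $\mathcal{K}_\tau f(x)=\int p^\tau(x,y)f(y)\,dy$ (it is bounded; $L^2_\rho$ is the real weighted $L^2$-space on $\mathbb{R}^d$). Let $\vartheta(x,y)=\rho_0(x)p^\tau(x,y)$ be the joint distribution on $\mathbb{R}^d\times\mathbb{R}^d$. Strong law: the random pairs $(x_k,y_k)\in\mathbb{R}^d\times\mathbb{R}^d$ satisfy, for every $\vartheta$-integrable Hilbert space-valued function $f$, almost surely $\lim_{m\to\infty}\frac1m\sum_{k=1}^m f(x_k,y_k)=\mathbb{E}^\vartheta[f]$. **Tensor spaces.** $\psi_k=(\psi_{k,1},\dots,\psi_{k,n_k})^\top$ are functions on $\mathbb{R}^d$ (fixed measurable functions, so that point evaluation makes sense) and $\mathbb{V}^k=\mathrm{span}\{\psi_{k,1},\dots,\psi_{k,n_k}\}$. $\mathbb{V}^{:k}=\bigotimes_{l=1}^k\mathbb{V}^l$ is the span of the pointwise products $x\mapsto\psi_{1,i_1}(x)\cdots\psi_{k,i_k}(x)$; these products form the basis $\mathbf{\Psi}_{:k}$ of $\mathbb{V}^{:k}$ (assumed linearly independent), $\mathbf{\Psi}=\mathbf{\Psi}_{:p}$, $\mathbb{V}=\mathbb{V}^{:p}$.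 All $\mathbb{V}^{:k}$ are contained in $L^2_{\rho_0}$ and carry its inner product. Analogously $\mathbb{W}^k$, $\mathbb{W}^{:k}\subset L^2_{\rho_1}$, $\phi_k$, $\mathbf{\Phi}_{:k}$, $\mathbf{\Phi}$. **Gramians.** For a finite tuple $\psi$ of functions, $C(\psi)$ is the Gramian matrix $(\langle\psi_i,\psi_j\rangle)_{ij}$ (in $L^2_{\rho_0}$ for functions in the $\mathbb{V}$-spaces, in $L^2_{\rho_1}$ for the $\mathbb{W}$-spaces). Empirical inner products are $\langle f,g\rangle^{\wedge}=\frac1m\sum_{k=1}^m f(x_k)g(x_k)$ on the $\mathbb{V}$-spaces and $\frac1m\sum_{k=1}^m f(y_k)g(y_k)$ on the $\mathbb{W}$-spaces (almost surely positive definite for $m$ large); empirical Gramians $\widehat{C}$ are the corresponding Gramians. **Multi-linear spectral subspaces.** Given $\mathbf{r}$, put $r_0=1$, $\mathbb{G}^{:0}=\mathrm{span}\{1\}$, $\theta_0=1$. Recursively for $k=1,\dots,p$, let $\mathbf{vec}(\theta_{k-1}\otimes\psi_k)$ be the vector of the $r_{k-1}n_k$ products $\theta_{k-1,l}\,\psi_{k,i}$, and let $\sigma_{k,1}^2\ge\sigma_{k,2}^2\ge\dots$ be the eigenvalues of its Gramian $C(\mathbf{vec}(\theta_{k-1}\otimes\psi_k))$. If $\sigma_{k,r_k}>\sigma_{k,r_k+1}$ (with $r_k\le r_{k-1}n_k$ and the convention $\sigma_{k,r_{k-1}n_k+1}=0$), choose any matrix $U_k\in\mathbb{R}^{r_{k-1}n_k\times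 r_k}$ whose columns are an orthonormal basis of the span of eigenvectors for the $r_k$ largest eigenvalues, set $(\theta_k)^\top=(\mathbf{vec}(\theta_{k-1}\otimes\psi_k))^\top U_k$ and $\mathbb{G}^{:k}=\mathrm{span}(\theta_k)$. The spaces $\mathbb{G}^{:k}=\mathbb{G}^{:k}(\mathbf{\Psi})\subset\mathbb{V}^{:k}$ are the multi-linear spectral subspaces (independent of the choice of the $U_k$); they are well-defined if all gap conditions hold. $\mathbb{G}^{:k}(\mathbf{\Phi})$ is defined in the same way from the $\phi_k$. The empirical versions $\widehat{\mathbb{G}}^{:k}$ are obtained by replacing all Gramians by empirical Gramians; almost surely they are well-defined for $m$ large. **Koopman projections.** For subspaces $\mathbb{F}_1\subset\mathbb{V}^{:k}$, $\mathbb{F}_2\subset\mathbb{W}^{:k}$, $\mathcal{K}_\tau(\mathbb{F}_1,\mathbb{F}_2)=\mathcal{P}_{\mathbb{F}_1}\mathcal{K}_\tau\mathcal{P}_{\mathbb{F}_2}$ with orthogonal projections in $L^2_{\rho_0}$, $L^2_{\rho_1}$. The empirical operator $\widehat{\mathcal{K}}_\tau(\mathbb{V}^{:k},\mathbb{W}^{:k}):\mathbb{W}^{:k}\to\mathbb{V}^{:k}$ is determined by $\langle\psi,\widehat{\mathcal{K}}_\tau(\mathbb{V}^{:k},\mathbb{W}^{:k})\phi\rangle^{\wedge}=\frac1m\sum_{j=1}^m\psi(x_j)\phi(y_j)$ for all $\psi\in\mathbb{V}^{:k}$, $\phi\in\mathbb{W}^{:k}$, and $\widehat{\mathcal{K}}_\tau(\mathbb{F}_1,\mathbb{F}_2)=\widehat{\mathcal{P}}_{\mathbb{F}_1}\widehat{\mathcal{K}}_\tau(\mathbb{V}^{:k},\mathbb{W}^{:k})\widehat{\mathcal{P}}_{\mathbb{F}_2}$,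 where $\widehat{\mathcal{P}}$ denotes orthogonal projection with respect to the empirical inner product. Both operators are regarded as maps $\mathbb{W}^{:k}\to\mathbb{V}^{:k}$; $\|\cdot\|_{L(\mathbb{W}^{:k},\mathbb{V}^{:k})}$ is the operator norm with respect to the (non-empirical) $L^2_{\rho_1}$ and $L^2_{\rho_0}$ norms. *)

theory Defs
  imports
    "HOL-Probability.Probability"
    "Jordan_Normal_Form.Char_Poly"
    "Jordan_Normal_Form.VS_Connect"
begin

text \<open>A transition kernel is a Markov kernel \<open>\<kappa>\<close>, i.e. \<open>\<kappa> x\<close> is the measure written
  \<open>p(x, y) dy\<close>. It need not have a Lebesgue density, so that deterministic dynamics (where \<open>\<kappa> x\<close> is
  a point mass) are covered. \<open>joint_law \<mu> \<kappa>\<close> is the distribution \<open>\<mu>(dx) \<kappa>(x, dy)\<close>.\<close>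

definition joint_law :: "'a::euclidean_space measure \<Rightarrow> ('a \<Rightarrow> 'a measure) \<Rightarrow> ('a \<times> 'a) measure" where
  "joint_law \<mu> \<kappa> = \<mu> \<bind> (\<lambda>x. \<kappa> x \<bind> (\<lambda>y. return (borel \<Otimes>\<^sub>M borel) (x, y)))"

text \<open>Only the two times \<open>0\<close> and \<open>\<tau>\<close> matter: the Markov property and time homogeneity of the
  process are not required.\<close>

definition dynamical_system ::
  "'s measure \<Rightarrow> (real \<Rightarrow> 's \<Rightarrow> 'a::euclidean_space) \<Rightarrow> real \<Rightarrow> ('a \<Rightarrow> 'a measure)
    \<Rightarrow> ('a \<Rightarrow> ennreal) \<Rightarrow> ('a \<Rightarrow> ennreal) \<Rightarrow> bool" where
  "dynamical_system P X \<tau> \<kappa> \<rho>\<^sub>0 \<rho>\<^sub>1 \<longleftrightarrow>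
     prob_space P \<and>
     (\<forall>t\<ge>0. X t \<in> borel_measurable P) \<and>
     distributed P lborel (X 0) \<rho>\<^sub>0 \<and>
     distributed P lborel (X \<tau>) \<rho>\<^sub>1 \<and>
     \<kappa> \<in> borel \<rightarrow>\<^sub>M prob_algebra borel \<and>
     distr P (borel \<Otimes>\<^sub>M borel) (\<lambda>\<omega>. (X 0 \<omega>, X \<tau> \<omega>)) = joint_law (density lborel \<rho>\<^sub>0) \<kappa>"

definition strong_law ::
  "'w measure \<Rightarrow> 'a measure \<Rightarrow> (nat \<Rightarrow> 'w \<Rightarrow> 'a) \<Rightarrow> bool" where
  "strong_law M \<theta> z \<longleftrightarrow>
     (\<forall>f :: 'a \<Rightarrow> real. integrable \<theta> f \<longrightarrow>
        (AE \<omega> in M. (\<lambda>m. (\<Sum>k<m. f (z k \<omega>)) / real m) \<longlonglongrightarrow> (\<integral>u. f u \<partial>\<theta>)))"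

text \<open>The law for real-valued functions is equivalent to the law for functions with values in
  separable Banach spaces, in particular in separable Hilbert spaces.\<close>

lemma strong_law_vector_valued:
  fixes f :: "'a \<Rightarrow> 'h::{banach, second_countable_topology}"
  assumes SL: "strong_law M \<theta> z" and int: "integrable \<theta> f"
  shows "AE \<omega> in M. (\<lambda>m. (1 / real m) *\<^sub>R (\<Sum>k<m. f (z k \<omega>))) \<longlonglongrightarrow> (\<integral>u. f u \<partial>\<theta>)"
  using int
proof (induction rule: integrable_induct)
  case (base A c)
  have i: "integrable \<theta> (indicator A :: 'a \<Rightarrow> real)"
    using base by (simp add: integrable_indicator_iff)
  have "AE \<omega> in M. (\<lambda>m. (\<Sum>k<m. indicator A (z k \<omega>)) / real m) \<longlonglongrightarrow> (\<integral>u. indicator A u \<partial>\<theta>)"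
    using SL i unfolding strong_law_def by blast
  then show ?case
  proof (rule AE_mp, intro AE_I2 impI)
    fix \<omega> assume "(\<lambda>m. (\<Sum>k<m. indicator A (z k \<omega>)) / real m) \<longlonglongrightarrow> (\<integral>u. indicator A u \<partial>\<theta>)"
    from tendsto_scaleR[OF this tendsto_const[of c]]
    show "(\<lambda>m. (1 / real m) *\<^sub>R (\<Sum>k<m. indicator A (z k \<omega>) *\<^sub>R c))
        \<longlonglongrightarrow> (\<integral>u. indicator A u *\<^sub>R c \<partial>\<theta>)"
      using i by (simp add: scaleR_sum_left[symmetric] divide_inverse mult.commute)
  qed
next
  case (add f g)
  show ?case
    using add(3,4)
  proof (eventually_elim)
    case (elim \<omega>)
    from tendsto_add[OF elim(1) elim(2)] show ?case
      using add(1,2) by (simp add: sum.distrib scaleR_add_right)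
  qed
next
  case (lim f s)
  define e where "e i = (\<integral>u. norm (f u - s i u) \<partial>\<theta>)" for i
  have e0: "e \<longlonglongrightarrow> 0"
  proof -
    have "(\<lambda>i. \<integral>u. norm (f u - s i u) \<partial>\<theta>) \<longlonglongrightarrow> (\<integral>u. 0 \<partial>\<theta>)"
    proof (rule integral_dominated_convergence[where w = "\<lambda>u. 3 * norm (f u)"])
      show "AE u in \<theta>. (\<lambda>i. norm (f u - s i u)) \<longlonglongrightarrow> 0"
      proof (intro AE_I2)
        fix u assume "u \<in> space \<theta>"
        from tendsto_norm[OF tendsto_diff[OF tendsto_const[of "f u"] lim.hyps(2)[OF this]]]
        show "(\<lambda>i. norm (f u - s i u)) \<longlonglongrightarrow> 0" by simp
      qed
      show "AE u in \<theta>. norm (norm (f u - s i u)) \<le> 3 * norm (f u)" for i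
      proof (intro AE_I2)
        fix u assume "u \<in> space \<theta>"
        from lim.hyps(3)[OF this, of i] norm_triangle_ineq4[of "f u" "s i u"]
        show "norm (norm (f u - s i u)) \<le> 3 * norm (f u)" by simp
      qed
    qed (use lim.hyps in auto)
    then show ?thesis by (simp add: e_def[abs_def])
  qed
  have "AE \<omega> in M. \<forall>i. (\<lambda>m. (\<Sum>k<m. norm (f (z k \<omega>) - s i (z k \<omega>))) / real m) \<longlonglongrightarrow> e i"
    unfolding AE_all_countable e_def
    using SL lim.hyps(1,4) unfolding strong_law_def
    by (auto intro!: Bochner_Integration.integrable_norm Bochner_Integration.integrable_diff)
  moreover have "AE \<omega> in M. \<forall>i. (\<lambda>m. (1 / real m) *\<^sub>R (\<Sum>k<m. s i (z k \<omega>))) \<longlonglongrightarrow> (\<integral>u. s i u \<partial>\<theta>)"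
    unfolding AE_all_countable using lim.IH by blast
  ultimately show ?case
  proof (eventually_elim)
    case (elim \<omega>)
    show ?case
    proof (rule tendstoI)
      fix d :: real assume "d > 0"
      then have "eventually (\<lambda>i. e i < d / 4) sequentially"
        using e0 by (intro order_tendstoD(2)) auto
      then obtain i where i: "e i < d / 4"
        by (auto simp: eventually_sequentially)
      have "eventually (\<lambda>m. (\<Sum>k<m. norm (f (z k \<omega>) - s i (z k \<omega>))) / real m < d / 4) sequentially"
        using elim(1) i by (intro order_tendstoD(2)[of _ "e i"]) auto
      moreover have "eventually (\<lambda>m. dist ((1 / real m) *\<^sub>R (\<Sum>k<m. s i (z k \<omega>)))
          (\<integral>u. s i u \<partial>\<theta>) < d / 4) sequentially"
        using elim(2) \<open>d > 0\<close> by (intro tendstoD) auto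
      ultimately show "eventually (\<lambda>m. dist ((1 / real m) *\<^sub>R (\<Sum>k<m. f (z k \<omega>)))
          (\<integral>u. f u \<partial>\<theta>) < d) sequentially"
      proof (eventually_elim)
        case (elim m)
        let ?a = "(1 / real m) *\<^sub>R (\<Sum>k<m. f (z k \<omega>))"
        let ?b = "(1 / real m) *\<^sub>R (\<Sum>k<m. s i (z k \<omega>))"
        have "norm (?a - ?b) = norm ((1 / real m) *\<^sub>R (\<Sum>k<m. f (z k \<omega>) - s i (z k \<omega>)))"
          by (simp add: sum_subtractf scaleR_diff_right)
        also have "\<dots> \<le> (1 / real m) * (\<Sum>k<m. norm (f (z k \<omega>) - s i (z k \<omega>)))"
          by (simp add: norm_sum divide_right_mono)
        also have "\<dots> = (\<Sum>k<m. norm (f (z k \<omega>) - s i (z k \<omega>))) / real m"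
          by simp
        also have "\<dots> < d / 4"
          by (rule elim(1))
        finally have 1: "norm (?a - ?b) < d / 4" .
        have "norm ((\<integral>u. f u \<partial>\<theta>) - (\<integral>u. s i u \<partial>\<theta>)) = norm (\<integral>u. f u - s i u \<partial>\<theta>)"
          using lim.hyps(1,4) by simp
        also have "\<dots> \<le> e i"
          unfolding e_def by (rule integral_norm_bound)
        also note i
        finally have 2: "norm ((\<integral>u. f u \<partial>\<theta>) - (\<integral>u. s i u \<partial>\<theta>)) < d / 4" .
        have 3: "norm (?b - (\<integral>u. s i u \<partial>\<theta>)) < d / 4"
          using elim(2) by (simp add: dist_norm)
        have "?a - (\<integral>u. f u \<partial>\<theta>) =
            (?a - ?b) + ((?b - (\<integral>u. s i u \<partial>\<theta>)) - ((\<integral>u. f u \<partial>\<theta>) - (\<integral>u. s i u \<partial>\<theta>)))"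
          by simp
        also have "norm \<dots> \<le> norm (?a - ?b) + norm ((?b - (\<integral>u. s i u \<partial>\<theta>)) - ((\<integral>u. f u \<partial>\<theta>) - (\<integral>u. s i u \<partial>\<theta>)))"
          by (rule norm_triangle_ineq)
        also have "\<dots> \<le> norm (?a - ?b) + (norm (?b - (\<integral>u. s i u \<partial>\<theta>)) + norm ((\<integral>u. f u \<partial>\<theta>) - (\<integral>u. s i u \<partial>\<theta>)))"
          by (intro add_left_mono norm_triangle_ineq4)
        finally show ?case
          unfolding dist_norm using 1 2 3 \<open>d > 0\<close> by linarith
      qed
    qed
  qed
qed

text \<open>Elements of the weighted spaces are represented by functions, not by equivalence classes; the
  tensor spaces below consist of fixed functions, which can be evaluated at the samples.\<close>

definition L2 :: "('a::euclidean_space \<Rightarrow> ennreal) \<Rightarrow> ('a \<Rightarrow> real) set" where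
  "L2 \<rho> = {f \<in> borel_measurable borel. integrable (density lborel \<rho>) (\<lambda>x. (f x)\<^sup>2)}"

definition L2_inner :: "('a::euclidean_space \<Rightarrow> ennreal) \<Rightarrow> ('a \<Rightarrow> real) \<Rightarrow> ('a \<Rightarrow> real) \<Rightarrow> real" where
  "L2_inner \<rho> f g = (\<integral>x. f x * g x \<partial>density lborel \<rho>)"

definition L2_norm :: "('a::euclidean_space \<Rightarrow> ennreal) \<Rightarrow> ('a \<Rightarrow> real) \<Rightarrow> real" where
  "L2_norm \<rho> f = sqrt (L2_inner \<rho> f f)"

definition emp_inner :: "nat \<Rightarrow> (nat \<Rightarrow> 'a) \<Rightarrow> ('a \<Rightarrow> real) \<Rightarrow> ('a \<Rightarrow> real) \<Rightarrow> real" where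
  "emp_inner m xs f g = (\<Sum>k<m. f (xs k) * g (xs k)) / real m"

text \<open>Extended-real-valued, so that an unbounded operator has norm \<open>\<infinity>\<close>.\<close>

definition op_norm ::
  "('a::euclidean_space \<Rightarrow> ennreal) \<Rightarrow> ('a \<Rightarrow> ennreal) \<Rightarrow> ('a \<Rightarrow> real) set
    \<Rightarrow> (('a \<Rightarrow> real) \<Rightarrow> 'a \<Rightarrow> real) \<Rightarrow> ennreal" where
  "op_norm \<rho>\<^sub>1 \<rho>\<^sub>0 W T = (SUP f\<in>{f \<in> W. L2_norm \<rho>\<^sub>1 f \<le> 1}. ennreal (L2_norm \<rho>\<^sub>0 (T f)))"

definition fun_span :: "'i set \<Rightarrow> ('i \<Rightarrow> 'a \<Rightarrow> real) \<Rightarrow> ('a \<Rightarrow> real) set" where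
  "fun_span I b = {\<lambda>x. \<Sum>i\<in>I. c i * b i x | c. True}"

text \<open>Factors are numbered \<open>1, \<dots>, p\<close>; the functions of the \<open>k\<close>-th factor are
  \<open>\<psi> k 0, \<dots>, \<psi> k (n k - 1)\<close>.\<close>

definition multi_indices :: "(nat \<Rightarrow> nat) \<Rightarrow> nat \<Rightarrow> (nat \<Rightarrow> nat) set" where
  "multi_indices n k = (\<Pi>\<^sub>E l\<in>{1..k}. {..<n l})"

definition tensor_basis :: "(nat \<Rightarrow> nat \<Rightarrow> 'a \<Rightarrow> real) \<Rightarrow> nat \<Rightarrow> (nat \<Rightarrow> nat) \<Rightarrow> 'a \<Rightarrow> real" where
  "tensor_basis \<psi> k i = (\<lambda>x. \<Prod>l\<in>{1..k}. \<psi> l (i l) x)"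

definition tensor_space :: "(nat \<Rightarrow> nat) \<Rightarrow> (nat \<Rightarrow> nat \<Rightarrow> 'a \<Rightarrow> real) \<Rightarrow> nat \<Rightarrow> ('a \<Rightarrow> real) set" where
  "tensor_space n \<psi> k = fun_span (multi_indices n k) (tensor_basis \<psi> k)"

text \<open>Linear independence in the weighted space, where functions are identified almost everywhere.\<close>

definition L2_independent ::
  "('a::euclidean_space \<Rightarrow> ennreal) \<Rightarrow> 'i set \<Rightarrow> ('i \<Rightarrow> 'a \<Rightarrow> real) \<Rightarrow> bool" where
  "L2_independent \<rho> I b \<longleftrightarrow>
     (\<forall>c :: 'i \<Rightarrow> real. (AE x in density lborel \<rho>. (\<Sum>i\<in>I. c i * b i x) = 0) \<longrightarrow> (\<forall>i\<in>I. c i = 0))"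

text \<open>An inner product on functions enters as a parameter \<open>ip\<close>, so that the same definitions
  yield the subspaces and their empirical versions.\<close>

definition gramian :: "(('a \<Rightarrow> real) \<Rightarrow> ('a \<Rightarrow> real) \<Rightarrow> real) \<Rightarrow> nat \<Rightarrow> (nat \<Rightarrow> 'a \<Rightarrow> real) \<Rightarrow> real mat" where
  "gramian ip N f = Matrix.mat N N (\<lambda>(i, j). ip (f i) (f j))"

text \<open>\<open>eigval A j\<close> is the \<open>j\<close>-th largest eigenvalue, counted from \<open>1\<close> and with multiplicity, and \<open>0\<close>
  beyond the last one.\<close>

definition eigval :: "real mat \<Rightarrow> nat \<Rightarrow> real" where
  "eigval A j = (let es = rev (sorted_list_of_multiset (proots (char_poly A)))
                 in if 1 \<le> j \<and> j \<le> length es then es ! (j - 1) else 0)"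

definition dominant_basis :: "real mat \<Rightarrow> nat \<Rightarrow> real mat \<Rightarrow> bool" where
  "dominant_basis A r U \<longleftrightarrow>
     U \<in> carrier_mat (dim_row A) r \<and>
     transpose_mat U * U = 1\<^sub>m r \<and>
     vec_space.col_space (dim_row A) U =
       LinearCombinations.module.span class_ring (module_vec TYPE(real) (dim_row A))
         {v. \<exists>j\<in>{1..r}. eigenvector A v (eigval A j)}"

text \<open>The products \<open>\<theta> l * \<psi> i\<close> with \<open>l < r\<close>, numbered in column-major order.\<close>

definition vec_tensor ::
  "nat \<Rightarrow> (nat \<Rightarrow> 'a \<Rightarrow> real) \<Rightarrow> (nat \<Rightarrow> 'a \<Rightarrow> real) \<Rightarrow> nat \<Rightarrow> 'a \<Rightarrow> real" where
  "vec_tensor r \<theta> \<psi> q = (\<lambda>x. \<theta> (q mod r) x * \<psi> (q div r) x)"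

definition ext_rank :: "(nat \<Rightarrow> nat) \<Rightarrow> nat \<Rightarrow> nat" where
  "ext_rank r k = (if k = 0 then 1 else r k)"

text \<open>\<open>spectral_tuple ip n \<psi> r k \<theta>\<close>: the gap conditions hold up to step \<open>k\<close>, and \<open>\<theta>\<close> is the
  \<open>k\<close>-th tuple for some choice of the orthonormal bases \<open>U\<close> (only the entries \<open>\<theta> l\<close> with
  \<open>l < ext_rank r k\<close> are meaningful). The numbers \<open>\<sigma>\<close> are the square roots of the eigenvalues.\<close>

inductive spectral_tuple ::
  "(('a \<Rightarrow> real) \<Rightarrow> ('a \<Rightarrow> real) \<Rightarrow> real) \<Rightarrow> (nat \<Rightarrow> nat) \<Rightarrow> (nat \<Rightarrow> nat \<Rightarrow> 'a \<Rightarrow> real)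
    \<Rightarrow> (nat \<Rightarrow> nat) \<Rightarrow> nat \<Rightarrow> (nat \<Rightarrow> 'a \<Rightarrow> real) \<Rightarrow> bool"
  for ip n \<psi> r where
  zero: "spectral_tuple ip n \<psi> r 0 (\<lambda>l x. 1)"
| step: "\<lbrakk> spectral_tuple ip n \<psi> r k \<theta>;
           N = ext_rank r k * n (Suc k);
           v = vec_tensor (ext_rank r k) \<theta> (\<psi> (Suc k));
           A = gramian ip N v;
           1 \<le> r (Suc k); r (Suc k) \<le> N;
           sqrt (eigval A (r (Suc k))) > sqrt (eigval A (r (Suc k) + 1));
           dominant_basis A (r (Suc k)) U \<rbrakk>
         \<Longrightarrow> spectral_tuple ip n \<psi> r (Suc k) (\<lambda>j x. \<Sum>q<N. U $$ (q, j) * v q x)"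

text \<open>Well-definedness is just the gap conditions: since Gramians are symmetric, the bases \<open>U\<close> exist
  whenever the gap conditions hold.\<close>

definition spectral_subspaces_welldef ::
  "(('a \<Rightarrow> real) \<Rightarrow> ('a \<Rightarrow> real) \<Rightarrow> real) \<Rightarrow> (nat \<Rightarrow> nat) \<Rightarrow> (nat \<Rightarrow> nat \<Rightarrow> 'a \<Rightarrow> real)
    \<Rightarrow> (nat \<Rightarrow> nat) \<Rightarrow> nat \<Rightarrow> bool" where
  "spectral_subspaces_welldef ip n \<psi> r p \<longleftrightarrow> (\<exists>\<theta>. spectral_tuple ip n \<psi> r p \<theta>)"

text \<open>The definite description expresses that the subspace does not depend on the choice of the
  bases \<open>U\<close>.\<close>

definition spectral_subspace ::
  "(('a \<Rightarrow> real) \<Rightarrow> ('a \<Rightarrow> real) \<Rightarrow> real) \<Rightarrow> (nat \<Rightarrow> nat) \<Rightarrow> (nat \<Rightarrow> nat \<Rightarrow> 'a \<Rightarrow> real)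
    \<Rightarrow> (nat \<Rightarrow> nat) \<Rightarrow> nat \<Rightarrow> ('a \<Rightarrow> real) set" where
  "spectral_subspace ip n \<psi> r k =
     (THE G. \<exists>\<theta>. spectral_tuple ip n \<psi> r k \<theta> \<and> G = fun_span {..<ext_rank r k} \<theta>)"

definition ortho_proj ::
  "(('a \<Rightarrow> real) \<Rightarrow> ('a \<Rightarrow> real) \<Rightarrow> real) \<Rightarrow> ('a \<Rightarrow> real) set \<Rightarrow> ('a \<Rightarrow> real) \<Rightarrow> 'a \<Rightarrow> real" where
  "ortho_proj ip F g = (THE h. h \<in> F \<and> (\<forall>f\<in>F. ip f (\<lambda>x. g x - h x) = 0))"

definition koopman :: "('a \<Rightarrow> 'a measure) \<Rightarrow> ('a \<Rightarrow> real) \<Rightarrow> 'a \<Rightarrow> real" where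
  "koopman \<kappa> f = (\<lambda>x. \<integral>y. f y \<partial>\<kappa> x)"

definition koopman_proj ::
  "('a::euclidean_space \<Rightarrow> 'a measure) \<Rightarrow> ('a \<Rightarrow> ennreal) \<Rightarrow> ('a \<Rightarrow> ennreal)
    \<Rightarrow> ('a \<Rightarrow> real) set \<Rightarrow> ('a \<Rightarrow> real) set \<Rightarrow> ('a \<Rightarrow> real) \<Rightarrow> 'a \<Rightarrow> real" where
  "koopman_proj \<kappa> \<rho>\<^sub>0 \<rho>\<^sub>1 F\<^sub>1 F\<^sub>2 f =
     ortho_proj (L2_inner \<rho>\<^sub>0) F\<^sub>1 (koopman \<kappa> (ortho_proj (L2_inner \<rho>\<^sub>1) F\<^sub>2 f))"

definition emp_koopman ::
  "nat \<Rightarrow> (nat \<Rightarrow> 'a) \<Rightarrow> (nat \<Rightarrow> 'a) \<Rightarrow> ('a \<Rightarrow> real) set \<Rightarrow> ('a \<Rightarrow> real) \<Rightarrow> 'a \<Rightarrow> real" where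
  "emp_koopman m xs ys V f =
     (THE g. g \<in> V \<and> (\<forall>h\<in>V. emp_inner m xs h g = (\<Sum>j<m. h (xs j) * f (ys j)) / real m))"

definition emp_koopman_proj ::
  "nat \<Rightarrow> (nat \<Rightarrow> 'a) \<Rightarrow> (nat \<Rightarrow> 'a) \<Rightarrow> ('a \<Rightarrow> real) set
    \<Rightarrow> ('a \<Rightarrow> real) set \<Rightarrow> ('a \<Rightarrow> real) set \<Rightarrow> ('a \<Rightarrow> real) \<Rightarrow> 'a \<Rightarrow> real" where
  "emp_koopman_proj m xs ys V F\<^sub>1 F\<^sub>2 f =
     ortho_proj (emp_inner m xs) F\<^sub>1 (emp_koopman m xs ys V (ortho_proj (emp_inner m ys) F\<^sub>2 f))"

end

theory Submission
  imports Defs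
begin

text \<open>
  In coordinates everything is finite-dimensional, and the theorem follows by compactness; no
  perturbation bound for eigenspaces enters.

  With respect to the tensor bases, a tuple \<open>\<theta>\<^sub>k\<close> is a matrix \<open>T\<close> of coefficients. The construction of
  \<open>T\<close> sees the inner product only through the Gram matrices of the tensor bases. These have finitely
  many entries, so by the strong law all empirical Gram matrices, and the cross Gram matrices between
  \<open>\<psi>\<close> at \<open>x\<close> and \<open>\<phi>\<close> at \<open>y\<close>, converge simultaneously with probability one. The rest is deterministic.

  Three facts make the spectral subspaces behave well. First, the columns of \<open>T\<close> are
  orthonormal in the Euclidean sense, whatever the inner product is (\<open>coef_tuple_orthonormal\<close>), so
  that empirical tuples stay in a compact set. Second, for a fixed inner product \<open>T\<close> is unique up to
  a rotation (\<open>coef_tuple_unique_up_to_rotation\<close>), so neither the subspace nor the gap conditions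
  depend on choices. Third, limits of empirical tuples are tuples for the limit inner product
  (\<open>coef_tuple_convergent_subsequence\<close>), and empirical tuples exist eventually
  (\<open>coef_tuple_eventually_exists\<close>). The third fact rests on the description of a dominant basis as the
  first columns of a diagonalizing frame times a rotation (\<open>dominant_basis_iff_rotated_columns\<close>): frames and
  rotations range over compact sets, and the limit of diagonalizations is a diagonalization.

  Projections and the empirical Koopman operator are solutions of linear systems whose matrices are
  Gram matrices, and the solutions depend continuously on the data (\<open>convergent_inverses\<close>). For the
  limit operator the right-hand side is an integral against the joint law (\<open>koopman_weak_form\<close>), which
  is what the cross Gram matrices converge to. If the operator norms did not tend to \<open>0\<close>, functions
  in the unit ball could be chosen on which the operators stay apart. Passing to a
  subsequence along which the coefficients of these functions and of the empirical tuples converge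
  gives a contradiction (\<open>koopman_proj_op_norm_tendsto_0\<close>).
\<close>

section \<open>Diagonalization of real symmetric matrices\<close>

lemma bounded_family_convergent_subsequence:
  fixes f :: "nat \<Rightarrow> 'i \<Rightarrow> real"
  assumes "finite I" and "\<And>i. i \<in> I \<Longrightarrow> \<exists>B. \<forall>m. \<bar>f m i\<bar> \<le> B"
  shows "\<exists>s l. strict_mono (s :: nat \<Rightarrow> nat) \<and> (\<forall>i\<in>I. (\<lambda>m. f (s m) i) \<longlonglongrightarrow> l i)"
  using assms
proof (induction I rule: finite_induct)
  case empty
  show ?case by (intro exI[of _ id]) (auto simp: strict_mono_def)
next
  case (insert i I)
  from insert.IH insert.prems obtain s l where s: "strict_mono (s :: nat \<Rightarrow> nat)"
    and l: "\<And>j. j \<in> I \<Longrightarrow> (\<lambda>m. f (s m) j) \<longlonglongrightarrow> l j" by (metis insert_iff)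
  obtain B where B: "\<And>m. \<bar>f m i\<bar> \<le> B" using insert.prems by blast
  have "bounded (range (\<lambda>m. f (s m) i))"
    unfolding bounded_iff using B by (intro exI[of _ B]) auto
  from bounded_imp_convergent_subsequence[OF this] obtain c t where t: "strict_mono t"
    and c: "((\<lambda>m. f (s m) i) \<circ> t) \<longlonglongrightarrow> c" by blast
  have "strict_mono (s \<circ> t)" using s t by (simp add: strict_mono_o)
  moreover have "(\<lambda>m. f ((s \<circ> t) m) j) \<longlonglongrightarrow> (l(i := c)) j" if "j \<in> insert i I" for j
  proof (cases "j = i")
    case True then show ?thesis using c by (simp add: o_def)
  next
    case False
    then have "j \<in> I" using that by auto
    from LIMSEQ_subseq_LIMSEQ[OF l[OF this] t] show ?thesis using False by (simp add: o_def)
  qed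
  ultimately show ?case by blast
qed

definition orthonormal_frame :: "nat \<Rightarrow> (nat \<Rightarrow> nat \<Rightarrow> real) \<Rightarrow> bool" where
  "orthonormal_frame N q \<longleftrightarrow> (\<forall>i<N. \<forall>j<N. (\<Sum>a<N. q i a * q j a) = (if i = j then 1 else 0))"

lemma abs_le_1_if_sum_squares:
  fixes u :: "'i \<Rightarrow> real"
  assumes "finite I" "(\<Sum>a\<in>I. u a * u a) = 1" "a \<in> I"
  shows "\<bar>u a\<bar> \<le> 1"
proof -
  have "u a * u a \<le> (\<Sum>a\<in>I. u a * u a)"
    using assms by (intro member_le_sum) auto
  then show ?thesis using assms abs_le_square_iff[of "u a" 1] by (simp add: power2_eq_square)
qed

text \<open>Orthonormal frames form a compact set; only their entries enter, so continuity of \<open>F\<close> is demanded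
  for entrywise convergence.\<close>

lemma orthonormal_frame_maximizer:
  fixes F :: "(nat \<Rightarrow> nat \<Rightarrow> real) \<Rightarrow> real"
  assumes cont: "\<And>q l. (\<And>i a. i < N \<Longrightarrow> a < N \<Longrightarrow> (\<lambda>m. q m i a) \<longlonglongrightarrow> l i a) \<Longrightarrow> (\<lambda>m. F (q m)) \<longlonglongrightarrow> F l"
    and bdd: "\<And>q. orthonormal_frame N q \<Longrightarrow> F q \<le> B"
  shows "\<exists>q. orthonormal_frame N q \<and> (\<forall>q'. orthonormal_frame N q' \<longrightarrow> F q' \<le> F q)"
proof -
  let ?S = "F ` {q. orthonormal_frame N q}"
  have ne: "?S \<noteq> {}"
  proof -
    have "orthonormal_frame N (\<lambda>i a. if a = i then 1 else 0)"
      by (auto simp: orthonormal_frame_def if_distrib[of "\<lambda>z. z * _"] cong: if_cong)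
    then show ?thesis by blast
  qed
  have bd: "bdd_above ?S" using bdd by (auto intro!: bdd_aboveI[of _ B])
  have "\<exists>q. orthonormal_frame N q \<and> Sup ?S - 1 / Suc m < F q" for m :: nat
    using less_cSup_iff[OF ne bd, of "Sup ?S - 1 / Suc m"] by auto
  then obtain q where q: "\<And>m. orthonormal_frame N (q m)" "\<And>m. Sup ?S - 1 / Suc m < F (q m)" by metis
  have "\<exists>s l. strict_mono (s :: nat \<Rightarrow> nat) \<and>
      (\<forall>ia\<in>{..<N} \<times> {..<N}. (\<lambda>m. q (s m) (fst ia) (snd ia)) \<longlonglongrightarrow> l ia)"
  proof (rule bounded_family_convergent_subsequence[where f = "\<lambda>m ia. q m (fst ia) (snd ia)"])
    fix ia :: "nat \<times> nat" assume "ia \<in> {..<N} \<times> {..<N}"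
    then have "\<bar>q m (fst ia) (snd ia)\<bar> \<le> 1" for m
      using q(1)[of m] by (intro abs_le_1_if_sum_squares[of "{..<N}"]) (auto simp: orthonormal_frame_def)
    then show "\<exists>B. \<forall>m. \<bar>q m (fst ia) (snd ia)\<bar> \<le> B" by blast
  qed auto
  then obtain s l where s: "strict_mono (s :: nat \<Rightarrow> nat)"
    and l: "\<And>i a. i < N \<Longrightarrow> a < N \<Longrightarrow> (\<lambda>m. q (s m) i a) \<longlonglongrightarrow> l (i, a)" by fastforce
  define q0 where "q0 i a = l (i, a)" for i a
  have on: "orthonormal_frame N q0"
    unfolding orthonormal_frame_def
  proof (intro allI impI)
    fix i j assume ij: "i < N" "j < N"
    have "(\<lambda>m. \<Sum>a<N. q (s m) i a * q (s m) j a) \<longlonglongrightarrow> (\<Sum>a<N. q0 i a * q0 j a)"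
      using l ij by (auto intro!: tendsto_intros simp: q0_def)
    moreover have "(\<Sum>a<N. q (s m) i a * q (s m) j a) = (if i = j then 1 else 0)" for m
      using q(1)[of "s m"] ij by (auto simp: orthonormal_frame_def)
    ultimately show "(\<Sum>a<N. q0 i a * q0 j a) = (if i = j then 1 else 0)"
      by (simp add: LIMSEQ_const_iff)
  qed
  have lim: "(\<lambda>m. F (q (s m))) \<longlonglongrightarrow> F q0" using l by (intro cont) (auto simp: q0_def)
  have "(\<lambda>m. Sup ?S - 1 / Suc m) \<longlonglongrightarrow> Sup ?S - 0"
    by (intro tendsto_diff tendsto_const LIMSEQ_Suc[OF lim_1_over_n])
  then have "(\<lambda>m. Sup ?S - 1 / Suc (s m)) \<longlonglongrightarrow> Sup ?S"
    using LIMSEQ_subseq_LIMSEQ[OF _ s] by (auto simp: o_def)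
  then have "Sup ?S \<le> F q0"
    by (rule LIMSEQ_le[OF _ lim]) (use q(2) less_imp_le in blast)
  then show ?thesis using on bd by (intro exI[of _ q0]) (auto intro: order_trans[OF cSup_upper])
qed

definition bilinear_form :: "nat \<Rightarrow> (nat \<Rightarrow> nat \<Rightarrow> real) \<Rightarrow> (nat \<Rightarrow> real) \<Rightarrow> (nat \<Rightarrow> real) \<Rightarrow> real" where
  "bilinear_form N A u v = (\<Sum>a<N. \<Sum>b<N. u a * A a b * v b)"

text \<open>Maximize \<open>\<Sum>i. w i * \<langle>q i, A q i\<rangle>\<close> with strictly decreasing weights over all orthonormal frames
  \<open>q\<close>. Rotating a maximizer in the plane of \<open>q i\<close> and \<open>q j\<close> cannot increase the value. A quarter turn
  shows that the diagonal entries are sorted; infinitesimal turns show that the entry \<open>(i, j)\<close>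
  vanishes. So diagonalization and ordering of the eigenvalues come out of one argument.\<close>

lemma symmetric_orthonormal_diagonalization:
  fixes A :: "nat \<Rightarrow> nat \<Rightarrow> real"
  assumes sym: "\<And>a b. a < N \<Longrightarrow> b < N \<Longrightarrow> A a b = A b a"
  shows "\<exists>q. orthonormal_frame N q \<and>
    (\<forall>i<N. \<forall>j<N. i \<noteq> j \<longrightarrow> bilinear_form N A (q i) (q j) = 0) \<and>
    (\<forall>i j. i \<le> j \<longrightarrow> j < N \<longrightarrow> bilinear_form N A (q j) (q j) \<le> bilinear_form N A (q i) (q i))"
proof -
  define B where "B = bilinear_form N A"
  note B_sum = fun_cong[OF fun_cong[OF B_def], unfolded bilinear_form_def]
  \<comment> \<open>Any strictly decreasing weights would do.\<close>
  define w :: "nat \<Rightarrow> real" where "w i = - real i" for i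
  define F where "F q = (\<Sum>i<N. w i * B (q i) (q i))" for q
  have Bsym: "B u v = B v u" for u v
  proof -
    have "B u v = (\<Sum>b<N. \<Sum>a<N. u a * A a b * v b)" unfolding B_sum by (rule sum.swap)
    also have "\<dots> = B v u" unfolding B_sum using sym by (intro sum.cong refl) (simp add: mult_ac)
    finally show ?thesis .
  qed
  have "\<exists>q. orthonormal_frame N q \<and> (\<forall>q'. orthonormal_frame N q' \<longrightarrow> F q' \<le> F q)"
  proof (rule orthonormal_frame_maximizer)
    fix q :: "nat \<Rightarrow> nat \<Rightarrow> nat \<Rightarrow> real" and l
    assume "\<And>i a. i < N \<Longrightarrow> a < N \<Longrightarrow> (\<lambda>m. q m i a) \<longlonglongrightarrow> l i a"
    then show "(\<lambda>m. F (q m)) \<longlonglongrightarrow> F l"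
      unfolding F_def B_sum by (auto intro!: tendsto_intros)
  next
    fix q :: "nat \<Rightarrow> nat \<Rightarrow> real" assume q: "orthonormal_frame N q"
    have 1: "\<bar>q i a\<bar> \<le> 1" if "i < N" "a < N" for i a
      using q that by (intro abs_le_1_if_sum_squares[of "{..<N}"]) (auto simp: orthonormal_frame_def)
    have "F q \<le> (\<Sum>i<N. \<bar>w i\<bar> * (\<Sum>a<N. \<Sum>b<N. \<bar>A a b\<bar>))"
      unfolding F_def
    proof (intro sum_mono)
      fix i assume i: "i \<in> {..<N}"
      have "\<bar>B (q i) (q i)\<bar> \<le> (\<Sum>a<N. \<Sum>b<N. \<bar>A a b\<bar>)"
        unfolding B_sum
      proof (intro order_trans[OF sum_abs] sum_mono)
        fix a b assume "a \<in> {..<N}" "b \<in> {..<N}"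
        then have "\<bar>q i a\<bar> * \<bar>A a b\<bar> * \<bar>q i b\<bar> \<le> 1 * \<bar>A a b\<bar> * 1"
          using 1 i by (intro mult_mono) auto
        then show "\<bar>q i a * A a b * q i b\<bar> \<le> \<bar>A a b\<bar>" by (simp add: abs_mult)
      qed
      then have "\<bar>w i * B (q i) (q i)\<bar> \<le> \<bar>w i\<bar> * (\<Sum>a<N. \<Sum>b<N. \<bar>A a b\<bar>)"
        by (simp add: abs_mult mult_left_mono)
      then show "w i * B (q i) (q i) \<le> \<bar>w i\<bar> * (\<Sum>a<N. \<Sum>b<N. \<bar>A a b\<bar>)" by linarith
    qed
    then show "F q \<le> (\<Sum>i<N. \<bar>w i\<bar> * (\<Sum>a<N. \<Sum>b<N. \<bar>A a b\<bar>))" .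
  qed
  then obtain q where q: "orthonormal_frame N q"
    and max: "\<And>q'. orthonormal_frame N q' \<Longrightarrow> F q' \<le> F q" by blast
  have rot: "s\<^sup>2 * (B (q j) (q j) - B (q i) (q i)) + 2 * c * s * B (q i) (q j) \<le> 0"
    if ij: "i < j" "j < N" and cs: "c\<^sup>2 + s\<^sup>2 = 1" for i j and c s :: real
  proof -
    define q' where "q' = q(i := (\<lambda>a. c * q i a + s * q j a), j := (\<lambda>a. - s * q i a + c * q j a))"
    have q'i: "q' i = (\<lambda>a. c * q i a + s * q j a)" and q'j: "q' j = (\<lambda>a. - s * q i a + c * q j a)"
      and q'k: "\<And>k. k \<noteq> i \<Longrightarrow> k \<noteq> j \<Longrightarrow> q' k = q k" using ij by (auto simp: q'_def)
    define ip where "ip u v = (\<Sum>a<N. u a * v a)" for u v :: "nat \<Rightarrow> real"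
    have ipl: "ip (\<lambda>a. x * u a + y * v a) z = x * ip u z + y * ip v z" for x y u v z
      by (simp add: ip_def sum.distrib sum_distrib_left algebra_simps)
    have ipr: "ip z (\<lambda>a. x * u a + y * v a) = x * ip z u + y * ip z v" for x y u v z
      by (simp add: ip_def sum.distrib sum_distrib_left algebra_simps)
    have Bl: "B (\<lambda>a. x * u a + y * v a) z = x * B u z + y * B v z" for x y u v z
      by (simp add: B_sum sum.distrib sum_distrib_left algebra_simps)
    have Br: "B z (\<lambda>a. x * u a + y * v a) = x * B z u + y * B z v" for x y u v z
      by (simp add: B_sum sum.distrib sum_distrib_left algebra_simps)
    have o: "ip (q k) (q l) = (if k = l then 1 else 0)" if "k < N" "l < N" for k l
      using q that by (auto simp: orthonormal_frame_def ip_def)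
    have iN: "i < N" "i \<noteq> j" "j \<noteq> i" using ij by auto
    note oo = o[OF iN(1) iN(1)] o[OF iN(1) ij(2)] o[OF ij(2) iN(1)] o[OF ij(2) ij(2)]
    have ii: "ip (q' i) (q' i) = 1"
      unfolding q'i ipl ipr using oo iN cs by (simp add: power2_eq_square)
    have jj: "ip (q' j) (q' j) = 1"
      unfolding q'j ipl ipr using oo iN cs by (simp add: power2_eq_square)
    have ij': "ip (q' i) (q' j) = 0" "ip (q' j) (q' i) = 0"
      unfolding q'i q'j ipl ipr using oo iN by simp_all
    have ik: "ip (q' i) (q' k) = 0" "ip (q' k) (q' i) = 0" "ip (q' j) (q' k) = 0" "ip (q' k) (q' j) = 0"
      if "k < N" "k \<noteq> i" "k \<noteq> j" for k
      unfolding q'i q'j q'k[OF that(2,3)] ipl ipr using that iN ij(2) by (simp_all add: o)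
    have kl': "ip (q' k) (q' l) = (if k = l then 1 else 0)"
      if "k < N" "k \<noteq> i" "k \<noteq> j" "l < N" "l \<noteq> i" "l \<noteq> j" for k l
      unfolding q'k[OF that(2,3)] q'k[OF that(5,6)] using that(1,4) by (rule o)
    have "ip (q' k) (q' l) = (if k = l then 1 else 0)" if kl: "k < N" "l < N" for k l
    proof (cases "k = i \<or> k = j")
      case True
      then show ?thesis using kl iN by (cases "l = i \<or> l = j") (auto simp: ii jj ij' ik)
    next
      case False
      then show ?thesis using kl iN by (cases "l = i \<or> l = j") (auto simp: ik kl')
    qed
    then have "orthonormal_frame N q'" by (auto simp: orthonormal_frame_def ip_def)
    then have "F q' - F q \<le> 0" using max by simp
    moreover have "F q' - F q = (\<Sum>k\<in>{i,j}. w k * B (q' k) (q' k) - w k * B (q k) (q k))"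
      unfolding F_def sum_subtractf[symmetric]
      using ij q'k by (intro sum.mono_neutral_right) auto
    moreover have "\<dots> = (real j - real i) * (s\<^sup>2 * (B (q j) (q j) - B (q i) (q i)) + 2 * c * s * B (q i) (q j))"
    proof -
      have c2: "c\<^sup>2 = 1 - s\<^sup>2" using cs by simp
      have "B (q' i) (q' i) = c\<^sup>2 * B (q i) (q i) + 2 * c * s * B (q i) (q j) + s\<^sup>2 * B (q j) (q j)"
        unfolding q'i Bl Br using Bsym[of "q j" "q i"] by (simp add: power2_eq_square algebra_simps)
      note e1 = this
      have "B (q' j) (q' j) = s\<^sup>2 * B (q i) (q i) - 2 * c * s * B (q i) (q j) + c\<^sup>2 * B (q j) (q j)"
        unfolding q'j Bl Br using Bsym[of "q j" "q i"] by (simp add: power2_eq_square algebra_simps)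
      note e2 = this
      have "(\<Sum>k\<in>{i,j}. w k * B (q' k) (q' k) - w k * B (q k) (q k)) =
          (w i * B (q' i) (q' i) - w i * B (q i) (q i)) + (w j * B (q' j) (q' j) - w j * B (q j) (q j))"
        using ij by simp
      also have "\<dots> = (real j - real i) * (s\<^sup>2 * (B (q j) (q j) - B (q i) (q i)) + 2 * c * s * B (q i) (q j))"
        unfolding e1 e2 c2 w_def by (simp add: algebra_simps)
      finally show ?thesis .
    qed
    ultimately show ?thesis using ij by (simp add: mult_le_0_iff)
  qed
  have le: "B (q j) (q j) \<le> B (q i) (q i)" if "i \<le> j" "j < N" for i j
    using rot[of i j 0 1] that by (cases "i = j") auto
  have zero: "B (q i) (q j) = 0" if ij: "i < j" "j < N" for i j
  proof -
    define a b where "a = B (q i) (q i) - B (q j) (q j)" and "b = B (q i) (q j)"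
    have a: "a \<ge> 0" using le[of i j] ij by (simp add: a_def)
    \<comment> \<open>In the direction \<open>(1, t)\<close> the rotation inequality reads \<open>2 t b \<le> t\<^sup>2 a\<close>. For \<open>b \<noteq> 0\<close> it fails for
      small \<open>t\<close> of the sign of \<open>b\<close>; this \<open>t\<close> is small enough.\<close>
    define t where "t = b / (a + 1)"
    have n: "1 + t\<^sup>2 > 0" by (simp add: add_pos_nonneg)
    have "(t / sqrt (1 + t\<^sup>2))\<^sup>2 * (- a) + 2 * (1 / sqrt (1 + t\<^sup>2)) * (t / sqrt (1 + t\<^sup>2)) * b \<le> 0"
      using rot[OF ij, of "1 / sqrt (1 + t\<^sup>2)" "t / sqrt (1 + t\<^sup>2)"] n
      by (simp add: a_def b_def power_divide add_divide_distrib[symmetric])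
    also have "(t / sqrt (1 + t\<^sup>2))\<^sup>2 * (- a) + 2 * (1 / sqrt (1 + t\<^sup>2)) * (t / sqrt (1 + t\<^sup>2)) * b =
        (2 * t * b - t\<^sup>2 * a) / (1 + t\<^sup>2)"
      using n by (simp add: power_divide diff_divide_distrib)
    finally have "2 * t * b \<le> t\<^sup>2 * a" using n by (simp add: divide_le_0_iff)
    then have "2 * t * b * (a + 1)\<^sup>2 \<le> t\<^sup>2 * a * (a + 1)\<^sup>2" by (intro mult_right_mono) auto
    moreover have "t * (a + 1) = b" using a by (simp add: t_def)
    ultimately have "2 * b * b * (a + 1) \<le> b * b * a"
      by (simp add: power2_eq_square mult.assoc[symmetric])
         (metis (no_types, lifting) mult.commute mult.left_commute)
    then have "b * b * (a + 2) \<le> 0" by (simp add: algebra_simps)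
    then have "b * b \<le> 0" using a by (simp add: mult_le_0_iff)
    then show ?thesis using b_def by (metis mult_eq_0_iff not_square_less_zero order_le_less)
  qed
  have "B (q i) (q j) = 0" if "i < N" "j < N" "i \<noteq> j" for i j
    using zero[of i j] zero[of j i] Bsym[of "q i" "q j"] that by (cases "i < j") auto
  then show ?thesis using q le by (intro exI[of _ q] conjI allI impI) (simp_all add: B_def)
qed

definition diagonal :: "nat \<Rightarrow> (nat \<Rightarrow> real) \<Rightarrow> real mat" where
  "diagonal N d = Matrix.mat N N (\<lambda>(i, j). if i = j then d i else 0)"

text \<open>A spectral decomposition with eigenvalues in descending order.\<close>

definition sorted_diagonalization :: "nat \<Rightarrow> real mat \<Rightarrow> real mat \<Rightarrow> (nat \<Rightarrow> real) \<Rightarrow> bool" where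
  "sorted_diagonalization N A Q d \<longleftrightarrow>
     Q \<in> carrier_mat N N \<and> Q\<^sup>T * Q = 1\<^sub>m N \<and>
     (\<forall>i j. i \<le> j \<longrightarrow> j < N \<longrightarrow> d j \<le> d i) \<and>
     A = Q * diagonal N d * Q\<^sup>T"

lemma diagonal_carrier [simp]: "diagonal N d \<in> carrier_mat N N"
  by (simp add: diagonal_def)

lemma mult_mat_entry:
  fixes A B :: "real mat"
  assumes "A \<in> carrier_mat n k" "B \<in> carrier_mat k m" "i < n" "j < m"
  shows "(A * B) $$ (i, j) = (\<Sum>l<k. A $$ (i, l) * B $$ (l, j))"
  using assms by (auto simp: scalar_prod_def atLeast0LessThan intro!: sum.cong)

lemma orthonormal_columns_iff:
  fixes Q :: "real mat"
  assumes "Q \<in> carrier_mat N r"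
  shows "Q\<^sup>T * Q = 1\<^sub>m r \<longleftrightarrow>
    (\<forall>i<r. \<forall>j<r. (\<Sum>a<N. Q $$ (a, i) * Q $$ (a, j)) = (if i = j then 1 else 0))"
proof -
  have QT: "Q\<^sup>T \<in> carrier_mat r N" using assms by simp
  have e: "(Q\<^sup>T * Q) $$ (i, j) = (\<Sum>a<N. Q $$ (a, i) * Q $$ (a, j))" if "i < r" "j < r" for i j
    using that assms by (subst mult_mat_entry[OF QT assms]) auto
  show ?thesis
  proof (intro iffI allI impI)
    fix i j assume "Q\<^sup>T * Q = 1\<^sub>m r" "i < r" "j < r"
    then show "(\<Sum>a<N. Q $$ (a, i) * Q $$ (a, j)) = (if i = j then 1 else 0)" using e[of i j] by simp
  next
    assume *: "\<forall>i<r. \<forall>j<r. (\<Sum>a<N. Q $$ (a, i) * Q $$ (a, j)) = (if i = j then 1 else 0)"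
    show "Q\<^sup>T * Q = 1\<^sub>m r"
    proof (rule eq_matI)
      fix i j assume "i < dim_row (1\<^sub>m r :: real mat)" "j < dim_col (1\<^sub>m r :: real mat)"
      then have ij: "i < r" "j < r" by auto
      then show "(Q\<^sup>T * Q) $$ (i, j) = (1\<^sub>m r :: real mat) $$ (i, j)"
        using e[OF ij] * by simp
    qed (use assms in auto)
  qed
qed

lemma symmetric_has_sorted_diagonalization:
  fixes A :: "real mat"
  assumes A: "A \<in> carrier_mat N N"
    and sym: "\<And>a b. a < N \<Longrightarrow> b < N \<Longrightarrow> A $$ (a, b) = A $$ (b, a)"
  shows "\<exists>Q d. sorted_diagonalization N A Q d"
proof -
  let ?B = "bilinear_form N (\<lambda>a b. A $$ (a, b))"
  have "\<exists>q. orthonormal_frame N q \<and> (\<forall>i<N. \<forall>j<N. i \<noteq> j \<longrightarrow> ?B (q i) (q j) = 0) \<and>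
      (\<forall>i j. i \<le> j \<longrightarrow> j < N \<longrightarrow> ?B (q j) (q j) \<le> ?B (q i) (q i))"
    by (rule symmetric_orthonormal_diagonalization) (rule sym)
  then obtain q where on: "orthonormal_frame N q"
    and off: "\<And>i j. i < N \<Longrightarrow> j < N \<Longrightarrow> i \<noteq> j \<Longrightarrow> ?B (q i) (q j) = 0"
    and ord: "\<And>i j. i \<le> j \<Longrightarrow> j < N \<Longrightarrow> ?B (q j) (q j) \<le> ?B (q i) (q i)"
    by auto
  define d where "d i = ?B (q i) (q i)" for i
  define Q where "Q = Matrix.mat N N (\<lambda>(a, i). q i a)"
  have Q: "Q \<in> carrier_mat N N" by (simp add: Q_def)
  have QT: "Q\<^sup>T \<in> carrier_mat N N" using Q by simp
  have QTQ: "Q\<^sup>T * Q = 1\<^sub>m N"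
    unfolding orthonormal_columns_iff[OF Q] using on by (auto simp: orthonormal_frame_def Q_def)
  have QQT: "Q * Q\<^sup>T = 1\<^sub>m N" by (rule mat_mult_left_right_inverse[OF QT Q QTQ])
  have D: "Q\<^sup>T * A * Q = diagonal N d"
  proof (rule eq_matI)
    fix i j assume "i < dim_row (diagonal N d)" "j < dim_col (diagonal N d)"
    then have ij: "i < N" "j < N" by (auto simp: diagonal_def)
    have QTA: "Q\<^sup>T * A \<in> carrier_mat N N" using QT A by simp
    have "(Q\<^sup>T * A * Q) $$ (i, j) = (\<Sum>b<N. (Q\<^sup>T * A) $$ (i, b) * Q $$ (b, j))"
      by (rule mult_mat_entry[OF QTA Q ij])
    also have "\<dots> = (\<Sum>b<N. (\<Sum>a<N. q i a * A $$ (a, b)) * q j b)"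
    proof (intro sum.cong refl, goal_cases)
      case (1 b)
      then have "(Q\<^sup>T * A) $$ (i, b) = (\<Sum>a<N. q i a * A $$ (a, b))"
        using ij by (subst mult_mat_entry[OF QT A]) (auto simp: Q_def)
      then show ?case using 1 ij by (simp add: Q_def)
    qed
    also have "\<dots> = ?B (q i) (q j)"
      unfolding sum_distrib_right bilinear_form_def by (rule sum.swap)
    finally show "(Q\<^sup>T * A * Q) $$ (i, j) = diagonal N d $$ (i, j)"
      using ij off by (auto simp: diagonal_def d_def)
  qed (use Q A in \<open>auto simp: diagonal_def\<close>)
  have "Q * diagonal N d * Q\<^sup>T = (Q * Q\<^sup>T) * A * (Q * Q\<^sup>T)"
    unfolding D[symmetric] using Q QT A
    by (simp add: assoc_mult_mat[where ?n\<^sub>1.0 = N and ?n\<^sub>2.0 = N and ?n\<^sub>3.0 = N and ?n\<^sub>4.0 = N])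
  also have "\<dots> = A" unfolding QQT using A by simp
  finally have "A = Q * diagonal N d * Q\<^sup>T" by simp
  then show ?thesis
    unfolding sorted_diagonalization_def using Q QTQ ord by (intro exI[of _ Q] exI[of _ d]) (auto simp: d_def)
qed

lemma proots_prod_linear_factors:
  "proots (\<Prod>a\<leftarrow>xs. [:- a, 1 :: 'a :: idom:]) = mset xs"
proof (induction xs)
  case (Cons a xs)
  have "(\<Prod>a\<leftarrow>xs. [:- a, 1:]) \<noteq> 0" by (auto simp: prod_list_zero_iff)
  then show ?case using Cons by (simp add: proots_mult del: mult_pCons_left)
qed simp

text \<open>\<open>eigval\<close> is defined by the roots of the characteristic polynomial, which similarity preserves, so
  it can be read off any sorted diagonalization. The index shift occurs because \<open>eigval\<close> counts from 1.\<close>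

lemma eigval_sorted_diagonalization:
  assumes "sorted_diagonalization N A Q d"
  shows "eigval A j = (if 1 \<le> j \<and> j \<le> N then d (j - 1) else 0)"
proof -
  have Q: "Q \<in> carrier_mat N N" and QTQ: "Q\<^sup>T * Q = 1\<^sub>m N"
    and ord: "\<And>i j. i \<le> j \<Longrightarrow> j < N \<Longrightarrow> d j \<le> d i"
    and A: "A = Q * diagonal N d * Q\<^sup>T"
    using assms by (auto simp: sorted_diagonalization_def)
  have QT: "Q\<^sup>T \<in> carrier_mat N N" using Q by simp
  have QQT: "Q * Q\<^sup>T = 1\<^sub>m N" by (rule mat_mult_left_right_inverse[OF QT Q QTQ])
  have "similar_mat A (diagonal N d)"
    by (rule similar_matI[where P = Q and Q = "Q\<^sup>T" and n = N]) (use Q QT QTQ QQT A in auto)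
  then have "char_poly A = char_poly (diagonal N d)" by (rule char_poly_similar)
  also have "\<dots> = (\<Prod>a\<leftarrow>diag_mat (diagonal N d). [:- a, 1:])"
    by (rule char_poly_upper_triangular[OF diagonal_carrier])
       (auto simp: diagonal_def upper_triangular_def)
  also have "diag_mat (diagonal N d) = map d [0..<N]"
    by (auto simp: diag_mat_def diagonal_def)
  finally have "char_poly A = (\<Prod>a\<leftarrow>map d [0..<N]. [:- a, 1:])" .
  then have p: "proots (char_poly A) = mset (map d [0..<N])"
    by (simp only: proots_prod_linear_factors)
  have "sorted (rev (map d [0..<N]))"
    using ord by (auto simp: sorted_rev_iff_nth_mono)
  then have "sort (map d [0..<N]) = rev (map d [0..<N])"
    by (intro properties_for_sort) auto
  then have "rev (sorted_list_of_multiset (proots (char_poly A))) = map d [0..<N]"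
    by (simp only: p sorted_list_of_multiset_mset rev_rev_ident)
  then show ?thesis by (auto simp: eigval_def Let_def)
qed

section \<open>Dominant eigenspaces\<close>

definition first_columns :: "nat \<Rightarrow> nat \<Rightarrow> real mat \<Rightarrow> real mat" where
  "first_columns N r Q = Matrix.mat N r (\<lambda>(i, j). Q $$ (i, j))"

lemma first_columns_carrier [simp]: "first_columns N r Q \<in> carrier_mat N r"
  by (simp add: first_columns_def)

text \<open>By the gap, an eigenvector for one of the \<open>r\<close> largest eigenvalues is orthogonal to all columns of
  \<open>Q\<close> beyond the \<open>r\<close>-th. Hence the dominant eigenspace is the span of the first \<open>r\<close> columns, and its
  orthonormal bases are the rotations of these columns. In this form the notion is visibly stable
  under limits and under conjugation. For \<open>r = N\<close> the eigenspace is everything.\<close>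

lemma dominant_basis_iff_rotated_columns:
  assumes sd: "sorted_diagonalization N A Q d" and r: "1 \<le> r" "r \<le> N"
    and gap: "r < N \<Longrightarrow> d r < d (r - 1)"
  shows "dominant_basis A r U \<longleftrightarrow>
    (\<exists>R. R \<in> carrier_mat r r \<and> R\<^sup>T * R = 1\<^sub>m r \<and> U = first_columns N r Q * R)"
proof -
  have Q: "Q \<in> carrier_mat N N" and QTQ: "Q\<^sup>T * Q = 1\<^sub>m N"
    and ord: "\<And>i j. i \<le> j \<Longrightarrow> j < N \<Longrightarrow> d j \<le> d i"
    and A: "A = Q * diagonal N d * Q\<^sup>T"
    using sd by (auto simp: sorted_diagonalization_def)
  have QT: "Q\<^sup>T \<in> carrier_mat N N" using Q by simp
  have QQT: "Q * Q\<^sup>T = 1\<^sub>m N" by (rule mat_mult_left_right_inverse[OF QT Q QTQ])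
  have Ac: "A \<in> carrier_mat N N" unfolding A by (intro mult_carrier_mat[of _ _ N] Q QT diagonal_carrier)
  then have dA: "dim_row A = N" by simp
  define Qr where "Qr = first_columns N r Q"
  have Qr: "Qr \<in> carrier_mat N r" and QrT: "Qr\<^sup>T \<in> carrier_mat r N" by (auto simp: Qr_def)
  have QrTQr: "Qr\<^sup>T * Qr = 1\<^sub>m r"
    using QTQ r unfolding orthonormal_columns_iff[OF Q] orthonormal_columns_iff[OF Qr]
    by (auto simp: Qr_def first_columns_def)
  interpret V: vec_space "TYPE(real)" N .
  have cs: "V.col_space B = {B *\<^sub>v x | x. x \<in> carrier_vec k}" if "B \<in> carrier_mat N k" for B k
    using V.col_space_eq[OF that] that by (auto intro: mult_mat_vec_carrier)
  define E where "E = {v. \<exists>j\<in>{1..r}. eigenvector A v (eigval A j)}"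
  have E1: "E \<subseteq> V.col_space Qr"
  proof
    fix v assume "v \<in> E"
    then obtain j where j: "1 \<le> j" "j \<le> r" and ev: "eigenvector A v (eigval A j)"
      by (auto simp: E_def)
    have v: "v \<in> carrier_vec N" and Av: "A *\<^sub>v v = d (j - 1) \<cdot>\<^sub>v v"
      using ev j r by (auto simp: eigenvector_def dA eigval_sorted_diagonalization[OF sd])
    define c where "c = Q\<^sup>T *\<^sub>v v"
    have c: "c \<in> carrier_vec N" using v QT by (simp add: c_def)
    have vc: "v = Q *\<^sub>v c"
      unfolding c_def using v Q QT by (simp add: assoc_mult_mat_vec[OF Q QT v, symmetric] QQT)
    have "diagonal N d *\<^sub>v c = Q\<^sup>T *\<^sub>v (A *\<^sub>v v)"
    proof -
      have "Q\<^sup>T *\<^sub>v (A *\<^sub>v v) = Q\<^sup>T *\<^sub>v (Q *\<^sub>v (diagonal N d *\<^sub>v c))"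
        unfolding A c_def using Q QT v by (simp add: assoc_mult_mat_vec[where ?n\<^sub>1.0 = N and ?n\<^sub>2.0 = N and ?n\<^sub>3.0 = N])
      also have "\<dots> = (Q\<^sup>T * Q) *\<^sub>v (diagonal N d *\<^sub>v c)"
        by (rule assoc_mult_mat_vec[OF QT Q mult_mat_vec_carrier[OF diagonal_carrier c], symmetric])
      finally show ?thesis
        by (simp only: QTQ one_mult_mat_vec[OF mult_mat_vec_carrier[OF diagonal_carrier c]])
    qed
    also have "\<dots> = d (j - 1) \<cdot>\<^sub>v c" unfolding Av c_def using QT v by (simp add: mult_mat_vec)
    finally have dc: "diagonal N d *\<^sub>v c = d (j - 1) \<cdot>\<^sub>v c" .
    have c0: "vec_index c i = 0" if i: "r \<le> i" "i < N" for i
    proof -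
      have "vec_index (diagonal N d *\<^sub>v c) i = d i * vec_index c i"
        using i c by (simp add: diagonal_def scalar_prod_def if_distrib[of "\<lambda>z. z * _"] cong: if_cong)
      then have "d i * vec_index c i = d (j - 1) * vec_index c i"
        unfolding dc using i c by auto
      moreover have "d i < d (j - 1)" 
      proof -
        have "d i \<le> d r" using i by (intro ord)
        also have "\<dots> < d (r - 1)" using i by (intro gap) simp
        also have "\<dots> \<le> d (j - 1)" using j r by (intro ord) auto
        finally show ?thesis .
      qed
      ultimately show ?thesis by simp
    qed
    define c' where "c' = Matrix.vec r (\<lambda>i. vec_index c i)"
    have "v = Qr *\<^sub>v c'"
    proof (rule eq_vecI)
      fix i assume "i < dim_vec (Qr *\<^sub>v c')"
      then have i: "i < N" using Qr by simp
      have "vec_index v i = (\<Sum>l\<in>{0..<N}. Q $$ (i, l) * vec_index c l)"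
        unfolding vc using Q i c by (simp add: scalar_prod_def)
      also have "\<dots> = (\<Sum>l\<in>{0..<r}. Q $$ (i, l) * vec_index c l)"
        using r c0 by (intro sum.mono_neutral_right) auto
      also have "\<dots> = vec_index (Qr *\<^sub>v c') i"
        using i by (simp add: scalar_prod_def Qr_def first_columns_def c'_def)
      finally show "vec_index v i = vec_index (Qr *\<^sub>v c') i" .
    qed (use v Qr in auto)
    then show "v \<in> V.col_space Qr" unfolding cs[OF Qr] by (auto simp: c'_def)
  qed
  have E2: "set (cols Qr) \<subseteq> E"
  proof
    fix v assume "v \<in> set (cols Qr)"
    then obtain j where j: "j < r" and v: "v = col Qr j" using Qr by (auto simp: cols_def)
    have jN: "j < N" using j r by simp
    have vQ: "v = col Q j"
      unfolding v using j jN Q by (intro eq_vecI) (auto simp: Qr_def first_columns_def)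
    have vc: "v \<in> carrier_vec N" using Q vQ jN by (metis carrier_matD(1) col_dim)
    have QTv: "Q\<^sup>T *\<^sub>v v = unit_vec N j"
    proof -
      have "Q\<^sup>T *\<^sub>v v = col (Q\<^sup>T * Q) j"
        unfolding vQ using Q jN by (intro eq_vecI) auto
      then show ?thesis using jN by (simp add: QTQ)
    qed
    have "A *\<^sub>v v = Q *\<^sub>v (diagonal N d *\<^sub>v (Q\<^sup>T *\<^sub>v v))"
      unfolding A using Q QT vc by (simp add: assoc_mult_mat_vec[where ?n\<^sub>1.0 = N and ?n\<^sub>2.0 = N and ?n\<^sub>3.0 = N])
    also have "diagonal N d *\<^sub>v (Q\<^sup>T *\<^sub>v v) = d j \<cdot>\<^sub>v (Q\<^sup>T *\<^sub>v v)"
      unfolding QTv using jN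
      by (intro eq_vecI) (auto simp: diagonal_def scalar_prod_def unit_vec_def if_distrib[of "\<lambda>z. z * _"] cong: if_cong)
    also have "Q *\<^sub>v \<dots> = d j \<cdot>\<^sub>v (Q *\<^sub>v (Q\<^sup>T *\<^sub>v v))"
      using Q QT vc by (intro mult_mat_vec) auto
    also have "Q *\<^sub>v (Q\<^sup>T *\<^sub>v v) = v"
      using Q QT vc by (simp add: assoc_mult_mat_vec[symmetric, where ?n\<^sub>1.0 = N and ?n\<^sub>2.0 = N and ?n\<^sub>3.0 = N] QQT)
    finally have Av: "A *\<^sub>v v = d j \<cdot>\<^sub>v v" .
    have "v \<noteq> 0\<^sub>v N"
    proof
      assume "v = 0\<^sub>v N"
      then have "Q\<^sup>T *\<^sub>v v = 0\<^sub>v N" using QT by auto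
      then have "vec_index (unit_vec N j :: real vec) j = vec_index (0\<^sub>v N) j" using QTv by simp
      then show False using jN by simp
    qed
    then have "eigenvector A v (d j)" using Av vc by (simp add: eigenvector_def dA)
    then have "eigenvector A v (eigval A (Suc j))" using jN eigval_sorted_diagonalization[OF sd, of "Suc j"] by simp
    then show "v \<in> E" using j by (auto simp: E_def intro!: bexI[of _ "Suc j"])
  qed
  have Ec: "E \<subseteq> carrier_vec N" by (auto simp: E_def eigenvector_def dA)
  have colsc: "set (cols Qr) \<subseteq> carrier_vec N" using Qr cols_dim by blast
  have spanE: "V.span E = V.col_space Qr"
  proof
    show "V.span E \<subseteq> V.col_space Qr"
      using E1 colsc unfolding V.col_space_def by (simp add: V.span_subsetI)
    show "V.col_space Qr \<subseteq> V.span E"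
      unfolding V.col_space_def by (rule V.span_is_monotone[OF E2])
  qed
  have db: "dominant_basis A r U \<longleftrightarrow> U \<in> carrier_mat N r \<and> U\<^sup>T * U = 1\<^sub>m r
      \<and> V.col_space U = V.col_space Qr"
    unfolding dominant_basis_def dA spanE[unfolded E_def] by simp
  show ?thesis
    unfolding db Qr_def[symmetric]
  proof (intro iffI; elim conjE exE)
    assume U: "U \<in> carrier_mat N r" and UTU: "U\<^sup>T * U = 1\<^sub>m r"
      and csU: "V.col_space U = V.col_space Qr"
    define R where "R = Qr\<^sup>T * U"
    have R: "R \<in> carrier_mat r r" using QrT U by (simp add: R_def)
    have "U = Qr * R"
    proof (rule mat_col_eqI)
      fix j assume "j < dim_col (Qr * R)"
      then have j: "j < r" using R by simp
      have cU: "col U j \<in> carrier_vec N" using U by (metis carrier_matD(1) col_dim)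
      have "col U j = U *\<^sub>v unit_vec r j" using U j by auto
      then have "col U j \<in> V.col_space U" unfolding cs[OF U] by auto
      then obtain x where x: "x \<in> carrier_vec r" and Ux: "col U j = Qr *\<^sub>v x"
        unfolding csU cs[OF Qr] by auto
      have "Qr\<^sup>T *\<^sub>v (Qr *\<^sub>v x) = x"
        using x by (simp add: assoc_mult_mat_vec[OF QrT Qr x, symmetric] QrTQr)
      then have "col R j = x" unfolding R_def using QrT U j Ux by (subst col_mult2) auto
      then show "col U j = col (Qr * R) j" using Qr R j Ux by (subst col_mult2[OF Qr R]) auto
    qed (use U Qr R in auto)
    moreover have "R\<^sup>T * R = 1\<^sub>m r"
    proof -
      have "1\<^sub>m r = (Qr * R)\<^sup>T * (Qr * R)" using UTU \<open>U = Qr * R\<close> by simp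
      also have "\<dots> = R\<^sup>T * (Qr\<^sup>T * Qr) * R"
        unfolding transpose_mult[OF Qr R] using R Qr QrT
        by (simp add: assoc_mult_mat[of _ r r _ r _ r] assoc_mult_mat[of _ r r _ N _ r]
            assoc_mult_mat[of _ r N _ r _ r] transpose_carrier_mat)
      finally show ?thesis using R by (simp add: QrTQr)
    qed
    ultimately show "\<exists>R. R \<in> carrier_mat r r \<and> R\<^sup>T * R = 1\<^sub>m r \<and> U = Qr * R" using R by blast
  next
    fix R assume R: "R \<in> carrier_mat r r" and RTR: "R\<^sup>T * R = 1\<^sub>m r" and U: "U = Qr * R"
    have RT: "R\<^sup>T \<in> carrier_mat r r" using R by simp
    have RRT: "R * R\<^sup>T = 1\<^sub>m r" by (rule mat_mult_left_right_inverse[OF RT R RTR])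
    have Uc: "U \<in> carrier_mat N r" using U Qr R by simp
    have "U\<^sup>T * U = R\<^sup>T * (Qr\<^sup>T * Qr) * R"
      unfolding U transpose_mult[OF Qr R] using R Qr QrT
      by (simp add: assoc_mult_mat[of _ r r _ r _ r] assoc_mult_mat[of _ r r _ N _ r]
          assoc_mult_mat[of _ r N _ r _ r] transpose_carrier_mat)
    then have UTU: "U\<^sup>T * U = 1\<^sub>m r" using R RTR by (simp add: QrTQr)
    have "V.col_space U = V.col_space Qr"
      unfolding cs[OF Uc] cs[OF Qr]
    proof (intro equalityI subsetI; elim CollectE exE conjE)
      fix v x assume "v = U *\<^sub>v x" "x \<in> carrier_vec r"
      then show "v \<in> {Qr *\<^sub>v x |x. x \<in> carrier_vec r}"
        using R Qr by (auto simp: U assoc_mult_mat_vec[OF Qr R] intro!: exI[of _ "R *\<^sub>v x"])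
    next
      fix v x assume vx: "v = Qr *\<^sub>v x" "x \<in> carrier_vec r"
      have "U *\<^sub>v (R\<^sup>T *\<^sub>v x) = Qr *\<^sub>v ((R * R\<^sup>T) *\<^sub>v x)"
        unfolding U using vx(2) R RT Qr
        by (simp add: assoc_mult_mat_vec[OF Qr R] assoc_mult_mat_vec[OF R RT])
      then show "v \<in> {U *\<^sub>v x |x. x \<in> carrier_vec r}"
        using vx RT by (auto simp: RRT intro!: exI[of _ "R\<^sup>T *\<^sub>v x"])
    qed
    then show "U \<in> carrier_mat N r \<and> U\<^sup>T * U = 1\<^sub>m r \<and> V.col_space U = V.col_space Qr"
      using Uc UTU by blast
  qed
qed

section \<open>Limits and conjugates of diagonalizations\<close>

text \<open>A formulation by polynomial equations and weak inequalities between entries, which pass to limits.\<close>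

lemma sorted_diagonalization_entries:
  "sorted_diagonalization N A Q d \<longleftrightarrow>
     Q \<in> carrier_mat N N \<and> A \<in> carrier_mat N N \<and>
     (\<forall>i<N. \<forall>j<N. (\<Sum>a<N. Q $$ (a, i) * Q $$ (a, j)) = (if i = j then 1 else 0)) \<and>
     (\<forall>i j. i \<le> j \<longrightarrow> j < N \<longrightarrow> d j \<le> d i) \<and>
     (\<forall>i<N. \<forall>j<N. A $$ (i, j) = (\<Sum>l<N. Q $$ (i, l) * d l * Q $$ (j, l)))"
proof (cases "Q \<in> carrier_mat N N")
  case Q: True
  have QT: "Q\<^sup>T \<in> carrier_mat N N" using Q by simp
  have QD: "Q * diagonal N d \<in> carrier_mat N N" using Q by simp
  have e: "(Q * diagonal N d * Q\<^sup>T) $$ (i, j) = (\<Sum>l<N. Q $$ (i, l) * d l * Q $$ (j, l))"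
    if ij: "i < N" "j < N" for i j
  proof -
    have "(Q * diagonal N d * Q\<^sup>T) $$ (i, j)
        = (\<Sum>l<N. (Q * diagonal N d) $$ (i, l) * Q\<^sup>T $$ (l, j))"
      by (rule mult_mat_entry[OF QD QT ij])
    also have "\<dots> = (\<Sum>l<N. Q $$ (i, l) * d l * Q $$ (j, l))"
    proof (intro sum.cong refl)
      fix l assume l: "l \<in> {..<N}"
      have "(Q * diagonal N d) $$ (i, l) = (\<Sum>a<N. Q $$ (i, a) * diagonal N d $$ (a, l))"
        using ij l by (intro mult_mat_entry[OF Q diagonal_carrier]) auto
      also have "\<dots> = (\<Sum>a<N. if a = l then Q $$ (i, a) * d a else 0)"
        using l by (intro sum.cong refl) (auto simp: diagonal_def)
      also have "\<dots> = Q $$ (i, l) * d l" using l by simp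
      finally show "(Q * diagonal N d) $$ (i, l) * Q\<^sup>T $$ (l, j) = Q $$ (i, l) * d l * Q $$ (j, l)"
        using l ij Q by simp
    qed
    finally show ?thesis .
  qed
  have "A = Q * diagonal N d * Q\<^sup>T \<longleftrightarrow> A \<in> carrier_mat N N \<and>
     (\<forall>i<N. \<forall>j<N. A $$ (i, j) = (\<Sum>l<N. Q $$ (i, l) * d l * Q $$ (j, l)))"
  proof (intro iffI conjI allI impI)
    assume A: "A = Q * diagonal N d * Q\<^sup>T"
    show "A \<in> carrier_mat N N" unfolding A by (rule mult_carrier_mat[OF QD QT])
    fix i j assume "i < N" "j < N"
    then show "A $$ (i, j) = (\<Sum>l<N. Q $$ (i, l) * d l * Q $$ (j, l))" unfolding A by (rule e)
  next
    assume "A \<in> carrier_mat N N \<and>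
     (\<forall>i<N. \<forall>j<N. A $$ (i, j) = (\<Sum>l<N. Q $$ (i, l) * d l * Q $$ (j, l)))"
    then show "A = Q * diagonal N d * Q\<^sup>T"
      using e Q by (intro eq_matI) auto
  qed
  note eq = this
  show ?thesis
    by (simp only: sorted_diagonalization_def orthonormal_columns_iff[OF Q] eq Q simp_thms conj_ac)
qed (auto simp: sorted_diagonalization_def)

text \<open>The eigenvalues are continuous functions of the matrix and the frame. So once the frames converge,
  the eigenvalues do.\<close>

lemma sorted_diagonalization_diagonal_entry:
  assumes "sorted_diagonalization N A Q d" and l: "l < N"
  shows "d l = (\<Sum>a<N. \<Sum>b<N. Q $$ (a, l) * A $$ (a, b) * Q $$ (b, l))"
proof -
  have on: "\<And>i j. i < N \<Longrightarrow> j < N \<Longrightarrow> (\<Sum>a<N. Q $$ (a, i) * Q $$ (a, j)) = (if i = j then 1 else 0)"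
    and A: "\<And>i j. i < N \<Longrightarrow> j < N \<Longrightarrow> A $$ (i, j) = (\<Sum>l<N. Q $$ (i, l) * d l * Q $$ (j, l))"
    using assms(1) unfolding sorted_diagonalization_entries by auto
  let ?F = "\<lambda>a b i. Q $$ (a, l) * (Q $$ (a, i) * d i * Q $$ (b, i)) * Q $$ (b, l)"
  have "(\<Sum>a<N. \<Sum>b<N. Q $$ (a, l) * A $$ (a, b) * Q $$ (b, l)) = (\<Sum>a<N. \<Sum>b<N. \<Sum>i<N. ?F a b i)"
    by (intro sum.cong refl) (simp add: A sum_distrib_left sum_distrib_right)
  also have "\<dots> = (\<Sum>a<N. \<Sum>i<N. \<Sum>b<N. ?F a b i)"
    by (rule sum.cong[OF refl], rule sum.swap)
  also have "\<dots> = (\<Sum>a<N. \<Sum>i<N. Q $$ (a, l) * Q $$ (a, i) * d i * (\<Sum>b<N. Q $$ (b, i) * Q $$ (b, l)))"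
    by (intro sum.cong refl) (simp add: sum_distrib_left mult.assoc mult.left_commute)
  also have "\<dots> = (\<Sum>a<N. \<Sum>i<N. if i = l then Q $$ (a, l) * Q $$ (a, i) * d i else 0)"
    using l by (intro sum.cong refl) (auto simp: on)
  also have "\<dots> = (\<Sum>a<N. Q $$ (a, l) * Q $$ (a, l)) * d l"
    using l by (simp add: sum_distrib_right)
  finally show ?thesis using l by (simp add: on)
qed

lemma orthonormal_columns_bound:
  fixes Q :: "real mat"
  assumes "Q \<in> carrier_mat N r" "Q\<^sup>T * Q = 1\<^sub>m r" "a < N" "i < r"
  shows "\<bar>Q $$ (a, i)\<bar> \<le> 1"
  using assms by (intro abs_le_1_if_sum_squares[of "{..<N}"]) (auto simp: orthonormal_columns_iff[OF assms(1)])

text \<open>Compactness of the Stiefel manifold.\<close>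

lemma orthonormal_columns_convergent_subsequence:
  fixes Q :: "nat \<Rightarrow> real mat"
  assumes Q: "\<And>m. Q m \<in> carrier_mat N r" and on: "\<And>m. (Q m)\<^sup>T * Q m = 1\<^sub>m r"
  shows "\<exists>s Q'. strict_mono (s :: nat \<Rightarrow> nat) \<and> Q' \<in> carrier_mat N r \<and> Q'\<^sup>T * Q' = 1\<^sub>m r \<and>
    (\<forall>a<N. \<forall>i<r. (\<lambda>m. Q (s m) $$ (a, i)) \<longlonglongrightarrow> Q' $$ (a, i))"
proof -
  have "\<exists>s l. strict_mono (s :: nat \<Rightarrow> nat) \<and>
      (\<forall>ai\<in>{..<N} \<times> {..<r}. (\<lambda>m. Q (s m) $$ ai) \<longlonglongrightarrow> l ai)"
    by (rule bounded_family_convergent_subsequence[where f = "\<lambda>m ai. Q m $$ ai"])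
       (use orthonormal_columns_bound[OF Q on] in auto)
  then obtain s l where s: "strict_mono (s :: nat \<Rightarrow> nat)"
    and l: "\<And>a i. a < N \<Longrightarrow> i < r \<Longrightarrow> (\<lambda>m. Q (s m) $$ (a, i)) \<longlonglongrightarrow> l (a, i)" by blast
  define Q' where "Q' = Matrix.mat N r l"
  have Q': "Q' \<in> carrier_mat N r" by (simp add: Q'_def)
  have lim: "(\<lambda>m. Q (s m) $$ (a, i)) \<longlonglongrightarrow> Q' $$ (a, i)" if "a < N" "i < r" for a i
    using l that by (simp add: Q'_def)
  have "Q'\<^sup>T * Q' = 1\<^sub>m r"
    unfolding orthonormal_columns_iff[OF Q']
  proof (intro allI impI)
    fix i j assume ij: "i < r" "j < r"
    have "(\<lambda>m. \<Sum>a<N. Q (s m) $$ (a, i) * Q (s m) $$ (a, j)) \<longlonglongrightarrow> (\<Sum>a<N. Q' $$ (a, i) * Q' $$ (a, j))"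
      using ij by (intro tendsto_sum tendsto_mult lim) auto
    moreover have "(\<Sum>a<N. Q (s m) $$ (a, i) * Q (s m) $$ (a, j)) = (if i = j then 1 else 0)" for m
      using on[of "s m"] ij unfolding orthonormal_columns_iff[OF Q] by blast
    ultimately show "(\<Sum>a<N. Q' $$ (a, i) * Q' $$ (a, j)) = (if i = j then 1 else 0)"
      by (simp add: LIMSEQ_const_iff)
  qed
  then show ?thesis using s Q' lim by blast
qed

text \<open>The frames need not converge, even if the matrices do (eigenvalues may be multiple), but a
  subsequence does, and its limit diagonalizes the limit matrix.\<close>

lemma sorted_diagonalization_convergent_subsequence:
  assumes A: "A \<in> carrier_mat N N"
    and lim: "\<And>a b. a < N \<Longrightarrow> b < N \<Longrightarrow> (\<lambda>m. Am m $$ (a, b)) \<longlonglongrightarrow> A $$ (a, b)"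
    and sd: "\<And>m. sorted_diagonalization N (Am m) (Q m) (d m)"
  shows "\<exists>s Q' d'. strict_mono (s :: nat \<Rightarrow> nat) \<and> sorted_diagonalization N A Q' d' \<and>
    (\<forall>a<N. \<forall>i<N. (\<lambda>m. Q (s m) $$ (a, i)) \<longlonglongrightarrow> Q' $$ (a, i)) \<and>
    (\<forall>i<N. (\<lambda>m. d (s m) i) \<longlonglongrightarrow> d' i)"
proof -
  have Q: "Q m \<in> carrier_mat N N" and on: "(Q m)\<^sup>T * Q m = 1\<^sub>m N" for m
    using sd[of m] by (auto simp: sorted_diagonalization_def)
  obtain s Q' where s: "strict_mono (s :: nat \<Rightarrow> nat)" and Q': "Q' \<in> carrier_mat N N" "Q'\<^sup>T * Q' = 1\<^sub>m N"
    and Ql: "\<And>a i. a < N \<Longrightarrow> i < N \<Longrightarrow> (\<lambda>m. Q (s m) $$ (a, i)) \<longlonglongrightarrow> Q' $$ (a, i)"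
    using orthonormal_columns_convergent_subsequence[of Q, OF Q on] by blast
  define d' where "d' l = (\<Sum>a<N. \<Sum>b<N. Q' $$ (a, l) * A $$ (a, b) * Q' $$ (b, l))" for l
  have As: "(\<lambda>m. Am (s m) $$ (a, b)) \<longlonglongrightarrow> A $$ (a, b)" if "a < N" "b < N" for a b
    using LIMSEQ_subseq_LIMSEQ[OF lim[OF that] s] by (simp add: o_def)
  have dl: "(\<lambda>m. d (s m) l) \<longlonglongrightarrow> d' l" if "l < N" for l
    unfolding d'_def sorted_diagonalization_diagonal_entry[OF sd that]
    using that by (intro tendsto_sum tendsto_mult Ql As) auto
  have "sorted_diagonalization N A Q' d'"
    unfolding sorted_diagonalization_entries
  proof (intro conjI allI impI)
    show "(\<Sum>a<N. Q' $$ (a, i) * Q' $$ (a, j)) = (if i = j then 1 else 0)" if "i < N" "j < N" for i j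
      using Q' that unfolding orthonormal_columns_iff[OF Q'(1)] by blast
    show "d' j \<le> d' i" if "i \<le> j" "j < N" for i j
    proof (rule LIMSEQ_le[OF dl dl])
      show "\<exists>M. \<forall>m\<ge>M. d (s m) j \<le> d (s m) i"
        using sd that unfolding sorted_diagonalization_def by blast
    qed (use that in auto)
    show "A $$ (i, j) = (\<Sum>l<N. Q' $$ (i, l) * d' l * Q' $$ (j, l))" if "i < N" "j < N" for i j
    proof (rule LIMSEQ_unique[OF As[OF that]])
      have "Am (s m) $$ (i, j) = (\<Sum>l<N. Q (s m) $$ (i, l) * d (s m) l * Q (s m) $$ (j, l))" for m
        using sd[of "s m"] that unfolding sorted_diagonalization_entries by blast
      then show "(\<lambda>m. Am (s m) $$ (i, j)) \<longlonglongrightarrow> (\<Sum>l<N. Q' $$ (i, l) * d' l * Q' $$ (j, l))"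
        using that by (simp only:) (intro tendsto_sum tendsto_mult Ql dl; simp)
    qed
  qed (use A Q' in auto)
  then show ?thesis using s Ql dl by blast
qed

lemma sorted_diagonalization_conjugate:
  assumes sd: "sorted_diagonalization N A Q d"
    and W: "W \<in> carrier_mat N N" and WTW: "W\<^sup>T * W = 1\<^sub>m N"
  shows "sorted_diagonalization N (W\<^sup>T * A * W) (W\<^sup>T * Q) d"
proof -
  have Q: "Q \<in> carrier_mat N N" and QTQ: "Q\<^sup>T * Q = 1\<^sub>m N"
    and ord: "\<forall>i j. i \<le> j \<longrightarrow> j < N \<longrightarrow> d j \<le> d i"
    and A: "A = Q * diagonal N d * Q\<^sup>T"
    using sd by (auto simp: sorted_diagonalization_def)
  have WT: "W\<^sup>T \<in> carrier_mat N N" and QT: "Q\<^sup>T \<in> carrier_mat N N" using W Q by auto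
  have WWT: "W * W\<^sup>T = 1\<^sub>m N" by (rule mat_mult_left_right_inverse[OF WT W WTW])
  note assoc = assoc_mult_mat[where ?n\<^sub>1.0 = N and ?n\<^sub>2.0 = N and ?n\<^sub>3.0 = N and ?n\<^sub>4.0 = N]
  have tr: "(W\<^sup>T * Q)\<^sup>T = Q\<^sup>T * W"
    using transpose_mult[OF WT Q] by simp
  have "Q\<^sup>T * W * (W\<^sup>T * Q) = Q\<^sup>T * (W * W\<^sup>T) * Q"
    using W WT Q QT by (simp add: assoc)
  then have 1: "(W\<^sup>T * Q)\<^sup>T * (W\<^sup>T * Q) = 1\<^sub>m N"
    unfolding tr WWT using QT QTQ by simp
  have 2: "W\<^sup>T * A * W = W\<^sup>T * Q * diagonal N d * (W\<^sup>T * Q)\<^sup>T"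
    unfolding tr A using W WT Q QT by (simp add: assoc mult_carrier_mat[of _ N N _ N])
  have 3: "W\<^sup>T * Q \<in> carrier_mat N N" using WT Q by simp
  show ?thesis
    unfolding sorted_diagonalization_def using 1 2 3 ord by blast
qed

section \<open>Coordinates in tensor product bases\<close>

lemma finite_multi_indices [simp]: "finite (multi_indices n k)"
  by (auto simp: multi_indices_def intro!: finite_PiE)

lemma multi_indices_0: "multi_indices n 0 = {\<lambda>_. undefined}"
  by (simp add: multi_indices_def)

text \<open>A multi-index of length \<open>k + 1\<close> is a multi-index of length \<open>k\<close> and a last entry.\<close>

lemma sum_multi_indices_Suc:
  fixes f :: "(nat \<Rightarrow> nat) \<Rightarrow> nat \<Rightarrow> 'b::comm_monoid_add"
  shows "(\<Sum>i\<in>multi_indices n (Suc k). f (restrict i {1..k}) (i (Suc k)))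
    = (\<Sum>i\<in>multi_indices n k. \<Sum>a<n (Suc k). f i a)"
proof -
  have "(\<Sum>i\<in>multi_indices n (Suc k). f (restrict i {1..k}) (i (Suc k)))
      = (\<Sum>(i, a)\<in>multi_indices n k \<times> {..<n (Suc k)}. f i a)"
  proof (rule sum.reindex_bij_witness[where i = "\<lambda>(i, a). i(Suc k := a)"
        and j = "\<lambda>i. (restrict i {1..k}, i (Suc k))"], goal_cases)
    case (1 i)
    then show ?case
      by (fastforce simp: multi_indices_def fun_eq_iff restrict_def PiE_def extensional_def)
  next
    case (2 i)
    then show ?case
      by (auto simp: multi_indices_def restrict_def PiE_def Pi_def extensional_def)
  next
    case (3 b)
    then show ?case
      by (auto simp: multi_indices_def fun_eq_iff restrict_def PiE_def extensional_def)
  next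
    case (4 b)
    then show ?case
      by (auto simp: multi_indices_def PiE_def extensional_def Pi_def le_Suc_eq)
  qed auto
  then show ?thesis by (simp add: sum.cartesian_product)
qed

lemma restrict_multi_index:
  "i \<in> multi_indices n (Suc k) \<Longrightarrow> restrict i {1..k} \<in> multi_indices n k"
  by (auto simp: multi_indices_def restrict_def PiE_def Pi_def extensional_def)

text \<open>The column-major numbering of \<open>vec_tensor\<close> enumerates all pairs exactly once.\<close>

lemma sum_mod_div:
  fixes f :: "nat \<Rightarrow> nat \<Rightarrow> 'b::comm_monoid_add"
  shows "(\<Sum>q<r * N. f (q mod r) (q div r)) = (\<Sum>l<r. \<Sum>a<N. f l a)"
proof (cases "r = 0")
  case False
  have "(\<Sum>q<r * N. f (q mod r) (q div r)) = (\<Sum>(l, a)\<in>{..<r} \<times> {..<N}. f l a)"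
  proof (rule sum.reindex_bij_witness[where i = "\<lambda>(l, a). l + r * a" and j = "\<lambda>q. (q mod r, q div r)"], goal_cases)
    case (4 b)
    then have "fst b < r" "Suc (snd b) \<le> N" by auto
    then have "fst b + r * snd b < r * Suc (snd b)" by simp
    also have "\<dots> \<le> r * N" using \<open>Suc (snd b) \<le> N\<close> by (rule mult_le_mono2)
    finally show ?case by (auto simp: case_prod_beta)
  qed (use False in \<open>auto simp: less_mult_imp_div_less mult.commute\<close>)
  then show ?thesis by (simp add: sum.cartesian_product)
qed simp

lemma tensor_basis_Suc:
  "tensor_basis \<psi> (Suc k) i x = tensor_basis \<psi> k (restrict i {1..k}) x * \<psi> (Suc k) (i (Suc k)) x"
proof -
  have "{1..Suc k} = insert (Suc k) {1..k}" by auto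
  then show ?thesis by (simp add: tensor_basis_def mult.commute)
qed

definition combine :: "(nat \<Rightarrow> nat) \<Rightarrow> (nat \<Rightarrow> nat \<Rightarrow> 'a \<Rightarrow> real) \<Rightarrow> nat \<Rightarrow> ((nat \<Rightarrow> nat) \<Rightarrow> real) \<Rightarrow> 'a \<Rightarrow> real" where
  "combine n \<psi> k c = (\<lambda>x. \<Sum>i\<in>multi_indices n k. c i * tensor_basis \<psi> k i x)"

text \<open>Coefficients of the products \<open>vec_tensor r \<theta> (\<psi> (Suc k))\<close>, where the columns of \<open>T\<close> are the
  coefficients of \<open>\<theta>\<close>.\<close>

definition product_coef :: "nat \<Rightarrow> nat \<Rightarrow> ((nat \<Rightarrow> nat) \<Rightarrow> nat \<Rightarrow> real) \<Rightarrow> (nat \<Rightarrow> nat) \<Rightarrow> nat \<Rightarrow> real" where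
  "product_coef r k T i q = T (restrict i {1..k}) (q mod r) * (if q div r = i (Suc k) then 1 else 0)"

lemma product_coef_vec_tensor:
  assumes "q < r * n (Suc k)"
  shows "vec_tensor r (\<lambda>l. combine n \<psi> k (\<lambda>i. T i l)) (\<psi> (Suc k)) q
    = combine n \<psi> (Suc k) (\<lambda>i. product_coef r k T i q)"
proof
  fix x
  have q: "q div r < n (Suc k)" using assms by (metis less_mult_imp_div_less mult.commute)
  have "combine n \<psi> (Suc k) (\<lambda>i. product_coef r k T i q) x =
      (\<Sum>i\<in>multi_indices n k. \<Sum>a<n (Suc k). T i (q mod r) * (if q div r = a then 1 else 0)
        * (tensor_basis \<psi> k i x * \<psi> (Suc k) a x))"
    unfolding combine_def tensor_basis_Suc product_coef_def
    by (subst sum_multi_indices_Suc[symmetric]) simp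
  also have "\<dots> = (\<Sum>i\<in>multi_indices n k. \<Sum>a<n (Suc k). if a = q div r then T i (q mod r)
        * (tensor_basis \<psi> k i x * \<psi> (Suc k) a x) else 0)"
    by (intro sum.cong refl) auto
  also have "\<dots> = (\<Sum>i\<in>multi_indices n k. T i (q mod r) * tensor_basis \<psi> k i x) * \<psi> (Suc k) (q div r) x"
    using q by (simp add: sum_distrib_right mult.assoc)
  finally show "vec_tensor r (\<lambda>l. combine n \<psi> k (\<lambda>i. T i l)) (\<psi> (Suc k)) q x
      = combine n \<psi> (Suc k) (\<lambda>i. product_coef r k T i q) x"
    by (simp add: vec_tensor_def combine_def)
qed

text \<open>Declaring the tensor basis orthonormal makes \<open>\<bbbV>\<^sup>:\<^sup>k\<close> a Euclidean space, compatible with tensor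
  products: products of orthonormal families are orthonormal.\<close>

lemma product_coef_orthonormal:
  assumes on: "\<And>l l'. l < r \<Longrightarrow> l' < r \<Longrightarrow> (\<Sum>i\<in>multi_indices n k. T i l * T i l') = (if l = l' then 1 else 0)"
    and q: "q < r * n (Suc k)" "q' < r * n (Suc k)"
  shows "(\<Sum>i\<in>multi_indices n (Suc k). product_coef r k T i q * product_coef r k T i q') = (if q = q' then 1 else (0 :: real))"
proof -
  have r: "r > 0" using q by (cases r) auto
  have d: "q div r < n (Suc k)" using q by (metis less_mult_imp_div_less mult.commute)
  have "(\<Sum>i\<in>multi_indices n (Suc k). product_coef r k T i q * product_coef r k T i q')
     = (\<Sum>i\<in>multi_indices n k. \<Sum>a<n (Suc k). (T i (q mod r) * (if q div r = a then 1 else 0)) *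
        (T i (q' mod r) * (if q' div r = a then 1 else 0)))"
    unfolding product_coef_def by (subst sum_multi_indices_Suc[symmetric]) simp
  also have "\<dots> = (\<Sum>i\<in>multi_indices n k. \<Sum>a<n (Suc k). if a = q div r then
      T i (q mod r) * T i (q' mod r) * (if q' div r = q div r then 1 else 0) else 0)"
    by (intro sum.cong refl) auto
  also have "\<dots> = (\<Sum>i\<in>multi_indices n k. T i (q mod r) * T i (q' mod r)) * (if q' div r = q div r then 1 else 0)"
    using d by (simp add: sum_distrib_right)
  also have "\<dots> = (if q mod r = q' mod r \<and> q' div r = q div r then 1 else 0)"
    using r by (subst on) auto
  also have "\<dots> = (if q = q' then 1 else 0)"
    by (metis mult_div_mod_eq)
  finally show ?thesis .
qed

definition coef_gramian :: "'i set \<Rightarrow> ('i \<Rightarrow> 'i \<Rightarrow> real) \<Rightarrow> nat \<Rightarrow> ('i \<Rightarrow> nat \<Rightarrow> real) \<Rightarrow> real mat" where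
  "coef_gramian I g N S = Matrix.mat N N (\<lambda>(q, q'). \<Sum>i\<in>I. \<Sum>j\<in>I. S i q * S j q' * g i j)"

lemma coef_gramian_carrier [simp]: "coef_gramian I g N S \<in> carrier_mat N N"
  by (simp add: coef_gramian_def)

lemma coef_gramian_symmetric:
  assumes "\<And>i j. g i j = g j i" "a < N" "b < N"
  shows "coef_gramian I g N S $$ (a, b) = coef_gramian I g N S $$ (b, a)"
proof -
  have "(\<Sum>i\<in>I. \<Sum>j\<in>I. S i a * S j b * g i j) = (\<Sum>j\<in>I. \<Sum>i\<in>I. S i a * S j b * g i j)"
    by (rule sum.swap)
  also have "\<dots> = (\<Sum>i\<in>I. \<Sum>j\<in>I. S i b * S j a * g i j)"
    by (intro sum.cong refl) (simp add: assms(1) mult_ac)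
  finally show ?thesis using assms(2,3) by (simp add: coef_gramian_def)
qed

text \<open>The Gram matrix transforms by congruence; for orthogonal \<open>W\<close> this is a similarity.\<close>

lemma coef_gramian_change_of_basis:
  fixes W :: "real mat"
  assumes W: "W \<in> carrier_mat N N" and S': "\<And>i q. i \<in> I \<Longrightarrow> q < N \<Longrightarrow> S' i q = (\<Sum>a<N. S i a * W $$ (a, q))"
  shows "coef_gramian I g N S' = W\<^sup>T * coef_gramian I g N S * W"
proof (rule eq_matI)
  let ?A = "coef_gramian I g N S"
  have A: "?A \<in> carrier_mat N N" and WT: "W\<^sup>T \<in> carrier_mat N N" using W by auto
  have WTA: "W\<^sup>T * ?A \<in> carrier_mat N N" using A WT by simp
  fix q q' assume "q < dim_row (W\<^sup>T * ?A * W)" "q' < dim_col (W\<^sup>T * ?A * W)"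
  then have q: "q < N" "q' < N" using W by auto
  let ?F = "\<lambda>i j a b. S i a * W $$ (a, q) * (S j b * W $$ (b, q')) * g i j"
  let ?g = "\<lambda>a b. \<Sum>i\<in>I. \<Sum>j\<in>I. S i a * S j b * g i j"
  have "(W\<^sup>T * ?A * W) $$ (q, q') = (\<Sum>b<N. (W\<^sup>T * ?A) $$ (q, b) * W $$ (b, q'))"
    by (rule mult_mat_entry[OF WTA W q])
  also have "\<dots> = (\<Sum>b<N. (\<Sum>a<N. W $$ (a, q) * ?g a b) * W $$ (b, q'))"
  proof (intro sum.cong refl)
    fix b assume b: "b \<in> {..<N}"
    then have "(W\<^sup>T * ?A) $$ (q, b) = (\<Sum>a<N. W $$ (a, q) * ?g a b)"
      using q W by (subst mult_mat_entry[OF WT A]) (auto simp: coef_gramian_def)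
    then show "(W\<^sup>T * ?A) $$ (q, b) * W $$ (b, q') =
        (\<Sum>a<N. W $$ (a, q) * ?g a b) * W $$ (b, q')" by simp
  qed
  also have "\<dots> = (\<Sum>b<N. \<Sum>a<N. \<Sum>i\<in>I. \<Sum>j\<in>I. ?F i j a b)"
    by (simp add: sum_distrib_left sum_distrib_right mult_ac)
  also have "\<dots> = (\<Sum>b<N. \<Sum>i\<in>I. \<Sum>j\<in>I. \<Sum>a<N. ?F i j a b)"
  proof (intro sum.cong refl)
    fix b
    show "(\<Sum>a<N. \<Sum>i\<in>I. \<Sum>j\<in>I. ?F i j a b) =
      (\<Sum>i\<in>I. \<Sum>j\<in>I. \<Sum>a<N. ?F i j a b)"
      by (subst sum.swap, rule sum.cong[OF refl], rule sum.swap)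
  qed
  also have "\<dots> = (\<Sum>i\<in>I. \<Sum>j\<in>I. \<Sum>b<N. \<Sum>a<N. ?F i j a b)"
    by (subst sum.swap, rule sum.cong[OF refl], rule sum.swap)
  also have "\<dots> = (\<Sum>i\<in>I. \<Sum>j\<in>I. S' i q * S' j q' * g i j)"
  proof (intro sum.cong refl)
    fix i j assume "i \<in> I" "j \<in> I"
    then show "(\<Sum>b<N. \<Sum>a<N. ?F i j a b) = S' i q * S' j q' * g i j"
      using q by (simp add: S' sum_distrib_left sum_distrib_right mult_ac)
  qed
  finally show "coef_gramian I g N S' $$ (q, q') = (W\<^sup>T * ?A * W) $$ (q, q')"
    using q by (simp add: coef_gramian_def)
qed (use W in \<open>auto simp: coef_gramian_def\<close>)

text \<open>Throughout, \<open>G k\<close> is the Gram matrix of the tensor basis of order \<open>k\<close>.\<close>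

definition symmetric_form :: "(nat \<Rightarrow> 'i \<Rightarrow> 'i \<Rightarrow> real) \<Rightarrow> bool" where
  "symmetric_form G \<longleftrightarrow> (\<forall>k i j. G k i j = G k j i)"

definition step_dim :: "(nat \<Rightarrow> nat) \<Rightarrow> (nat \<Rightarrow> nat) \<Rightarrow> nat \<Rightarrow> nat" where
  "step_dim n r k = ext_rank r k * n (Suc k)"

definition step_coef :: "(nat \<Rightarrow> nat) \<Rightarrow> nat \<Rightarrow> ((nat \<Rightarrow> nat) \<Rightarrow> nat \<Rightarrow> real) \<Rightarrow> (nat \<Rightarrow> nat) \<Rightarrow> nat \<Rightarrow> real" where
  "step_coef r k T = product_coef (ext_rank r k) k T"

definition step_gramian where
  "step_gramian G n r k T =
     coef_gramian (multi_indices n (Suc k)) (G (Suc k)) (step_dim n r k) (step_coef r k T)"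

lemma step_gramian_carrier [simp]: "step_gramian G n r k T \<in> carrier_mat (step_dim n r k) (step_dim n r k)"
  by (simp add: step_gramian_def)

text \<open>The recursion of \<open>spectral_tuple\<close> carried out on coefficients. It refers to the inner product only
  through the Gram matrices \<open>G\<close> of the tensor bases.\<close>

inductive coef_tuple :: "(nat \<Rightarrow> (nat \<Rightarrow> nat) \<Rightarrow> (nat \<Rightarrow> nat) \<Rightarrow> real) \<Rightarrow> (nat \<Rightarrow> nat) \<Rightarrow> (nat \<Rightarrow> nat)
    \<Rightarrow> nat \<Rightarrow> ((nat \<Rightarrow> nat) \<Rightarrow> nat \<Rightarrow> real) \<Rightarrow> bool"
  for G n r where
  zero: "coef_tuple G n r 0 (\<lambda>i l. 1)"
| step: "\<lbrakk> coef_tuple G n r k T;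
           1 \<le> r (Suc k); r (Suc k) \<le> step_dim n r k;
           eigval (step_gramian G n r k T) (r (Suc k) + 1) < eigval (step_gramian G n r k T) (r (Suc k));
           dominant_basis (step_gramian G n r k T) (r (Suc k)) U \<rbrakk>
         \<Longrightarrow> coef_tuple G n r (Suc k) (\<lambda>i j. \<Sum>q<step_dim n r k. U $$ (q, j) * step_coef r k T i q)"

lemma combine_sum:
  "(\<Sum>q\<in>B. c q * combine n \<psi> k (\<lambda>i. S i q) x) = combine n \<psi> k (\<lambda>i. \<Sum>q\<in>B. c q * S i q) x"
  unfolding combine_def sum_distrib_left sum_distrib_right by (subst sum.swap) (simp add: mult.assoc)

text \<open>Bilinearity is required only on the tensor spaces of order \<open>1, \<dots>, p\<close>, because \<open>L2_inner\<close> is not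
  bilinear on functions that fail to be square integrable.\<close>

definition represents where
  "represents ip n \<psi> p G \<longleftrightarrow> (\<forall>k\<in>{1..p}. \<forall>a b.
     ip (combine n \<psi> k a) (combine n \<psi> k b) = (\<Sum>i\<in>multi_indices n k. \<Sum>j\<in>multi_indices n k. a i * b j * G k i j))"

lemma spectral_tuple_iff_coef_tuple:
  assumes rep: "represents ip n \<psi> p G" and k: "k \<le> p"
  shows "spectral_tuple ip n \<psi> r k \<theta> \<longleftrightarrow>
    (\<exists>T. coef_tuple G n r k T \<and> \<theta> = (\<lambda>l. combine n \<psi> k (\<lambda>i. T i l)))"
proof -
  let ?v = "\<lambda>k T. vec_tensor (ext_rank r k) (\<lambda>l. combine n \<psi> k (\<lambda>i. T i l)) (\<psi> (Suc k))"
  have v: "?v k T q = combine n \<psi> (Suc k) (\<lambda>i. step_coef r k T i q)" if "q < step_dim n r k" for k T q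
    using that unfolding step_coef_def step_dim_def by (rule product_coef_vec_tensor)
  have gram: "gramian ip (step_dim n r k) (?v k T) = step_gramian G n r k T" if "Suc k \<le> p" for k T
    using that rep
    by (intro eq_matI) (auto simp: gramian_def step_gramian_def coef_gramian_def v represents_def)
  have new: "(\<lambda>j x. \<Sum>q<step_dim n r k. U $$ (q, j) * ?v k T q x)
      = (\<lambda>j. combine n \<psi> (Suc k) (\<lambda>i. \<Sum>q<step_dim n r k. U $$ (q, j) * step_coef r k T i q))"
    for k T and U :: "real mat"
    by (intro ext) (simp add: v combine_sum)
  show ?thesis
  proof
    assume "spectral_tuple ip n \<psi> r k \<theta>"
    then show "\<exists>T. coef_tuple G n r k T \<and> \<theta> = (\<lambda>l. combine n \<psi> k (\<lambda>i. T i l))" using k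
    proof (induction rule: spectral_tuple.induct)
      case zero
      show ?case
        by (intro exI[of _ "\<lambda>i l. 1"] conjI coef_tuple.zero)
           (auto simp: combine_def multi_indices_0 tensor_basis_def fun_eq_iff)
    next
      case (step k \<theta> N v A U)
      then obtain T where T: "coef_tuple G n r k T" and \<theta>: "\<theta> = (\<lambda>l. combine n \<psi> k (\<lambda>i. T i l))" by auto
      have N: "N = step_dim n r k" using step.hyps(2) by (simp add: step_dim_def)
      have A: "A = step_gramian G n r k T"
        using step.hyps(3,4) step.prems gram[of k T] by (simp add: \<theta> N)
      have gap: "eigval A (r (Suc k) + 1) < eigval A (r (Suc k))" using step.hyps(7) by simp
      show ?case
        unfolding step.hyps(3) \<theta> N new
        using coef_tuple.step[OF T step.hyps(5) _ gap[unfolded A] step.hyps(8)[unfolded A]] step.hyps(6) N by blast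
    qed
  next
    assume "\<exists>T. coef_tuple G n r k T \<and> \<theta> = (\<lambda>l. combine n \<psi> k (\<lambda>i. T i l))"
    then obtain T where "coef_tuple G n r k T" and \<theta>: "\<theta> = (\<lambda>l. combine n \<psi> k (\<lambda>i. T i l))" by blast
    then show "spectral_tuple ip n \<psi> r k \<theta>" unfolding \<theta> using k
    proof (induction rule: coef_tuple.induct)
      case zero
      have "(\<lambda>l. combine n \<psi> 0 (\<lambda>i. 1)) = (\<lambda>(l::nat) x. 1)"
        by (auto simp: combine_def multi_indices_0 tensor_basis_def fun_eq_iff)
      then show ?case using spectral_tuple.zero by simp
    next
      case (step k T U)
      have A: "step_gramian G n r k T = gramian ip (step_dim n r k) (?v k T)"
        using gram[of k T] step.prems by simp
      have gap: "sqrt (eigval (step_gramian G n r k T) (r (Suc k))) > sqrt (eigval (step_gramian G n r k T) (r (Suc k) + 1))"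
        using step.hyps(4) by simp
      have "spectral_tuple ip n \<psi> r k (\<lambda>l. combine n \<psi> k (\<lambda>i. T i l))" using step by auto
      from spectral_tuple.step[OF this step_dim_def refl A step.hyps(2,3) gap step.hyps(5)]
      show ?case unfolding new .
    qed
  qed
qed

lemma coef_tuple_0_iff: "coef_tuple G n r 0 T \<longleftrightarrow> T = (\<lambda>i l. 1)"
  by (subst coef_tuple.simps) auto

lemma coef_tuple_Suc_iff:
  "coef_tuple G n r (Suc k) T \<longleftrightarrow> 1 \<le> r (Suc k) \<and> r (Suc k) \<le> step_dim n r k \<and>
    (\<exists>T0 U. coef_tuple G n r k T0 \<and>
      eigval (step_gramian G n r k T0) (r (Suc k) + 1) < eigval (step_gramian G n r k T0) (r (Suc k)) \<and>
      dominant_basis (step_gramian G n r k T0) (r (Suc k)) U \<and>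
      T = (\<lambda>i j. \<Sum>q<step_dim n r k. U $$ (q, j) * step_coef r k T0 i q))"
  by (subst coef_tuple.simps) (auto simp del: sum.lessThan_Suc)

lemma step_gramian_symmetric:
  assumes "symmetric_form G" "a < step_dim n r k" "b < step_dim n r k"
  shows "step_gramian G n r k T $$ (a, b) = step_gramian G n r k T $$ (b, a)"
  unfolding step_gramian_def using assms by (intro coef_gramian_symmetric) (auto simp: symmetric_form_def)

lemma step_gramian_diagonalization:
  assumes "symmetric_form G"
  shows "\<exists>Q d. sorted_diagonalization (step_dim n r k) (step_gramian G n r k T) Q d"
  by (rule symmetric_has_sorted_diagonalization[OF step_gramian_carrier]) (rule step_gramian_symmetric[OF assms])

section \<open>Uniqueness of the spectral subspaces\<close>

lemma dominant_basisD:
  assumes "dominant_basis A r U" "A \<in> carrier_mat N N"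
  shows "U \<in> carrier_mat N r" "U\<^sup>T * U = 1\<^sub>m r"
  using assms by (auto simp: dominant_basis_def)

lemma gap_of_diagonalization:
  assumes "sorted_diagonalization N A Q d" "eigval A (r + 1) < eigval A r" "1 \<le> r" "r < N"
  shows "d r < d (r - 1)"
  using assms(2-4) by (simp add: eigval_sorted_diagonalization[OF assms(1)])

lemma dominant_basis_iff:
  assumes "sorted_diagonalization N A Q d" "1 \<le> r" "r \<le> N" "eigval A (r + 1) < eigval A r"
  shows "dominant_basis A r U \<longleftrightarrow>
    (\<exists>R. R \<in> carrier_mat r r \<and> R\<^sup>T * R = 1\<^sub>m r \<and> U = first_columns N r Q * R)"
  by (rule dominant_basis_iff_rotated_columns[OF assms(1-3)])
     (rule gap_of_diagonalization[OF assms(1,4,2)])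

text \<open>The Euclidean orthonormality of the coefficient columns does not depend on the inner product, since
  each \<open>U\<close> is an isometry for the Euclidean structure. This is what makes the admissible coefficients
  range over one compact set for all inner products at once.\<close>

lemma coef_tuple_orthonormal:
  assumes "coef_tuple G n r k T" "l < ext_rank r k" "l' < ext_rank r k"
  shows "(\<Sum>i\<in>multi_indices n k. T i l * T i l') = (if l = l' then 1 else 0)"
  using assms
proof (induction k arbitrary: T l l')
  case 0
  then show ?case by (simp add: coef_tuple_0_iff multi_indices_0 ext_rank_def)
next
  case (Suc k)
  obtain T0 U where T0: "coef_tuple G n r k T0"
    and db: "dominant_basis (step_gramian G n r k T0) (r (Suc k)) U"
    and T: "T = (\<lambda>i j. \<Sum>q<step_dim n r k. U $$ (q, j) * step_coef r k T0 i q)"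
    using Suc.prems(1) unfolding coef_tuple_Suc_iff by blast
  let ?N = "step_dim n r k" and ?S = "step_coef r k T0" and ?I = "multi_indices n (Suc k)"
  note U = dominant_basisD[OF db step_gramian_carrier]
  have l: "l < r (Suc k)" "l' < r (Suc k)" using Suc.prems by (auto simp: ext_rank_def)
  have S: "(\<Sum>i\<in>?I. ?S i q * ?S i q') = (if q = q' then 1 else 0)" if "q < ?N" "q' < ?N" for q q'
    unfolding step_coef_def
    by (rule product_coef_orthonormal[where r = "ext_rank r k" and k = k and T = T0, OF Suc.IH[OF T0]])
       (use that in \<open>simp_all add: step_dim_def\<close>)
  let ?F = "\<lambda>i q q'. U $$ (q, l) * U $$ (q', l') * (?S i q * ?S i q')"
  have "(\<Sum>i\<in>?I. T i l * T i l') = (\<Sum>i\<in>?I. \<Sum>q<?N. \<Sum>q'<?N. ?F i q q')"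
    unfolding T sum_product by (simp add: mult_ac)
  also have "\<dots> = (\<Sum>q<?N. \<Sum>i\<in>?I. \<Sum>q'<?N. ?F i q q')"
    by (rule sum.swap)
  also have "\<dots> = (\<Sum>q<?N. \<Sum>q'<?N. \<Sum>i\<in>?I. ?F i q q')"
    by (rule sum.cong[OF refl], rule sum.swap)
  also have "\<dots> = (\<Sum>q<?N. \<Sum>q'<?N. if q' = q then U $$ (q, l) * U $$ (q', l') else 0)"
  proof (intro sum.cong refl)
    fix q q' assume "q \<in> {..<?N}" "q' \<in> {..<?N}"
    then show "(\<Sum>i\<in>?I. U $$ (q, l) * U $$ (q', l') * (?S i q * ?S i q')) =
        (if q' = q then U $$ (q, l) * U $$ (q', l') else 0)"
      by (simp only: sum_distrib_left[symmetric] lessThan_iff S) auto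
  qed
  also have "\<dots> = (\<Sum>q<?N. U $$ (q, l) * U $$ (q, l'))" by simp
  also have "\<dots> = (if l = l' then 1 else 0)"
    using U(2) l unfolding orthonormal_columns_iff[OF U(1)] by blast
  finally show ?case .
qed

text \<open>A rotation \<open>R\<close> of \<open>\<theta>\<close> rotates the products of \<open>\<theta>\<close> and \<open>\<psi> (Suc k)\<close> by \<open>W = R \<otimes> 1\<close>.\<close>

lemma step_coef_rotation:
  fixes R :: "real mat"
  assumes R: "R \<in> carrier_mat (ext_rank r k) (ext_rank r k)"
    and RTR: "R\<^sup>T * R = 1\<^sub>m (ext_rank r k)"
    and T': "\<forall>i\<in>multi_indices n k. \<forall>l<ext_rank r k.
      T' i l = (\<Sum>l'<ext_rank r k. T i l' * R $$ (l', l))"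
  shows "\<exists>W. W \<in> carrier_mat (step_dim n r k) (step_dim n r k) \<and> W\<^sup>T * W = 1\<^sub>m (step_dim n r k) \<and>
    (\<forall>i\<in>multi_indices n (Suc k). \<forall>q<step_dim n r k.
      step_coef r k T' i q = (\<Sum>a<step_dim n r k. step_coef r k T i a * W $$ (a, q)))"
proof -
  define \<rho> where "\<rho> = ext_rank r k"
  define N where "N = step_dim n r k"
  have N: "N = \<rho> * n (Suc k)" by (simp add: N_def \<rho>_def step_dim_def)
  define w :: "nat \<Rightarrow> nat \<Rightarrow> nat \<Rightarrow> real" where "w q l b = R $$ (l, q mod \<rho>) * (if b = q div \<rho> then 1 else 0)" for q l b
  \<comment> \<open>The matrix of \<open>R \<otimes> 1\<close> in the column-major numbering.\<close>
  define W where "W = Matrix.mat N N (\<lambda>(a, q). w q (a mod \<rho>) (a div \<rho>))"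
  have W: "W \<in> carrier_mat N N" by (simp add: W_def)
  have dq: "q div \<rho> < n (Suc k)" "q mod \<rho> < \<rho>" if "q < N" for q
  proof -
    show "q div \<rho> < n (Suc k)" using that unfolding N by (metis less_mult_imp_div_less mult.commute)
    show "q mod \<rho> < \<rho>" using that unfolding N by (cases \<rho>) auto
  qed
  have "W\<^sup>T * W = 1\<^sub>m N"
    unfolding orthonormal_columns_iff[OF W]
  proof (intro allI impI)
    fix q q' assume q: "q < N" "q' < N"
    have "(\<Sum>a<N. W $$ (a, q) * W $$ (a, q')) =
        (\<Sum>a<\<rho> * n (Suc k). w q (a mod \<rho>) (a div \<rho>) * w q' (a mod \<rho>) (a div \<rho>))"
      using q by (simp add: W_def N)
    also have "\<dots> = (\<Sum>l<\<rho>. \<Sum>b<n (Suc k). w q l b * w q' l b)"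
      by (rule sum_mod_div)
    also have "\<dots> = (\<Sum>l<\<rho>. \<Sum>b<n (Suc k). if b = q div \<rho> then
        R $$ (l, q mod \<rho>) * R $$ (l, q' mod \<rho>) * (if q div \<rho> = q' div \<rho> then 1 else 0) else 0)"
      unfolding w_def by (intro sum.cong refl) auto
    also have "\<dots> = (\<Sum>l<\<rho>. R $$ (l, q mod \<rho>) * R $$ (l, q' mod \<rho>)) * (if q div \<rho> = q' div \<rho> then 1 else 0)"
      using dq[OF q(1)] by (simp add: sum_distrib_right)
    also have "(\<Sum>l<\<rho>. R $$ (l, q mod \<rho>) * R $$ (l, q' mod \<rho>)) = (if q mod \<rho> = q' mod \<rho> then 1 else 0)"
      using RTR dq(2)[OF q(1)] dq(2)[OF q(2)] unfolding orthonormal_columns_iff[OF R] \<rho>_def by simp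
    also have "\<dots> * (if q div \<rho> = q' div \<rho> then 1 else 0) = (if q = q' then 1 else (0 :: real))"
    proof -
      have "q = q' \<longleftrightarrow> q mod \<rho> = q' mod \<rho> \<and> q div \<rho> = q' div \<rho>"
        by (metis mult_div_mod_eq)
      then show ?thesis by simp
    qed
    finally show "(\<Sum>a<N. W $$ (a, q) * W $$ (a, q')) = (if q = q' then 1 else 0)" .
  qed
  moreover have "step_coef r k T' i q = (\<Sum>a<N. step_coef r k T i a * W $$ (a, q))"
    if i: "i \<in> multi_indices n (Suc k)" and q: "q < N" for i q
  proof -
    let ?i = "restrict i {1..k}" and ?b = "i (Suc k)"
    have "(\<Sum>a<N. step_coef r k T i a * W $$ (a, q)) =
        (\<Sum>a<\<rho> * n (Suc k). T ?i (a mod \<rho>) * (if a div \<rho> = ?b then 1 else 0) * w q (a mod \<rho>) (a div \<rho>))"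
      using q by (simp add: W_def N step_coef_def product_coef_def \<rho>_def)
    also have "\<dots> = (\<Sum>l<\<rho>. \<Sum>b<n (Suc k). T ?i l * (if b = ?b then 1 else 0) * w q l b)"
      by (rule sum_mod_div)
    also have "\<dots> = (\<Sum>l<\<rho>. \<Sum>b<n (Suc k). if b = q div \<rho> then
        T ?i l * R $$ (l, q mod \<rho>) * (if q div \<rho> = ?b then 1 else 0) else 0)"
      unfolding w_def by (intro sum.cong refl) auto
    also have "\<dots> = (\<Sum>l<\<rho>. T ?i l * R $$ (l, q mod \<rho>)) * (if q div \<rho> = ?b then 1 else 0)"
      using dq[OF q] by (simp add: sum_distrib_right)
    also have "\<dots> = T' ?i (q mod \<rho>) * (if q div \<rho> = ?b then 1 else 0)"
      using T' restrict_multi_index[OF i] dq[OF q] by (simp add: \<rho>_def)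
    finally show ?thesis by (simp add: step_coef_def product_coef_def \<rho>_def)
  qed
  ultimately show ?thesis using W unfolding N_def by blast
qed

text \<open>Two choices at level \<open>k\<close> differ by a rotation, so their Gram matrices are conjugate by an orthogonal
  \<open>W\<close>. If \<open>Q\<close> diagonalizes one of them, \<open>W\<^sup>T * Q\<close> diagonalizes the other with the same
  eigenvalues. Dominant bases of both are therefore rotations of the same first columns of \<open>Q\<close>,
  up to the factor \<open>W\<close> that already accounts for the change of products.\<close>

lemma coef_tuple_unique_up_to_rotation:
  assumes sym: "symmetric_form G"
    and "coef_tuple G n r k T" "coef_tuple G n r k T'"
  shows "\<exists>R. R \<in> carrier_mat (ext_rank r k) (ext_rank r k) \<and> R\<^sup>T * R = 1\<^sub>m (ext_rank r k) \<and>
    (\<forall>i\<in>multi_indices n k. \<forall>l<ext_rank r k. T' i l = (\<Sum>l'<ext_rank r k. T i l' * R $$ (l', l)))"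
  using assms(2,3)
proof (induction k arbitrary: T T')
  case 0
  then show ?case
    by (intro exI[of _ "1\<^sub>m 1"]) (auto simp: coef_tuple_0_iff ext_rank_def)
next
  case (Suc k)
  let ?N = "step_dim n r k" and ?\<rho> = "r (Suc k)" and ?I = "multi_indices n (Suc k)"
  obtain T0 U where T0: "coef_tuple G n r k T0"
    and gap: "eigval (step_gramian G n r k T0) (?\<rho> + 1) < eigval (step_gramian G n r k T0) ?\<rho>"
    and db: "dominant_basis (step_gramian G n r k T0) ?\<rho> U"
    and T: "T = (\<lambda>i j. \<Sum>q<?N. U $$ (q, j) * step_coef r k T0 i q)"
    and \<rho>: "1 \<le> ?\<rho>" "?\<rho> \<le> ?N"
    using Suc.prems(1) unfolding coef_tuple_Suc_iff by blast
  obtain T0' U' where T0': "coef_tuple G n r k T0'"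
    and gap': "eigval (step_gramian G n r k T0') (?\<rho> + 1) < eigval (step_gramian G n r k T0') ?\<rho>"
    and db': "dominant_basis (step_gramian G n r k T0') ?\<rho> U'"
    and T': "T' = (\<lambda>i j. \<Sum>q<?N. U' $$ (q, j) * step_coef r k T0' i q)"
    using Suc.prems(2) unfolding coef_tuple_Suc_iff by blast
  obtain R0 where R0: "R0 \<in> carrier_mat (ext_rank r k) (ext_rank r k)" "R0\<^sup>T * R0 = 1\<^sub>m (ext_rank r k)"
      "\<forall>i\<in>multi_indices n k. \<forall>l<ext_rank r k. T0' i l = (\<Sum>l'<ext_rank r k. T0 i l' * R0 $$ (l', l))"
    using Suc.IH[OF T0 T0'] by blast
  obtain W where W: "W \<in> carrier_mat ?N ?N" and WTW: "W\<^sup>T * W = 1\<^sub>m ?N"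
    and SW: "\<And>i q. i \<in> ?I \<Longrightarrow> q < ?N \<Longrightarrow>
      step_coef r k T0' i q = (\<Sum>a<?N. step_coef r k T0 i a * W $$ (a, q))"
    using step_coef_rotation[OF R0] by blast
  have A': "step_gramian G n r k T0' = W\<^sup>T * step_gramian G n r k T0 * W"
    unfolding step_gramian_def by (rule coef_gramian_change_of_basis[OF W SW])
  obtain Q d where sd: "sorted_diagonalization ?N (step_gramian G n r k T0) Q d"
    using step_gramian_diagonalization[OF sym] by blast
  have sd': "sorted_diagonalization ?N (step_gramian G n r k T0') (W\<^sup>T * Q) d"
    unfolding A' by (rule sorted_diagonalization_conjugate[OF sd W WTW])
  have Q: "Q \<in> carrier_mat ?N ?N" using sd by (simp add: sorted_diagonalization_def)
  have WT: "W\<^sup>T \<in> carrier_mat ?N ?N" using W by simp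
  have WWT: "W * W\<^sup>T = 1\<^sub>m ?N" by (rule mat_mult_left_right_inverse[OF WT W WTW])
  define Qr where "Qr = first_columns ?N ?\<rho> Q"
  have Qr: "Qr \<in> carrier_mat ?N ?\<rho>" by (simp add: Qr_def)
  obtain R1 where R1: "R1 \<in> carrier_mat ?\<rho> ?\<rho>" "R1\<^sup>T * R1 = 1\<^sub>m ?\<rho>" and U: "U = Qr * R1"
    using db unfolding dominant_basis_iff[OF sd \<rho> gap] Qr_def by blast
  obtain R2 where R2: "R2 \<in> carrier_mat ?\<rho> ?\<rho>" "R2\<^sup>T * R2 = 1\<^sub>m ?\<rho>"
    and U': "U' = first_columns ?N ?\<rho> (W\<^sup>T * Q) * R2"
    using db' unfolding dominant_basis_iff[OF sd' \<rho> gap'] by blast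
  have fc: "first_columns ?N ?\<rho> (W\<^sup>T * Q) = W\<^sup>T * Qr"
  proof (rule eq_matI)
    fix i j assume "i < dim_row (W\<^sup>T * Qr)" "j < dim_col (W\<^sup>T * Qr)"
    then have ij: "i < ?N" "j < ?\<rho>" using WT Qr by auto
    then have j: "j < ?N" using \<rho> by simp
    have "(W\<^sup>T * Q) $$ (i, j) = (\<Sum>l<?N. W\<^sup>T $$ (i, l) * Q $$ (l, j))"
      by (rule mult_mat_entry[OF WT Q ij(1) j])
    also have "\<dots> = (\<Sum>l<?N. W\<^sup>T $$ (i, l) * Qr $$ (l, j))"
      using ij by (intro sum.cong refl) (simp add: Qr_def first_columns_def)
    also have "\<dots> = (W\<^sup>T * Qr) $$ (i, j)"
      by (rule mult_mat_entry[OF WT Qr ij, symmetric])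
    finally show "first_columns ?N ?\<rho> (W\<^sup>T * Q) $$ (i, j) = (W\<^sup>T * Qr) $$ (i, j)"
      using ij by (simp add: first_columns_def)
  qed (use W Qr in \<open>auto simp: first_columns_def\<close>)
  have R1T: "R1\<^sup>T \<in> carrier_mat ?\<rho> ?\<rho>" using R1 by simp
  have R11: "R1 * R1\<^sup>T = 1\<^sub>m ?\<rho>" by (rule mat_mult_left_right_inverse[OF R1T R1])
  define R where "R = R1\<^sup>T * R2"
  have R: "R \<in> carrier_mat ?\<rho> ?\<rho>" using R1 R2 by (simp add: R_def)
  note assocr = assoc_mult_mat[where ?n\<^sub>1.0 = "?\<rho>" and ?n\<^sub>2.0 = "?\<rho>" and ?n\<^sub>3.0 = "?\<rho>" and ?n\<^sub>4.0 = "?\<rho>"]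
  have "R\<^sup>T * R = R2\<^sup>T * (R1 * R1\<^sup>T) * R2"
    unfolding R_def transpose_mult[OF R1T R2(1)] using R1(1) R2(1) R1T
    by (simp add: assocr mult_carrier_mat[of _ "?\<rho>" "?\<rho>" _ "?\<rho>"])
  also have "\<dots> = 1\<^sub>m ?\<rho>" unfolding R11 using R2 by simp
  finally have RTR: "R\<^sup>T * R = 1\<^sub>m ?\<rho>" .
  have U'c: "U' \<in> carrier_mat ?N ?\<rho>" by (rule dominant_basisD[OF db' step_gramian_carrier])
  have Uc: "U \<in> carrier_mat ?N ?\<rho>" by (rule dominant_basisD[OF db step_gramian_carrier])
  have "W * U' = Qr * R2"
  proof -
    have "W * U' = W * (W\<^sup>T * (Qr * R2))"
      unfolding U' fc using assoc_mult_mat[OF WT Qr R2(1)] by simp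
    also have "\<dots> = (W * W\<^sup>T) * (Qr * R2)"
      by (rule assoc_mult_mat[OF W WT mult_carrier_mat[OF Qr R2(1)], symmetric])
    also have "\<dots> = Qr * R2"
      unfolding WWT by (rule left_mult_one_mat[OF mult_carrier_mat[OF Qr R2(1)]])
    finally show ?thesis .
  qed
  also have "\<dots> = U * R"
  proof -
    have "U * R = Qr * (R1 * (R1\<^sup>T * R2))"
      unfolding U R_def by (rule assoc_mult_mat[OF Qr R1(1) mult_carrier_mat[OF R1T R2(1)]])
    also have "R1 * (R1\<^sup>T * R2) = (R1 * R1\<^sup>T) * R2"
      by (rule assoc_mult_mat[OF R1(1) R1T R2(1), symmetric])
    also have "\<dots> = R2" unfolding R11 using R2 by simp
    finally show ?thesis by simp
  qed
  \<comment> \<open>\<open>W * U'\<close> holds the second dominant basis, expressed in the products of the first tuple.\<close>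
  finally have WU: "W * U' = U * R" .
  have "T' i l = (\<Sum>l'<?\<rho>. T i l' * R $$ (l', l))" if i: "i \<in> ?I" and l: "l < ?\<rho>" for i l
  proof -
    let ?S = "step_coef r k T0 i"
    have "T' i l = (\<Sum>q<?N. \<Sum>a<?N. U' $$ (q, l) * (?S a * W $$ (a, q)))"
      unfolding T' using SW[OF i] by (simp add: sum_distrib_left)
    also have "\<dots> = (\<Sum>a<?N. \<Sum>q<?N. U' $$ (q, l) * (?S a * W $$ (a, q)))"
      by (rule sum.swap)
    also have "\<dots> = (\<Sum>a<?N. ?S a * (W * U') $$ (a, l))"
      using l by (intro sum.cong refl) (simp add: mult_mat_entry[OF W U'c] sum_distrib_left mult_ac)
    also have "\<dots> = (\<Sum>a<?N. \<Sum>l'<?\<rho>. ?S a * (U $$ (a, l') * R $$ (l', l)))"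
      unfolding WU using l by (intro sum.cong refl) (simp add: mult_mat_entry[OF Uc R] sum_distrib_left)
    also have "\<dots> = (\<Sum>l'<?\<rho>. \<Sum>a<?N. ?S a * (U $$ (a, l') * R $$ (l', l)))"
      by (rule sum.swap)
    also have "\<dots> = (\<Sum>l'<?\<rho>. T i l' * R $$ (l', l))"
      unfolding T by (simp add: sum_distrib_left sum_distrib_right mult_ac)
    finally show ?thesis .
  qed
  then show ?case using R RTR by (auto simp: ext_rank_def)
qed

text \<open>The gap conditions do not depend on earlier choices. This is needed because well-definedness only
  provides the gaps for some choice, whereas limits produce other choices.\<close>

lemma step_gramian_eigval_unique:
  assumes sym: "symmetric_form G"
    and T: "coef_tuple G n r k T" and T': "coef_tuple G n r k T'"
  shows "eigval (step_gramian G n r k T') = eigval (step_gramian G n r k T)"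
proof -
  let ?N = "step_dim n r k"
  obtain R0 where R0: "R0 \<in> carrier_mat (ext_rank r k) (ext_rank r k)" "R0\<^sup>T * R0 = 1\<^sub>m (ext_rank r k)"
      "\<forall>i\<in>multi_indices n k. \<forall>l<ext_rank r k. T' i l = (\<Sum>l'<ext_rank r k. T i l' * R0 $$ (l', l))"
    using coef_tuple_unique_up_to_rotation[OF sym T T'] by blast
  obtain W where W: "W \<in> carrier_mat ?N ?N" and WTW: "W\<^sup>T * W = 1\<^sub>m ?N"
    and SW: "\<And>i q. i \<in> multi_indices n (Suc k) \<Longrightarrow> q < ?N \<Longrightarrow>
      step_coef r k T' i q = (\<Sum>a<?N. step_coef r k T i a * W $$ (a, q))"
    using step_coef_rotation[OF R0] by blast
  have A': "step_gramian G n r k T' = W\<^sup>T * step_gramian G n r k T * W"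
    unfolding step_gramian_def by (rule coef_gramian_change_of_basis[OF W SW])
  obtain Q d where sd: "sorted_diagonalization ?N (step_gramian G n r k T) Q d"
    using step_gramian_diagonalization[OF sym] by blast
  have sd': "sorted_diagonalization ?N (step_gramian G n r k T') (W\<^sup>T * Q) d"
    unfolding A' by (rule sorted_diagonalization_conjugate[OF sd W WTW])
  show ?thesis
    by (simp add: fun_eq_iff eigval_sorted_diagonalization[OF sd] eigval_sorted_diagonalization[OF sd'])
qed

section \<open>Compactness of the spectral tuples\<close>

definition forms_converge where
  "forms_converge n p Gm G \<longleftrightarrow> (\<forall>k\<in>{1..p}. \<forall>i\<in>multi_indices n k. \<forall>j\<in>multi_indices n k.
     (\<lambda>m::nat. Gm m k i j) \<longlonglongrightarrow> (G k i j :: real))"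

lemma forms_converge_subseq:
  assumes "forms_converge n p Gm G" "strict_mono s"
  shows "forms_converge n p (\<lambda>m. Gm (s m)) G"
  unfolding forms_converge_def
proof (intro ballI)
  fix k i j assume "k \<in> {1..p}" "i \<in> multi_indices n k" "j \<in> multi_indices n k"
  then have "(\<lambda>m. Gm m k i j) \<longlonglongrightarrow> G k i j" using assms(1) by (simp add: forms_converge_def)
  from LIMSEQ_subseq_LIMSEQ[OF this assms(2)]
  show "(\<lambda>m. Gm (s m) k i j) \<longlonglongrightarrow> G k i j" by (simp add: o_def)
qed

lemma step_coef_tendsto:
  assumes T: "\<forall>i\<in>multi_indices n k. \<forall>l<ext_rank r k. (\<lambda>m. Tm m i l) \<longlonglongrightarrow> T i l"
    and i: "i \<in> multi_indices n (Suc k)" and q: "q < step_dim n r k"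
  shows "(\<lambda>m. step_coef r k (Tm m) i q) \<longlonglongrightarrow> step_coef r k T i q"
proof -
  have "q mod ext_rank r k < ext_rank r k"
    using q by (cases "ext_rank r k") (auto simp: step_dim_def)
  then show ?thesis
    unfolding step_coef_def product_coef_def
    using T restrict_multi_index[OF i] by (intro tendsto_mult tendsto_const) auto
qed

lemma step_gramian_tendsto:
  assumes conv: "forms_converge n p Gm G" and k: "Suc k \<le> p"
    and T: "\<forall>i\<in>multi_indices n k. \<forall>l<ext_rank r k. (\<lambda>m. Tm m i l) \<longlonglongrightarrow> T i l"
    and q: "q < step_dim n r k" "q' < step_dim n r k"
  shows "(\<lambda>m. step_gramian (Gm m) n r k (Tm m) $$ (q, q')) \<longlonglongrightarrow> step_gramian G n r k T $$ (q, q')"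
proof -
  have "(\<lambda>m. \<Sum>i\<in>multi_indices n (Suc k). \<Sum>j\<in>multi_indices n (Suc k).
      step_coef r k (Tm m) i q * step_coef r k (Tm m) j q' * Gm m (Suc k) i j) \<longlonglongrightarrow>
    (\<Sum>i\<in>multi_indices n (Suc k). \<Sum>j\<in>multi_indices n (Suc k).
      step_coef r k T i q * step_coef r k T j q' * G (Suc k) i j)"
    using conv k q by (intro tendsto_sum tendsto_mult step_coef_tendsto[OF T]) (auto simp: forms_converge_def)
  then show ?thesis using q by (simp add: step_gramian_def coef_gramian_def)
qed

lemma step_gramian_convergent_diagonalization:
  assumes sym: "\<And>m. symmetric_form (Gm m)" and conv: "forms_converge n p Gm G" and k: "Suc k \<le> p"
    and T: "\<forall>i\<in>multi_indices n k. \<forall>l<ext_rank r k. (\<lambda>m. Tm m i l) \<longlonglongrightarrow> T i l"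
  shows "\<exists>s Qm dm Q d. strict_mono (s :: nat \<Rightarrow> nat) \<and>
    (\<forall>m. sorted_diagonalization (step_dim n r k) (step_gramian (Gm (s m)) n r k (Tm (s m))) (Qm m) (dm m)) \<and>
    sorted_diagonalization (step_dim n r k) (step_gramian G n r k T) Q d \<and>
    (\<forall>a<step_dim n r k. \<forall>i<step_dim n r k. (\<lambda>m. Qm m $$ (a, i)) \<longlonglongrightarrow> Q $$ (a, i)) \<and>
    (\<forall>i<step_dim n r k. (\<lambda>m. dm m i) \<longlonglongrightarrow> d i)"
proof -
  let ?N = "step_dim n r k"
  have "\<forall>m. \<exists>Q d. sorted_diagonalization ?N (step_gramian (Gm m) n r k (Tm m)) Q d"
    using step_gramian_diagonalization[OF sym] by blast
  then obtain Qm dm where sd: "\<And>m. sorted_diagonalization ?N (step_gramian (Gm m) n r k (Tm m)) (Qm m) (dm m)"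
    by metis
  obtain s Q d where "strict_mono (s :: nat \<Rightarrow> nat)" "sorted_diagonalization ?N (step_gramian G n r k T) Q d"
    "\<forall>a<?N. \<forall>i<?N. (\<lambda>m. Qm (s m) $$ (a, i)) \<longlonglongrightarrow> Q $$ (a, i)"
    "\<forall>i<?N. (\<lambda>m. dm (s m) i) \<longlonglongrightarrow> d i"
    using sorted_diagonalization_convergent_subsequence[OF step_gramian_carrier step_gramian_tendsto[OF conv k T] sd]
    by blast
  then show ?thesis using sd
    by (intro exI[of _ s] exI[of _ "\<lambda>m. Qm (s m)"] exI[of _ "\<lambda>m. dm (s m)"] exI[of _ Q] exI[of _ d]) simp
qed

text \<open>Closedness of the construction under convergence of the inner products. The matrix \<open>U\<close> of step
  \<open>k + 1\<close> consists of the first columns of a diagonalizing frame, rotated. Frames and rotations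
  converge along a subsequence, and the limit is again of this form for the limit Gram matrix. This
  exhibits a dominant basis only if the limit matrix has a gap, which is inherited from the
  tuple \<open>T'\<close>.\<close>

lemma coef_tuple_convergent_subsequence:
  assumes sym: "symmetric_form G" "\<And>m. symmetric_form (Gm m)"
    and "forms_converge n p Gm G" and k: "k \<le> p"
    and "coef_tuple G n r k T'" and "\<And>m. coef_tuple (Gm m) n r k (Tm m)"
  shows "\<exists>s T. strict_mono (s :: nat \<Rightarrow> nat) \<and> coef_tuple G n r k T \<and>
    (\<forall>i\<in>multi_indices n k. \<forall>l<ext_rank r k. (\<lambda>m. Tm (s m) i l) \<longlonglongrightarrow> T i l)"
  using assms(3-)
proof (induction k arbitrary: T' Tm)
  case 0
  then show ?case
    by (intro exI[of _ id] exI[of _ "\<lambda>i l. 1"]) (auto simp: coef_tuple_0_iff strict_mono_def)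
next
  case (Suc k)
  let ?N = "step_dim n r k" and ?\<rho> = "r (Suc k)" and ?I = "multi_indices n (Suc k)"
  let ?A = "\<lambda>m. step_gramian (Gm m) n r k" and ?L = "step_gramian G n r k"
  have k: "Suc k \<le> p" and conv: "forms_converge n p Gm G" using Suc.prems by auto
  obtain T0' where T0': "coef_tuple G n r k T0'"
    and gap': "eigval (?L T0') (?\<rho> + 1) < eigval (?L T0') ?\<rho>"
    and \<rho>: "1 \<le> ?\<rho>" "?\<rho> \<le> ?N"
    using Suc.prems(3) unfolding coef_tuple_Suc_iff by blast
  define St where "St m T0 U \<longleftrightarrow> coef_tuple (Gm m) n r k T0 \<and>
      eigval (?A m T0) (?\<rho> + 1) < eigval (?A m T0) ?\<rho> \<and>
      dominant_basis (?A m T0) ?\<rho> U \<and>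
      Tm m = (\<lambda>i j. \<Sum>q<?N. U $$ (q, j) * step_coef r k T0 i q)" for m T0 U
  have "\<forall>m. \<exists>T0 U. St m T0 U"
    using Suc.prems(4) unfolding coef_tuple_Suc_iff St_def by blast
  then obtain T0m Um where St: "\<And>m. St m (T0m m) (Um m)" by metis
  note St = St[unfolded St_def]
  have T0m: "\<And>m. coef_tuple (Gm m) n r k (T0m m)"
    and gap: "\<And>m. eigval (?A m (T0m m)) (?\<rho> + 1) < eigval (?A m (T0m m)) ?\<rho>"
    and db: "\<And>m. dominant_basis (?A m (T0m m)) ?\<rho> (Um m)"
    and Tm: "\<And>m. Tm m = (\<lambda>i j. \<Sum>q<?N. Um m $$ (q, j) * step_coef r k (T0m m) i q)"
    using St by simp_all
  obtain s1 T0 where s1: "strict_mono (s1 :: nat \<Rightarrow> nat)" and T0: "coef_tuple G n r k T0"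
    and T0l: "\<forall>i\<in>multi_indices n k. \<forall>l<ext_rank r k. (\<lambda>m. T0m (s1 m) i l) \<longlonglongrightarrow> T0 i l"
    using Suc.IH[OF conv Suc_leD[OF k] T0' T0m] by blast
  obtain s2 Qm dm Q d where s2: "strict_mono (s2 :: nat \<Rightarrow> nat)"
    and sd\<^sub>m: "\<And>m. sorted_diagonalization ?N (step_gramian (Gm (s1 (s2 m))) n r k (T0m (s1 (s2 m)))) (Qm m) (dm m)"
    and sd: "sorted_diagonalization ?N (?L T0) Q d"
    and Ql: "\<And>a i. a < ?N \<Longrightarrow> i < ?N \<Longrightarrow> (\<lambda>m. Qm m $$ (a, i)) \<longlonglongrightarrow> Q $$ (a, i)"
    using step_gramian_convergent_diagonalization[OF sym(2) forms_converge_subseq[OF conv s1] k T0l] by blast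
  have "\<forall>m. \<exists>R. R \<in> carrier_mat ?\<rho> ?\<rho> \<and> R\<^sup>T * R = 1\<^sub>m ?\<rho> \<and>
      Um (s1 (s2 m)) = first_columns ?N ?\<rho> (Qm m) * R"
    using db unfolding dominant_basis_iff[OF sd\<^sub>m \<rho> gap, symmetric] by blast
  then obtain Rm where Rm: "\<And>m. Rm m \<in> carrier_mat ?\<rho> ?\<rho>" "\<And>m. (Rm m)\<^sup>T * Rm m = 1\<^sub>m ?\<rho>"
    and Um: "\<And>m. Um (s1 (s2 m)) = first_columns ?N ?\<rho> (Qm m) * Rm m" by metis
  obtain s3 R where s3: "strict_mono (s3 :: nat \<Rightarrow> nat)" and R: "R \<in> carrier_mat ?\<rho> ?\<rho>" "R\<^sup>T * R = 1\<^sub>m ?\<rho>"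
    and Rl: "\<And>a i. a < ?\<rho> \<Longrightarrow> i < ?\<rho> \<Longrightarrow> (\<lambda>m. Rm (s3 m) $$ (a, i)) \<longlonglongrightarrow> R $$ (a, i)"
    using orthonormal_columns_convergent_subsequence[of Rm, OF Rm] by blast
  define s where "s = s1 \<circ> s2 \<circ> s3"
  define U where "U = first_columns ?N ?\<rho> Q * R"
  define T where "T = (\<lambda>i j. \<Sum>q<?N. U $$ (q, j) * step_coef r k T0 i q)"
  have s: "strict_mono s" unfolding s_def by (intro strict_mono_o s1 s2 s3)
  have s23: "strict_mono (s2 \<circ> s3)" by (intro strict_mono_o s2 s3)
  \<comment> \<open>The limit tuple \<open>T0\<close> need not be \<open>T0'\<close>, for which the gap is known.\<close>
  have gap0: "eigval (?L T0) (?\<rho> + 1) < eigval (?L T0) ?\<rho>"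
    using gap' step_gramian_eigval_unique[OF sym(1) T0' T0] by simp
  have dbU: "dominant_basis (?L T0) ?\<rho> U"
    unfolding dominant_basis_iff[OF sd \<rho> gap0] U_def using R by blast
  have tup: "coef_tuple G n r (Suc k) T"
    unfolding coef_tuple_Suc_iff T_def using T0 gap0 dbU \<rho> by blast
  have Ul: "(\<lambda>m. Um (s m) $$ (q, j)) \<longlonglongrightarrow> U $$ (q, j)" if q: "q < ?N" and j: "j < ?\<rho>" for q j
  proof -
    have "U $$ (q, j) = (\<Sum>l<?\<rho>. Q $$ (q, l) * R $$ (l, j))"
      unfolding U_def mult_mat_entry[OF first_columns_carrier R(1) q j]
      using q by (simp add: first_columns_def)
    moreover have "Um (s m) $$ (q, j) = (\<Sum>l<?\<rho>. Qm (s3 m) $$ (q, l) * Rm (s3 m) $$ (l, j))" for m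
      unfolding s_def o_def Um mult_mat_entry[OF first_columns_carrier Rm(1) q j]
      using q by (simp add: first_columns_def)
    moreover have "(\<lambda>m. \<Sum>l<?\<rho>. Qm (s3 m) $$ (q, l) * Rm (s3 m) $$ (l, j)) \<longlonglongrightarrow> (\<Sum>l<?\<rho>. Q $$ (q, l) * R $$ (l, j))"
    proof (intro tendsto_sum tendsto_mult)
      fix l assume l: "l \<in> {..<?\<rho>}"
      then have "(\<lambda>m. Qm m $$ (q, l)) \<longlonglongrightarrow> Q $$ (q, l)" using q \<rho> by (intro Ql) auto
      from LIMSEQ_subseq_LIMSEQ[OF this s3]
      show "(\<lambda>m. Qm (s3 m) $$ (q, l)) \<longlonglongrightarrow> Q $$ (q, l)" by (simp add: o_def)
      show "(\<lambda>m. Rm (s3 m) $$ (l, j)) \<longlonglongrightarrow> R $$ (l, j)" using l j by (intro Rl) auto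
    qed
    ultimately show ?thesis by simp
  qed
  have T0s: "\<forall>i\<in>multi_indices n k. \<forall>l<ext_rank r k. (\<lambda>m. T0m (s m) i l) \<longlonglongrightarrow> T0 i l"
  proof (intro ballI allI impI)
    fix i l assume "i \<in> multi_indices n k" "l < ext_rank r k"
    then have "(\<lambda>m. T0m (s1 m) i l) \<longlonglongrightarrow> T0 i l" using T0l by blast
    from LIMSEQ_subseq_LIMSEQ[OF this s23]
    show "(\<lambda>m. T0m (s m) i l) \<longlonglongrightarrow> T0 i l" by (simp add: o_def s_def)
  qed
  have "(\<lambda>m. Tm (s m) i j) \<longlonglongrightarrow> T i j" if "i \<in> ?I" "j < ext_rank r (Suc k)" for i j
    unfolding Tm T_def using that
    by (intro tendsto_sum tendsto_mult Ul step_coef_tendsto[OF T0s]) (auto simp: ext_rank_def)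
  then show ?case using s tup by blast
qed

text \<open>If the construction broke down at step \<open>k + 1\<close> infinitely often, then the Gram matrices of a
  convergent subsequence would violate the gap condition. But their eigenvalues converge to those of
  the limit matrix, which has a gap.\<close>

lemma coef_tuple_eventually_exists:
  assumes sym: "symmetric_form G" "\<And>m. symmetric_form (Gm m)"
    and conv: "forms_converge n p Gm G"
    and "k \<le> p" "coef_tuple G n r k T'"
  shows "\<forall>\<^sub>F m in sequentially. \<exists>T. coef_tuple (Gm m) n r k T"
  using assms(4,5)
proof (induction k arbitrary: T')
  case 0
  then show ?case by (simp add: coef_tuple_0_iff)
next
  case (Suc k)
  let ?N = "step_dim n r k" and ?\<rho> = "r (Suc k)" and ?L = "step_gramian G n r k"
  have k: "Suc k \<le> p" using Suc.prems by auto
  obtain T0' where T0': "coef_tuple G n r k T0'"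
    and gap': "eigval (?L T0') (?\<rho> + 1) < eigval (?L T0') ?\<rho>"
    and \<rho>: "1 \<le> ?\<rho>" "?\<rho> \<le> ?N"
    using Suc.prems(2) unfolding coef_tuple_Suc_iff by blast
  have IH: "\<forall>\<^sub>F m in sequentially. \<exists>T. coef_tuple (Gm m) n r k T"
    using Suc.IH[OF Suc_leD[OF k] T0'] .
  \<comment> \<open>Failure at step \<open>k + 1\<close> matters only where step \<open>k\<close> succeeded, so that a sequence of tuples
    of level \<open>k\<close> is available along the subsequence of failures.\<close>
  define Pr where "Pr m \<longleftrightarrow> (\<exists>T. coef_tuple (Gm m) n r k T) \<longrightarrow> (\<exists>T. coef_tuple (Gm m) n r (Suc k) T)" for m
  have "\<forall>\<^sub>F m in sequentially. Pr m"
  proof (rule ccontr)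
    assume "\<not> ?thesis"
    from not_eventually_sequentiallyD[OF this] obtain s where s: "strict_mono (s :: nat \<Rightarrow> nat)"
      and no: "\<And>m. \<not> Pr (s m)" by blast
    then have "\<forall>m. \<exists>T. coef_tuple (Gm (s m)) n r k T" and no: "\<And>m T. \<not> coef_tuple (Gm (s m)) n r (Suc k) T"
      unfolding Pr_def by blast+
    then obtain T0m where T0m: "\<And>m. coef_tuple (Gm (s m)) n r k (T0m m)" by metis
    note conv' = forms_converge_subseq[OF conv s]
    obtain s1 T0 where s1: "strict_mono (s1 :: nat \<Rightarrow> nat)" and T0: "coef_tuple G n r k T0"
      and T0l: "\<forall>i\<in>multi_indices n k. \<forall>l<ext_rank r k. (\<lambda>m. T0m (s1 m) i l) \<longlonglongrightarrow> T0 i l"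
      using coef_tuple_convergent_subsequence[OF sym(1) sym(2) conv' Suc_leD[OF k] T0' T0m] by blast
    obtain s2 Qm dm Q d where s2: "strict_mono (s2 :: nat \<Rightarrow> nat)"
      and sd\<^sub>m: "\<And>m. sorted_diagonalization ?N (step_gramian (Gm (s (s1 (s2 m)))) n r k (T0m (s1 (s2 m)))) (Qm m) (dm m)"
      and sd: "sorted_diagonalization ?N (?L T0) Q d"
      and dl: "\<And>i. i < ?N \<Longrightarrow> (\<lambda>m. dm m i) \<longlonglongrightarrow> d i"
      using step_gramian_convergent_diagonalization[OF sym(2) forms_converge_subseq[OF conv' s1] k T0l] by blast
    let ?A = "\<lambda>m. step_gramian (Gm (s (s1 (s2 m)))) n r k (T0m (s1 (s2 m)))"
    have ev: "(\<lambda>m. eigval (?A m) j)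
        \<longlonglongrightarrow> eigval (?L T0) j" for j
      unfolding eigval_sorted_diagonalization[OF sd\<^sub>m] eigval_sorted_diagonalization[OF sd]
      using dl by (cases "1 \<le> j \<and> j \<le> ?N") auto
    have gap0: "eigval (?L T0) (?\<rho> + 1) < eigval (?L T0) ?\<rho>"
      using gap' step_gramian_eigval_unique[OF sym(1) T0' T0] by simp
    have "\<forall>\<^sub>F m in sequentially. eigval (?A m) (?\<rho> + 1)
        < eigval (?A m) ?\<rho>"
    proof -
      define c where "c = (eigval (?L T0) (?\<rho> + 1) + eigval (?L T0) ?\<rho>) / 2"
      have "eigval (?L T0) (?\<rho> + 1) < c" "c < eigval (?L T0) ?\<rho>"
        using gap0 by (auto simp: c_def)
      from order_tendstoD(2)[OF ev this(1)] order_tendstoD(1)[OF ev this(2)]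
      show ?thesis by eventually_elim simp
    qed
    then obtain m where gap: "eigval (?A m) (?\<rho> + 1)
        < eigval (?A m) ?\<rho>"
      unfolding eventually_sequentially by blast
    have "dominant_basis (?A m) ?\<rho>
        (first_columns ?N ?\<rho> (Qm m) * 1\<^sub>m ?\<rho>)"
      unfolding dominant_basis_iff[OF sd\<^sub>m \<rho> gap] by (intro exI[of _ "1\<^sub>m ?\<rho>"]) simp
    then have "\<exists>T. coef_tuple (Gm (s (s1 (s2 m)))) n r (Suc k) T"
      unfolding coef_tuple_Suc_iff using T0m gap \<rho> by blast
    then show False using no by blast
  qed
  then show ?case using IH by eventually_elim (simp add: Pr_def)
qed

section \<open>Galerkin systems\<close>

definition inverse_on :: "'i set \<Rightarrow> ('i \<Rightarrow> 'i \<Rightarrow> real) \<Rightarrow> ('i \<Rightarrow> 'i \<Rightarrow> real) \<Rightarrow> bool" where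
  "inverse_on I C D \<longleftrightarrow> (\<forall>i\<in>I. \<forall>j\<in>I. (\<Sum>l\<in>I. C i l * D l j) = (if i = j then 1 else 0) \<and>
     (\<Sum>l\<in>I. D i l * C l j) = (if i = j then 1 else 0))"

lemma inverse_on_solve_iff:
  assumes "finite I" "inverse_on I C D"
  shows "(\<forall>i\<in>I. (\<Sum>j\<in>I. C i j * c j) = b i) \<longleftrightarrow> (\<forall>i\<in>I. c i = (\<Sum>j\<in>I. D i j * b j))"
proof -
  have aux: "(\<Sum>j\<in>I. E i j * (\<Sum>l\<in>I. F j l * v l)) = v i"
    if "i \<in> I" and "\<And>l. l \<in> I \<Longrightarrow> (\<Sum>j\<in>I. E i j * F j l) = (if i = l then 1 else 0)" for i v and E F :: "'a \<Rightarrow> 'a \<Rightarrow> real"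
  proof -
    have "(\<Sum>j\<in>I. E i j * (\<Sum>l\<in>I. F j l * v l)) = (\<Sum>j\<in>I. \<Sum>l\<in>I. E i j * F j l * v l)"
      by (simp add: sum_distrib_left mult.assoc)
    also have "\<dots> = (\<Sum>l\<in>I. (\<Sum>j\<in>I. E i j * F j l) * v l)"
      by (subst sum.swap) (simp add: sum_distrib_right)
    also have "\<dots> = (\<Sum>l\<in>I. if l = i then v l else 0)"
      using that(2) by (intro sum.cong refl) auto
    finally show ?thesis using that(1) assms(1) by simp
  qed
  show ?thesis
  proof (intro iffI ballI)
    fix i assume c: "\<forall>i\<in>I. (\<Sum>j\<in>I. C i j * c j) = b i" and i: "i \<in> I"
    have "(\<Sum>j\<in>I. D i j * b j) = (\<Sum>j\<in>I. D i j * (\<Sum>l\<in>I. C j l * c l))"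
      using c by (intro sum.cong refl) simp
    also have "\<dots> = c i" using assms(2) i by (intro aux) (auto simp: inverse_on_def)
    finally show "c i = (\<Sum>j\<in>I. D i j * b j)" by simp
  next
    fix i assume c: "\<forall>i\<in>I. c i = (\<Sum>j\<in>I. D i j * b j)" and i: "i \<in> I"
    have "(\<Sum>j\<in>I. C i j * c j) = (\<Sum>j\<in>I. C i j * (\<Sum>l\<in>I. D j l * b l))"
      using c by (intro sum.cong refl) simp
    also have "\<dots> = b i" using assms(2) i by (intro aux) (auto simp: inverse_on_def)
    finally show "(\<Sum>j\<in>I. C i j * c j) = b i" .
  qed
qed

lemma det_tendsto:
  fixes A :: "real mat"
  assumes A: "A \<in> carrier_mat N N" "\<And>m. Am m \<in> carrier_mat N N"
    and lim: "\<And>i j. i < N \<Longrightarrow> j < N \<Longrightarrow> (\<lambda>m. Am m $$ (i, j)) \<longlonglongrightarrow> A $$ (i, j)"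
  shows "(\<lambda>m. Determinant.det (Am m)) \<longlonglongrightarrow> Determinant.det A"
  unfolding det_def'[OF A(1)] det_def'[OF A(2)]
proof (intro tendsto_sum tendsto_mult tendsto_const tendsto_prod)
  fix p i assume "p \<in> {p. p permutes {0..<N}}" "i \<in> {0..<N}"
  then have "i < N" "p i < N" using permutes_in_image[of p "{0..<N}" i] by auto
  then show "(\<lambda>m. Am m $$ (i, p i)) \<longlonglongrightarrow> A $$ (i, p i)" by (rule lim)
qed

text \<open>Entries of the adjugate are polynomials in the entries of the matrix.\<close>

lemma adj_mat_tendsto:
  fixes A :: "real mat"
  assumes A: "A \<in> carrier_mat N N" "\<And>m. Am m \<in> carrier_mat N N"
    and lim: "\<And>i j. i < N \<Longrightarrow> j < N \<Longrightarrow> (\<lambda>m. Am m $$ (i, j)) \<longlonglongrightarrow> A $$ (i, j)"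
    and ij: "i < N" "j < N"
  shows "(\<lambda>m. adj_mat (Am m) $$ (i, j)) \<longlonglongrightarrow> adj_mat A $$ (i, j)"
proof -
  have dims: "dim_row A = N" "dim_col A = N" "\<And>m. dim_row (Am m) = N" "\<And>m. dim_col (Am m) = N" using A by auto
  have "(\<lambda>m. Determinant.det (mat_delete (Am m) j i)) \<longlonglongrightarrow> Determinant.det (mat_delete A j i)"
  proof (rule det_tendsto[where N = "N - 1"])
    show "mat_delete A j i \<in> carrier_mat (N - 1) (N - 1)" using A(1) by (auto simp: mat_delete_def)
    show "mat_delete (Am m) j i \<in> carrier_mat (N - 1) (N - 1)" for m
      using A(2)[of m] by (auto simp: mat_delete_def)
    fix a b assume "a < N - 1" "b < N - 1"
    then show "(\<lambda>m. mat_delete (Am m) j i $$ (a, b)) \<longlonglongrightarrow> mat_delete A j i $$ (a, b)"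
      unfolding mat_delete_def dims by (auto intro!: lim)
  qed
  then show ?thesis
    unfolding adj_mat_def dims cofactor_def using ij by (auto intro!: tendsto_intros)
qed

lemma inverse_on_adj_mat:
  assumes e: "bij_betw e {..<N} I" and M: "M = Matrix.mat N N (\<lambda>(a, b). C (e a) (e b))"
    and det: "Determinant.det M \<noteq> 0"
  shows "inverse_on I C (\<lambda>i j. adj_mat M $$ (inv_into {..<N} e i, inv_into {..<N} e j) / Determinant.det M)"
proof -
  have Mc: "M \<in> carrier_mat N N" by (simp add: M)
  note adj = adj_mat[OF Mc]
  let ?D = "\<lambda>i j. adj_mat M $$ (inv_into {..<N} e i, inv_into {..<N} e j) / Determinant.det M"
  have inj: "inj_on e {..<N}" and im: "e ` {..<N} = I" using e by (auto simp: bij_betw_def)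
  have "(\<Sum>l\<in>I. C (e a) l * ?D l (e c)) = (if e a = e c then 1 else 0) \<and>
      (\<Sum>l\<in>I. ?D (e a) l * C l (e c)) = (if e a = e c then 1 else 0)" if ac: "a < N" "c < N" for a c
  proof -
    have e1: "(\<Sum>b<N. M $$ (a, b) * adj_mat M $$ (b, c)) = (if a = c then Determinant.det M else 0)"
      using mult_mat_entry[OF Mc adj(1) ac] ac unfolding adj(2) by auto
    have e2: "(\<Sum>b<N. adj_mat M $$ (a, b) * M $$ (b, c)) = (if a = c then Determinant.det M else 0)"
      using mult_mat_entry[OF adj(1) Mc ac] ac unfolding adj(3) by auto
    have eac: "e a = e c \<longleftrightarrow> a = c" using inj ac by (auto simp: inj_on_def)
    have "(\<Sum>l\<in>I. C (e a) l * ?D l (e c)) = (\<Sum>b<N. C (e a) (e b) * ?D (e b) (e c))"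
      by (rule sum.reindex_bij_betw[OF e, symmetric])
    also have "\<dots> = (\<Sum>b<N. M $$ (a, b) * adj_mat M $$ (b, c)) / Determinant.det M"
      unfolding sum_divide_distrib using ac inj by (intro sum.cong refl) (simp add: M)
    finally have 1: "(\<Sum>l\<in>I. C (e a) l * ?D l (e c)) = (if e a = e c then 1 else 0)"
      unfolding e1 eac using det by simp
    have "(\<Sum>l\<in>I. ?D (e a) l * C l (e c)) = (\<Sum>b<N. ?D (e a) (e b) * C (e b) (e c))"
      by (rule sum.reindex_bij_betw[OF e, symmetric])
    also have "\<dots> = (\<Sum>b<N. adj_mat M $$ (a, b) * M $$ (b, c)) / Determinant.det M"
      unfolding sum_divide_distrib using ac inj by (intro sum.cong refl) (simp add: M)
    finally have 2: "(\<Sum>l\<in>I. ?D (e a) l * C l (e c)) = (if e a = e c then 1 else 0)"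
      unfolding e2 eac using det by simp
    from 1 2 show ?thesis by blast
  qed
  then show ?thesis
    unfolding inverse_on_def im[symmetric] by auto
qed

definition nondegenerate_on :: "'i set \<Rightarrow> ('i \<Rightarrow> 'i \<Rightarrow> real) \<Rightarrow> bool" where
  "nondegenerate_on I C \<longleftrightarrow> (\<forall>c. (\<forall>i\<in>I. (\<Sum>j\<in>I. C i j * c j) = 0) \<longrightarrow> (\<forall>i\<in>I. c i = 0))"

text \<open>Cramer's rule: inverses depend continuously on the matrix and exist near an invertible one.
  Matrices are indexed by an arbitrary finite set, since both tuples and tensor bases occur.\<close>

lemma convergent_inverses:
  assumes I: "finite I" and lim: "\<forall>i\<in>I. \<forall>j\<in>I. (\<lambda>m. Cm m i j) \<longlonglongrightarrow> C i j"
    and nondeg: "nondegenerate_on I C"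
  shows "\<exists>Dm D. inverse_on I C D \<and> (\<forall>\<^sub>F m in sequentially. inverse_on I (Cm m) (Dm m)) \<and>
    (\<forall>i\<in>I. \<forall>j\<in>I. (\<lambda>m. Dm m i j) \<longlonglongrightarrow> (D i j :: real))"
proof -
  define N where "N = card I"
  obtain e where e: "bij_betw e {..<N} I"
    using ex_bij_betw_nat_finite[OF I] by (auto simp: N_def atLeast0LessThan)
  have inj: "inj_on e {..<N}" and im: "e ` {..<N} = I" using e by (auto simp: bij_betw_def)
  define M where "M m = Matrix.mat N N (\<lambda>(a, b). Cm m (e a) (e b))" for m
  define M0 where "M0 = Matrix.mat N N (\<lambda>(a, b). C (e a) (e b))"
  have Mc: "\<And>m. M m \<in> carrier_mat N N" and M0c: "M0 \<in> carrier_mat N N" by (auto simp: M_def M0_def)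
  have Ml: "(\<lambda>m. M m $$ (a, b)) \<longlonglongrightarrow> M0 $$ (a, b)" if "a < N" "b < N" for a b
    using that im lim by (auto simp: M_def M0_def)
  have detl: "(\<lambda>m. Determinant.det (M m)) \<longlonglongrightarrow> Determinant.det M0"
    by (rule det_tendsto[OF M0c Mc Ml])
  have det0: "Determinant.det M0 \<noteq> 0"
  proof
    assume "Determinant.det M0 = 0"
    then obtain v where v: "v \<in> carrier_vec N" "v \<noteq> 0\<^sub>v N" "M0 *\<^sub>v v = 0\<^sub>v N"
      using det_0_iff_vec_prod_zero[OF M0c] by blast
    define c where "c i = vec_index v (inv_into {..<N} e i)" for i
    have "(\<Sum>j\<in>I. C i j * c j) = 0" if "i \<in> I" for i
    proof -
      obtain a where a: "a < N" "i = e a" using \<open>i \<in> I\<close> im by blast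
      have "(\<Sum>j\<in>I. C i j * c j) = (\<Sum>b<N. C i (e b) * c (e b))"
        by (rule sum.reindex_bij_betw[OF e, symmetric])
      also have "\<dots> = (\<Sum>b\<in>{0..<N}. M0 $$ (a, b) * vec_index v b)"
        using a inj by (intro sum.cong) (auto simp: M0_def c_def)
      also have "\<dots> = vec_index (M0 *\<^sub>v v) a"
        using a M0c v(1) by (simp add: scalar_prod_def)
      finally show ?thesis using v(3) a by simp
    qed
    then have "c i = 0" if "i \<in> I" for i
      using nondeg that unfolding nondegenerate_on_def by blast
    then have "vec_index v a = 0" if "a < N" for a
      using that im inj c_def[of "e a"] by auto
    then have "v = 0\<^sub>v N" using v(1) by (intro eq_vecI) auto
    then show False using v(2) by blast
  qed
  let ?f = "inv_into {..<N} e"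
  define Dm where "Dm m = (\<lambda>i j. adj_mat (M m) $$ (?f i, ?f j) / Determinant.det (M m))" for m
  define D where "D = (\<lambda>i j. adj_mat M0 $$ (?f i, ?f j) / Determinant.det M0)"
  have "inverse_on I C D" unfolding D_def by (rule inverse_on_adj_mat[OF e M0_def det0])
  moreover have "\<forall>\<^sub>F m in sequentially. inverse_on I (Cm m) (Dm m)"
    using tendsto_imp_eventually_ne[OF detl det0]
    by eventually_elim (unfold Dm_def, rule inverse_on_adj_mat[OF e M_def])
  moreover have "(\<lambda>m. Dm m i j) \<longlonglongrightarrow> D i j" if "i \<in> I" "j \<in> I" for i j
  proof -
    have "?f i < N" "?f j < N" using inv_into_into[of _ e "{..<N}"] that im by auto
    then show ?thesis unfolding Dm_def D_def
      by (intro tendsto_divide detl det0 adj_mat_tendsto[OF M0c Mc Ml])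
  qed
  ultimately show ?thesis by blast
qed

lemma sum_mult_all_eq_0_iff:
  fixes w :: "'i \<Rightarrow> real"
  assumes "finite I"
  shows "(\<forall>u. (\<Sum>i\<in>I. u i * w i) = 0) \<longleftrightarrow> (\<forall>i\<in>I. w i = 0)"
proof (intro iffI ballI allI)
  fix i assume *: "\<forall>u. (\<Sum>i\<in>I. u i * w i) = 0" and i: "i \<in> I"
  have "(\<Sum>j\<in>I. (if j = i then 1 else 0) * w j) = 0" by (rule *[THEN spec])
  moreover have "(\<Sum>j\<in>I. (if j = i then 1 else 0) * w j) = (\<Sum>j\<in>I. if j = i then w j else 0)"
    by (intro sum.cong refl) auto
  ultimately show "w i = 0" using assms i by simp
qed simp

lemma ball_fun_span_iff: "(\<forall>f\<in>fun_span L \<theta>. P f) \<longleftrightarrow> (\<forall>u. P (\<lambda>x. \<Sum>l\<in>L. u l * \<theta> l x))"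
  unfolding fun_span_def by blast

lemma fun_spanI: "(\<lambda>x. \<Sum>l\<in>L. c l * \<theta> l x) \<in> fun_span L \<theta>"
  unfolding fun_span_def by (intro CollectI exI[of _ c]) simp

text \<open>Orthogonal projections and the empirical Koopman operator are defined by a definite description of
  an element of a span that satisfies a variational equation. If the equation amounts to a uniquely
  solvable linear system for the coefficients, the description is the solution.\<close>

lemma fun_span_galerkin:
  assumes L: "finite L" and inv: "inverse_on L C D"
    and iff: "\<And>c. (\<forall>f\<in>fun_span L \<theta>. Phi f (\<lambda>x. \<Sum>l\<in>L. c l * \<theta> l x)) \<longleftrightarrow> (\<forall>l\<in>L. (\<Sum>l'\<in>L. C l l' * c l') = b l)"
  shows "(THE h. h \<in> fun_span L \<theta> \<and> (\<forall>f\<in>fun_span L \<theta>. Phi f h)) =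
    (\<lambda>x. \<Sum>l\<in>L. (\<Sum>l'\<in>L. D l l' * b l') * \<theta> l x)" (is "_ = ?h")
proof (rule the_equality)
  show "?h \<in> fun_span L \<theta> \<and> (\<forall>f\<in>fun_span L \<theta>. Phi f ?h)"
  proof
    show "?h \<in> fun_span L \<theta>" by (rule fun_spanI)
    show "\<forall>f\<in>fun_span L \<theta>. Phi f ?h" unfolding iff inverse_on_solve_iff[OF L inv] by simp
  qed
next
  fix h assume h: "h \<in> fun_span L \<theta> \<and> (\<forall>f\<in>fun_span L \<theta>. Phi f h)"
  then obtain c where hc: "h = (\<lambda>x. \<Sum>l\<in>L. c l * \<theta> l x)" by (auto simp: fun_span_def)
  have "\<forall>l\<in>L. (\<Sum>l'\<in>L. C l l' * c l') = b l" using h iff[of c] by (simp add: hc)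
  then have "\<forall>l\<in>L. c l = (\<Sum>l'\<in>L. D l l' * b l')" by (simp add: inverse_on_solve_iff[OF L inv])
  then show "h = ?h" unfolding hc by (intro ext sum.cong refl) simp
qed

section \<open>Projections onto spectral subspaces\<close>

text \<open>Coefficients of the projection onto the span of the columns of \<open>T\<close>, in matrix notation
  \<open>T D T\<^sup>T \<beta>\<close>, where \<open>D\<close> is the inverse of the Gram matrix of the columns and \<open>\<beta> i\<close> is the pairing of
  the projected object with the \<open>i\<close>-th basis function.\<close>

definition galerkin_coef :: "'i set \<Rightarrow> nat \<Rightarrow> ('i \<Rightarrow> nat \<Rightarrow> real) \<Rightarrow> (nat \<Rightarrow> nat \<Rightarrow> real) \<Rightarrow> ('i \<Rightarrow> real) \<Rightarrow> 'i \<Rightarrow> real" where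
  "galerkin_coef I \<rho> T D \<beta> i = (\<Sum>l<\<rho>. T i l * (\<Sum>l'<\<rho>. D l l' * (\<Sum>j\<in>I. T j l' * \<beta> j)))"

definition subspace_gramian :: "'i set \<Rightarrow> ('i \<Rightarrow> 'i \<Rightarrow> real) \<Rightarrow> ('i \<Rightarrow> nat \<Rightarrow> real) \<Rightarrow> nat \<Rightarrow> nat \<Rightarrow> real" where
  "subspace_gramian I g T l l' = (\<Sum>i\<in>I. \<Sum>j\<in>I. T i l * T j l' * g i j)"

definition positive_definite_on :: "'i set \<Rightarrow> ('i \<Rightarrow> 'i \<Rightarrow> real) \<Rightarrow> bool" where
  "positive_definite_on I g \<longleftrightarrow> (\<forall>c. (\<Sum>i\<in>I. \<Sum>j\<in>I. c i * c j * g i j) \<ge> 0 \<and>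
     ((\<Sum>i\<in>I. \<Sum>j\<in>I. c i * c j * g i j) = 0 \<longrightarrow> (\<forall>i\<in>I. c i = 0)))"

lemma positive_definite_on_nondegenerate:
  assumes "positive_definite_on I g"
  shows "nondegenerate_on I g"
  unfolding nondegenerate_on_def
proof (intro allI impI)
  fix c assume 0: "\<forall>i\<in>I. (\<Sum>j\<in>I. g i j * c j) = 0"
  have "(\<Sum>i\<in>I. \<Sum>j\<in>I. c i * c j * g i j) = (\<Sum>i\<in>I. c i * (\<Sum>j\<in>I. g i j * c j))"
    by (simp add: sum_distrib_left mult_ac)
  also have "\<dots> = 0" using 0 by simp
  finally show "\<forall>i\<in>I. c i = 0" using assms unfolding positive_definite_on_def by blast
qed

text \<open>A positive definite form stays positive definite on a subspace; orthonormality ensures that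
  the columns of \<open>T\<close> are independent.\<close>

lemma subspace_gramian_nondegenerate:
  assumes pd: "positive_definite_on I g"
    and on: "\<And>l l'. l < \<rho> \<Longrightarrow> l' < \<rho> \<Longrightarrow> (\<Sum>i\<in>I. T i l * T i l') = (if l = l' then 1 else 0)"
  shows "nondegenerate_on {..<\<rho>} (subspace_gramian I g T)"
  unfolding nondegenerate_on_def
proof (intro allI impI ballI)
  fix c l assume 0: "\<forall>l\<in>{..<\<rho>}. (\<Sum>l'<\<rho>. subspace_gramian I g T l l' * c l') = 0" and l: "l \<in> {..<\<rho>}"
  define v where "v i = (\<Sum>l<\<rho>. c l * T i l)" for i
  let ?F = "\<lambda>i j l l'. c l * T i l * (c l' * T j l') * g i j"
  have "(\<Sum>i\<in>I. \<Sum>j\<in>I. v i * v j * g i j) = (\<Sum>i\<in>I. \<Sum>j\<in>I. \<Sum>l<\<rho>. \<Sum>l'<\<rho>. ?F i j l l')"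
    unfolding v_def sum_product by (simp add: sum_distrib_right)
  also have "\<dots> = (\<Sum>i\<in>I. \<Sum>l<\<rho>. \<Sum>j\<in>I. \<Sum>l'<\<rho>. ?F i j l l')"
    by (rule sum.cong[OF refl], rule sum.swap)
  also have "\<dots> = (\<Sum>l<\<rho>. \<Sum>i\<in>I. \<Sum>j\<in>I. \<Sum>l'<\<rho>. ?F i j l l')"
    by (rule sum.swap)
  also have "\<dots> = (\<Sum>l<\<rho>. \<Sum>i\<in>I. \<Sum>l'<\<rho>. \<Sum>j\<in>I. ?F i j l l')"
    by (rule sum.cong[OF refl], rule sum.cong[OF refl], rule sum.swap)
  also have "\<dots> = (\<Sum>l<\<rho>. \<Sum>l'<\<rho>. \<Sum>i\<in>I. \<Sum>j\<in>I. ?F i j l l')"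
    by (rule sum.cong[OF refl], rule sum.swap)
  also have "\<dots> = (\<Sum>l<\<rho>. c l * (\<Sum>l'<\<rho>. subspace_gramian I g T l l' * c l'))"
    unfolding subspace_gramian_def by (simp add: sum_distrib_left sum_distrib_right mult_ac)
  also have "\<dots> = 0" using 0 by simp
  finally have v0: "\<And>i. i \<in> I \<Longrightarrow> v i = 0" using pd unfolding positive_definite_on_def by blast
  have "0 = (\<Sum>i\<in>I. T i l * v i)" using v0 by simp
  also have "\<dots> = (\<Sum>l'<\<rho>. \<Sum>i\<in>I. c l' * (T i l * T i l'))"
    unfolding v_def sum_distrib_left by (subst sum.swap) (simp add: mult_ac)
  also have "\<dots> = (\<Sum>l'<\<rho>. if l' = l then c l' else 0)"
    using on l by (intro sum.cong refl) (auto simp: sum_distrib_left[symmetric])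
  finally show "c l = 0" using l by simp
qed

text \<open>The projected function \<open>h\<close> need not lie in the tensor space: only its pairings \<open>\<beta>\<close> with the basis
  enter. This covers the image of the Koopman operator.\<close>

lemma ortho_proj_combine:
  assumes inv: "inverse_on {..<\<rho>} (subspace_gramian (multi_indices n k) g T) D"
    and pair: "\<And>u c. ip (combine n \<psi> k u) (\<lambda>x. h x - combine n \<psi> k c x) =
      (\<Sum>i\<in>multi_indices n k. u i * (\<beta> i - (\<Sum>j\<in>multi_indices n k. g i j * c j)))"
  shows "ortho_proj ip (fun_span {..<\<rho>} (\<lambda>l. combine n \<psi> k (\<lambda>i. T i l))) h =
    combine n \<psi> k (galerkin_coef (multi_indices n k) \<rho> T D \<beta>)"
proof -
  let ?I = "multi_indices n k" and ?\<theta> = "\<lambda>l. combine n \<psi> k (\<lambda>i. T i l)"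
  let ?C = "subspace_gramian ?I g T" and ?b = "\<lambda>l. \<Sum>i\<in>?I. T i l * \<beta> i"
  have lin: "(\<lambda>x. \<Sum>l<\<rho>. c l * ?\<theta> l x) = combine n \<psi> k (\<lambda>i. \<Sum>l<\<rho>. c l * T i l)" for c
    by (intro ext) (rule combine_sum)
  have ip: "ip (\<lambda>x. \<Sum>l<\<rho>. u l * ?\<theta> l x) (\<lambda>x. h x - (\<Sum>l<\<rho>. c l * ?\<theta> l x)) =
      (\<Sum>l<\<rho>. u l * (?b l - (\<Sum>l'<\<rho>. ?C l l' * c l')))" for u c
  proof -
    have gc: "(\<Sum>i\<in>?I. T i l * (\<Sum>j\<in>?I. g i j * (\<Sum>l'<\<rho>. c l' * T j l'))) = (\<Sum>l'<\<rho>. ?C l l' * c l')" for l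
    proof -
      let ?F = "\<lambda>i j l'. T i l * T j l' * g i j * c l'"
      have "(\<Sum>i\<in>?I. T i l * (\<Sum>j\<in>?I. g i j * (\<Sum>l'<\<rho>. c l' * T j l'))) = (\<Sum>i\<in>?I. \<Sum>j\<in>?I. \<Sum>l'<\<rho>. ?F i j l')"
        by (simp add: sum_distrib_left mult_ac)
      also have "\<dots> = (\<Sum>i\<in>?I. \<Sum>l'<\<rho>. \<Sum>j\<in>?I. ?F i j l')"
        by (rule sum.cong[OF refl], rule sum.swap)
      also have "\<dots> = (\<Sum>l'<\<rho>. \<Sum>i\<in>?I. \<Sum>j\<in>?I. ?F i j l')"
        by (rule sum.swap)
      finally show ?thesis by (simp add: subspace_gramian_def sum_distrib_right)
    qed
    have "ip (\<lambda>x. \<Sum>l<\<rho>. u l * ?\<theta> l x) (\<lambda>x. h x - (\<Sum>l<\<rho>. c l * ?\<theta> l x)) =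
        (\<Sum>i\<in>?I. (\<Sum>l<\<rho>. u l * T i l) * (\<beta> i - (\<Sum>j\<in>?I. g i j * (\<Sum>l'<\<rho>. c l' * T j l'))))"
      using pair[of "\<lambda>i. \<Sum>l<\<rho>. u l * T i l" "\<lambda>i. \<Sum>l<\<rho>. c l * T i l"] by (simp only: combine_sum)
    also have "\<dots> = (\<Sum>l<\<rho>. \<Sum>i\<in>?I. u l * (T i l * (\<beta> i - (\<Sum>j\<in>?I. g i j * (\<Sum>l'<\<rho>. c l' * T j l')))))"
      by (subst sum.swap) (simp add: sum_distrib_right mult.assoc)
    also have "\<dots> = (\<Sum>l<\<rho>. u l * (?b l - (\<Sum>l'<\<rho>. ?C l l' * c l')))"
      unfolding sum_distrib_left[symmetric] gc[symmetric] by (simp add: right_diff_distrib sum_subtractf)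
    finally show ?thesis .
  qed
  have "ortho_proj ip (fun_span {..<\<rho>} ?\<theta>) h =
      (\<lambda>x. \<Sum>l<\<rho>. (\<Sum>l'<\<rho>. D l l' * ?b l') * ?\<theta> l x)"
    unfolding ortho_proj_def
  proof (rule fun_span_galerkin[OF _ inv])
    fix c
    show "(\<forall>f\<in>fun_span {..<\<rho>} ?\<theta>. ip f (\<lambda>x. h x - (\<Sum>l<\<rho>. c l * ?\<theta> l x)) = 0) \<longleftrightarrow>
        (\<forall>l\<in>{..<\<rho>}. (\<Sum>l'<\<rho>. ?C l l' * c l') = ?b l)"
      unfolding ball_fun_span_iff ip sum_mult_all_eq_0_iff[OF finite_lessThan] by auto
  qed simp
  also have "\<dots> = combine n \<psi> k (galerkin_coef ?I \<rho> T D \<beta>)"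
    unfolding lin galerkin_coef_def by (simp add: mult.commute)
  finally show ?thesis .
qed

lemma fun_span_rotation_subset:
  assumes T': "\<forall>i\<in>multi_indices n k. \<forall>l<\<rho>. T' i l = (\<Sum>l'<\<rho>. T i l' * (R l' l :: real))"
  shows "fun_span {..<\<rho>} (\<lambda>l. combine n \<psi> k (\<lambda>i. T' i l)) \<subseteq> fun_span {..<\<rho>} (\<lambda>l. combine n \<psi> k (\<lambda>i. T i l))"
proof
  fix f assume "f \<in> fun_span {..<\<rho>} (\<lambda>l. combine n \<psi> k (\<lambda>i. T' i l))"
  then obtain c where f: "f = (\<lambda>x. \<Sum>l<\<rho>. c l * combine n \<psi> k (\<lambda>i. T' i l) x)" unfolding fun_span_def by blast
  have "combine n \<psi> k (\<lambda>i. T' i l) x = (\<Sum>l'<\<rho>. R l' l * combine n \<psi> k (\<lambda>i. T i l') x)" if "l < \<rho>" for l x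
    unfolding combine_sum using T' that by (simp add: combine_def mult.commute)
  then have "f = (\<lambda>x. \<Sum>l<\<rho>. \<Sum>l'<\<rho>. c l * (R l' l * combine n \<psi> k (\<lambda>i. T i l') x))"
    unfolding f by (simp add: sum_distrib_left)
  also have "\<dots> = (\<lambda>x. \<Sum>l'<\<rho>. (\<Sum>l<\<rho>. c l * R l' l) * combine n \<psi> k (\<lambda>i. T i l') x)"
    by (subst sum.swap) (simp add: sum_distrib_right mult.assoc)
  finally show "f \<in> fun_span {..<\<rho>} (\<lambda>l. combine n \<psi> k (\<lambda>i. T i l))" by (simp only: fun_spanI)
qed

text \<open>The definite description has at most one candidate, because all tuples are rotations of each other.\<close>

lemma spectral_subspace_eq:
  assumes rep: "represents ip n \<psi> p G" and sym: "symmetric_form G" and k: "k \<le> p"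
    and T: "coef_tuple G n r k T"
  shows "spectral_subspace ip n \<psi> r k = fun_span {..<ext_rank r k} (\<lambda>l. combine n \<psi> k (\<lambda>i. T i l))"
  unfolding spectral_subspace_def spectral_tuple_iff_coef_tuple[OF rep k]
proof (rule the_equality)
  show "\<exists>\<theta>. (\<exists>T. coef_tuple G n r k T \<and> \<theta> = (\<lambda>l. combine n \<psi> k (\<lambda>i. T i l))) \<and>
      fun_span {..<ext_rank r k} (\<lambda>l. combine n \<psi> k (\<lambda>i. T i l)) = fun_span {..<ext_rank r k} \<theta>"
    using T by blast
next
  fix H assume "\<exists>\<theta>. (\<exists>T. coef_tuple G n r k T \<and> \<theta> = (\<lambda>l. combine n \<psi> k (\<lambda>i. T i l))) \<and>
      H = fun_span {..<ext_rank r k} \<theta>"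
  then obtain T' where T': "coef_tuple G n r k T'"
    and H: "H = fun_span {..<ext_rank r k} (\<lambda>l. combine n \<psi> k (\<lambda>i. T' i l))" by blast
  obtain R where R: "\<forall>i\<in>multi_indices n k. \<forall>l<ext_rank r k. T' i l = (\<Sum>l'<ext_rank r k. T i l' * R $$ (l', l))"
    using coef_tuple_unique_up_to_rotation[OF sym T T'] by blast
  obtain R' where R': "\<forall>i\<in>multi_indices n k. \<forall>l<ext_rank r k. T i l = (\<Sum>l'<ext_rank r k. T' i l' * R' $$ (l', l))"
    using coef_tuple_unique_up_to_rotation[OF sym T' T] by blast
  show "H = fun_span {..<ext_rank r k} (\<lambda>l. combine n \<psi> k (\<lambda>i. T i l))"
    unfolding H
    using fun_span_rotation_subset[where R = "\<lambda>l' l. R $$ (l', l)" and \<psi> = \<psi>, OF R]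
      fun_span_rotation_subset[where R = "\<lambda>l' l. R' $$ (l', l)" and \<psi> = \<psi>, OF R'] by (rule equalityI)
qed

lemma coef_tuple_prefix:
  assumes "coef_tuple G n r p T" "k \<le> p"
  shows "\<exists>T. coef_tuple G n r k T"
  using assms
proof (induction p arbitrary: T)
  case (Suc p)
  show ?case
  proof (cases "k = Suc p")
    case False
    then have "k \<le> p" using Suc.prems by simp
    then show ?thesis using Suc.IH Suc.prems(1) unfolding coef_tuple_Suc_iff by blast
  qed (use Suc.prems in blast)
qed auto

section \<open>Empirical operators in coordinates\<close>

definition tensor_gramian where
  "tensor_gramian ip \<psi> k i j = ip (tensor_basis \<psi> k i) (tensor_basis \<psi> k j)"

definition cross_gramian where
  "cross_gramian m xs ys \<psi> \<phi> k i j =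
     (\<Sum>t<m. tensor_basis \<psi> k i (xs t) * tensor_basis \<phi> k j (ys t)) / real m"

lemma ball_tensor_span_iff:
  "(\<forall>f\<in>fun_span (multi_indices n k) (tensor_basis \<psi> k). P f) \<longleftrightarrow> (\<forall>u. P (combine n \<psi> k u))"
  by (simp add: ball_fun_span_iff combine_def)

lemma emp_cross_combine:
  "(\<Sum>t<m. combine n \<psi> k a (xs t) * combine n' \<phi> k b (ys t)) / real m =
    (\<Sum>i\<in>multi_indices n k. \<Sum>j\<in>multi_indices n' k. a i * b j * cross_gramian m xs ys \<psi> \<phi> k i j)"
proof -
  let ?I = "multi_indices n k" and ?J = "multi_indices n' k"
  let ?F = "\<lambda>t i j. a i * b j * (tensor_basis \<psi> k i (xs t) * tensor_basis \<phi> k j (ys t))"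
  have "(\<Sum>t<m. combine n \<psi> k a (xs t) * combine n' \<phi> k b (ys t)) = (\<Sum>t<m. \<Sum>i\<in>?I. \<Sum>j\<in>?J. ?F t i j)"
    unfolding combine_def sum_product by (simp add: mult_ac)
  also have "\<dots> = (\<Sum>i\<in>?I. \<Sum>t<m. \<Sum>j\<in>?J. ?F t i j)" by (rule sum.swap)
  also have "\<dots> = (\<Sum>i\<in>?I. \<Sum>j\<in>?J. \<Sum>t<m. ?F t i j)" by (rule sum.cong[OF refl], rule sum.swap)
  finally show ?thesis
    by (simp add: cross_gramian_def sum_divide_distrib sum_distrib_left)
qed

lemma tensor_gramian_emp_inner: "tensor_gramian (emp_inner m xs) \<psi> = cross_gramian m xs xs \<psi> \<psi>"
  by (intro ext) (simp add: tensor_gramian_def cross_gramian_def emp_inner_def)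

lemma emp_inner_represents: "represents (emp_inner m xs) n \<psi> p (tensor_gramian (emp_inner m xs) \<psi>)"
  unfolding represents_def tensor_gramian_emp_inner emp_inner_def
  by (intro ballI allI) (rule emp_cross_combine)

lemma symmetric_form_emp: "symmetric_form (tensor_gramian (emp_inner m xs) \<psi>)"
  by (simp add: symmetric_form_def tensor_gramian_def emp_inner_def mult.commute)

lemma combine_diff: "(\<lambda>x. combine n \<psi> k a x - combine n \<psi> k b x) = combine n \<psi> k (\<lambda>i. a i - b i)"
  by (simp add: combine_def fun_eq_iff sum_subtractf left_diff_distrib)

lemma tensor_space_eq: "tensor_space n \<psi> k = range (combine n \<psi> k)"
  by (auto simp: tensor_space_def fun_span_def combine_def[abs_def])

lemma represents_diff:
  assumes "represents ip n \<psi> p G" "k \<in> {1..p}"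
  shows "ip (combine n \<psi> k u) (\<lambda>x. combine n \<psi> k a x - combine n \<psi> k c x) =
    (\<Sum>i\<in>multi_indices n k. u i * ((\<Sum>j\<in>multi_indices n k. G k i j * a j) - (\<Sum>j\<in>multi_indices n k. G k i j * c j)))"
proof -
  have "ip (combine n \<psi> k u) (combine n \<psi> k (\<lambda>i. a i - c i)) =
      (\<Sum>i\<in>multi_indices n k. \<Sum>j\<in>multi_indices n k. u i * (a j - c j) * G k i j)"
    using assms unfolding represents_def by blast
  then show ?thesis
    unfolding combine_diff by (simp add: sum_distrib_left sum_subtractf[symmetric] algebra_simps)
qed

text \<open>Projecting the image onto a spectral subspace evaluates only its pairings with the basis, which are
  the Gram matrix applied to \<open>c\<close>. So the system for \<open>c\<close> is more useful than its solution.\<close>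

lemma emp_koopman_combine:
  assumes inv: "inverse_on (multi_indices n k) (tensor_gramian (emp_inner m xs) \<psi> k) E"
  shows "\<exists>c. emp_koopman m xs ys (tensor_space n \<psi> k) (combine n' \<phi> k a) = combine n \<psi> k c \<and>
    (\<forall>i\<in>multi_indices n k. (\<Sum>j\<in>multi_indices n k. tensor_gramian (emp_inner m xs) \<psi> k i j * c j) =
      (\<Sum>j\<in>multi_indices n' k. cross_gramian m xs ys \<psi> \<phi> k i j * a j))"
proof -
  let ?I = "multi_indices n k"
  define G where "G = tensor_gramian (emp_inner m xs) \<psi> k"
  define b where "b i = (\<Sum>j\<in>multi_indices n' k. cross_gramian m xs ys \<psi> \<phi> k i j * a j)" for i
  define c where "c i = (\<Sum>j\<in>?I. E i j * b j)" for i
  have inv': "inverse_on ?I G E" using inv by (simp add: G_def)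
  have eq: "emp_inner m xs (combine n \<psi> k u) (combine n \<psi> k v) - (\<Sum>t<m. combine n \<psi> k u (xs t) * combine n' \<phi> k a (ys t)) / real m
      = (\<Sum>i\<in>?I. u i * ((\<Sum>j\<in>?I. G i j * v j) - b i))" for u v
    unfolding emp_inner_def emp_cross_combine G_def b_def tensor_gramian_emp_inner
    by (simp add: right_diff_distrib sum_subtractf sum_distrib_left mult_ac)
  have "emp_koopman m xs ys (tensor_space n \<psi> k) (combine n' \<phi> k a) =
      (\<lambda>x. \<Sum>l\<in>?I. (\<Sum>l'\<in>?I. E l l' * b l') * tensor_basis \<psi> k l x)"
    unfolding emp_koopman_def tensor_space_def
  proof (rule fun_span_galerkin[OF _ inv'])
    fix v
    have cv: "(\<lambda>x. \<Sum>l\<in>?I. v l * tensor_basis \<psi> k l x) = combine n \<psi> k v" for v by (simp add: combine_def)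
    show "(\<forall>h\<in>fun_span ?I (tensor_basis \<psi> k). emp_inner m xs h (\<lambda>x. \<Sum>l\<in>?I. v l * tensor_basis \<psi> k l x) =
          (\<Sum>j<m. h (xs j) * combine n' \<phi> k a (ys j)) / real m) \<longleftrightarrow>
        (\<forall>l\<in>?I. (\<Sum>l'\<in>?I. G l l' * v l') = b l)"
    proof -
      have "emp_inner m xs (combine n \<psi> k u) (combine n \<psi> k v) =
          (\<Sum>t<m. combine n \<psi> k u (xs t) * combine n' \<phi> k a (ys t)) / real m \<longleftrightarrow>
          (\<Sum>i\<in>?I. u i * ((\<Sum>j\<in>?I. G i j * v j) - b i)) = 0" for u
        using eq[of u v] by linarith
      then show ?thesis
        unfolding cv ball_tensor_span_iff by (simp add: sum_mult_all_eq_0_iff)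
    qed
  qed simp
  moreover have "\<forall>i\<in>?I. (\<Sum>j\<in>?I. G i j * c j) = b i"
    unfolding inverse_on_solve_iff[OF finite_multi_indices inv'] by (simp add: c_def)
  ultimately show ?thesis
    unfolding G_def b_def by (intro exI[of _ c]) (auto simp: combine_def c_def b_def)
qed

text \<open>A unit ball for a definite form is bounded in coordinates: the pairings of \<open>a\<close> with the basis are
  bounded by positivity at \<open>a \<plusminus> e\<^sub>j\<close>, and the inverse Gram matrix recovers \<open>a\<close> from them.\<close>

lemma positive_definite_on_coef_bound:
  assumes I: "finite I" and pd: "positive_definite_on I g" and sym: "\<And>i j. g i j = g j i"
  shows "\<exists>B. \<forall>a. (\<Sum>i\<in>I. \<Sum>j\<in>I. a i * a j * g i j) \<le> 1 \<longrightarrow> (\<forall>i\<in>I. \<bar>a i\<bar> \<le> B)"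
proof -
  obtain D where D: "inverse_on I g D"
    using convergent_inverses[OF I _ positive_definite_on_nondegenerate[OF pd], of "\<lambda>_. g"] by auto
  have bound: "\<bar>\<Sum>l\<in>I. g j l * a l\<bar> \<le> (g j j + 1) / 2"
    if le: "(\<Sum>i\<in>I. \<Sum>j\<in>I. a i * a j * g i j) \<le> 1" and j: "j \<in> I" for a j
  proof -
    define b where "b = (\<Sum>l\<in>I. g j l * a l)"
    have *: "0 \<le> (\<Sum>i\<in>I. \<Sum>l\<in>I. a i * a l * g i l) + 2 * t * b + t\<^sup>2 * g j j" for t
    proof -
      let ?e = "\<lambda>i. if i = j then t else 0"
      have e: "(\<Sum>i\<in>I. ?e i * f i) = t * f j" for f :: "'a \<Rightarrow> real"
      proof -
        have "(\<Sum>i\<in>I. ?e i * f i) = (\<Sum>i\<in>I. if i = j then t * f i else 0)"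
          by (intro sum.cong refl) auto
        then show ?thesis using I j by simp
      qed
      have "0 \<le> (\<Sum>i\<in>I. \<Sum>l\<in>I. (a i + ?e i) * (a l + ?e l) * g i l)"
        using pd[unfolded positive_definite_on_def, THEN spec, of "\<lambda>i. a i + ?e i"] by (rule conjunct1)
      also have "\<dots> = (\<Sum>i\<in>I. (\<Sum>l\<in>I. a i * a l * g i l) + a i * (\<Sum>l\<in>I. ?e l * g i l)
          + ?e i * (\<Sum>l\<in>I. a l * g i l) + ?e i * (\<Sum>l\<in>I. ?e l * g i l))"
        by (intro sum.cong refl) (simp add: sum_distrib_left sum.distrib distrib_right distrib_left mult.assoc)
      also have "\<dots> = (\<Sum>i\<in>I. \<Sum>l\<in>I. a i * a l * g i l) + (\<Sum>i\<in>I. a i * (t * g i j))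
          + t * (\<Sum>l\<in>I. a l * g j l) + t * (t * g j j)"
        unfolding e by (simp only: sum.distrib e)
      also have "(\<Sum>i\<in>I. a i * (t * g i j)) = t * b"
        unfolding b_def sum_distrib_left by (intro sum.cong refl) (simp add: sym[of j] mult_ac)
      also have "(\<Sum>l\<in>I. a l * g j l) = b"
        unfolding b_def by (intro sum.cong refl) (simp add: mult_ac)
      finally show ?thesis by (simp add: power2_eq_square algebra_simps)
    qed
    show ?thesis using *[of 1] *[of "-1"] le unfolding b_def[symmetric] by (simp add: abs_le_iff)
  qed
  define B where "B = (\<Sum>i\<in>I. \<Sum>j\<in>I. \<bar>D i j\<bar> * ((g j j + 1) / 2))"
  have "\<bar>a i\<bar> \<le> B" if le: "(\<Sum>i\<in>I. \<Sum>j\<in>I. a i * a j * g i j) \<le> 1" and i: "i \<in> I" for a i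
  proof -
    have b0: "0 \<le> (g j j + 1) / 2" if "j \<in> I" for j
      using bound[OF le that] by linarith
    have "a i = (\<Sum>j\<in>I. D i j * (\<Sum>l\<in>I. g j l * a l))"
      using inverse_on_solve_iff[OF I D, of a "\<lambda>j. \<Sum>l\<in>I. g j l * a l"] i by blast
    then have "\<bar>a i\<bar> \<le> (\<Sum>j\<in>I. \<bar>D i j * (\<Sum>l\<in>I. g j l * a l)\<bar>)" by (metis sum_abs)
    also have "\<dots> \<le> (\<Sum>j\<in>I. \<bar>D i j\<bar> * ((g j j + 1) / 2))"
      unfolding abs_mult using bound[OF le] by (intro sum_mono mult_left_mono) auto
    also have "\<dots> \<le> B"
      unfolding B_def using I i b0 by (intro member_le_sum sum_nonneg mult_nonneg_nonneg) auto
    finally show ?thesis .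
  qed
  then show ?thesis by blast
qed

section \<open>Convergence along a fixed sample path\<close>

lemma galerkin_coef_tendsto:
  fixes Tm :: "nat \<Rightarrow> 'i \<Rightarrow> nat \<Rightarrow> real"
  assumes "\<forall>i\<in>I. \<forall>l<\<rho>. (\<lambda>m. Tm m i l) \<longlonglongrightarrow> T i l"
    and "\<forall>l\<in>{..<\<rho>}. \<forall>l'\<in>{..<\<rho>}. (\<lambda>m. Dm m l l') \<longlonglongrightarrow> D l l'"
    and "\<And>j. j \<in> I \<Longrightarrow> (\<lambda>m. \<beta>\<^sub>m m j) \<longlonglongrightarrow> \<beta> j" and "i \<in> I"
  shows "(\<lambda>m. galerkin_coef I \<rho> (Tm m) (Dm m) (\<beta>\<^sub>m m) i) \<longlonglongrightarrow> galerkin_coef I \<rho> T D \<beta> i"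
  unfolding galerkin_coef_def using assms by (intro tendsto_sum tendsto_mult) auto

lemma galerkin_coef_cong:
  "(\<And>j. j \<in> I \<Longrightarrow> \<beta> j = \<beta>' j) \<Longrightarrow> galerkin_coef I \<rho> T D \<beta> = galerkin_coef I \<rho> T D \<beta>'"
  unfolding galerkin_coef_def by (intro ext) simp

lemma convergent_subspace_inverses:
  assumes pd: "positive_definite_on I g"
    and on: "\<And>l l'. l < \<rho> \<Longrightarrow> l' < \<rho> \<Longrightarrow> (\<Sum>i\<in>I. T i l * T i l') = (if l = l' then 1 else 0)"
    and T: "\<forall>i\<in>I. \<forall>l<\<rho>. (\<lambda>m. Tm m i l) \<longlonglongrightarrow> T i l"
    and g: "\<forall>i\<in>I. \<forall>j\<in>I. (\<lambda>m. gm m i j) \<longlonglongrightarrow> g i j"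
  shows "\<exists>Dm D. inverse_on {..<\<rho>} (subspace_gramian I g T) D \<and>
    (\<forall>\<^sub>F m in sequentially. inverse_on {..<\<rho>} (subspace_gramian I (gm m) (Tm m)) (Dm m)) \<and>
    (\<forall>l\<in>{..<\<rho>}. \<forall>l'\<in>{..<\<rho>}. (\<lambda>m. Dm m l l') \<longlonglongrightarrow> D l l')"
proof (rule convergent_inverses[OF finite_lessThan _ subspace_gramian_nondegenerate[OF pd on]])
  show "\<forall>l\<in>{..<\<rho>}. \<forall>l'\<in>{..<\<rho>}. (\<lambda>m. subspace_gramian I (gm m) (Tm m) l l') \<longlonglongrightarrow> subspace_gramian I g T l l'"
    unfolding subspace_gramian_def using T g by (intro ballI tendsto_sum tendsto_mult) auto
qed

text \<open>The compressed operator in coordinates. The same formula serves the empirical operator and its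
  limit, so the convergence of the one to the other is a matter of continuity.\<close>

definition koopman_coef where
  "koopman_coef I J \<rho> T D X T' D' G' a =
     galerkin_coef I \<rho> T D (\<lambda>i. \<Sum>j\<in>J. X i j * galerkin_coef J \<rho> T' D' (\<lambda>j. \<Sum>l\<in>J. G' j l * a l) j)"

lemma emp_koopman_proj_combine:
  assumes k: "k \<in> {1..p}"
    and T: "coef_tuple (tensor_gramian (emp_inner m xs) \<psi>) n r k T"
    and T': "coef_tuple (tensor_gramian (emp_inner m ys) \<phi>) n' r k T'"
    and E: "inverse_on (multi_indices n k) (tensor_gramian (emp_inner m xs) \<psi> k) E"
    and D: "inverse_on {..<ext_rank r k} (subspace_gramian (multi_indices n k) (tensor_gramian (emp_inner m xs) \<psi> k) T) D"
    and D': "inverse_on {..<ext_rank r k} (subspace_gramian (multi_indices n' k) (tensor_gramian (emp_inner m ys) \<phi> k) T') D'"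
  shows "emp_koopman_proj m xs ys (tensor_space n \<psi> k)
      (spectral_subspace (emp_inner m xs) n \<psi> r k) (spectral_subspace (emp_inner m ys) n' \<phi> r k) (combine n' \<phi> k a) =
    combine n \<psi> k (koopman_coef (multi_indices n k) (multi_indices n' k) (ext_rank r k) T D
      (cross_gramian m xs ys \<psi> \<phi> k) T' D' (tensor_gramian (emp_inner m ys) \<phi> k) a)"
proof -
  have kp: "k \<le> p" using k by simp
  let ?b = "galerkin_coef (multi_indices n' k) (ext_rank r k) T' D'
    (\<lambda>j. \<Sum>l\<in>multi_indices n' k. tensor_gramian (emp_inner m ys) \<phi> k j l * a l)"
  have F: "spectral_subspace (emp_inner m xs) n \<psi> r k = fun_span {..<ext_rank r k} (\<lambda>l. combine n \<psi> k (\<lambda>i. T i l))"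
    by (rule spectral_subspace_eq[OF emp_inner_represents symmetric_form_emp kp T])
  have F': "spectral_subspace (emp_inner m ys) n' \<phi> r k = fun_span {..<ext_rank r k} (\<lambda>l. combine n' \<phi> k (\<lambda>i. T' i l))"
    by (rule spectral_subspace_eq[OF emp_inner_represents symmetric_form_emp kp T'])
  have 1: "ortho_proj (emp_inner m ys) (spectral_subspace (emp_inner m ys) n' \<phi> r k) (combine n' \<phi> k a) = combine n' \<phi> k ?b"
    unfolding F' by (rule ortho_proj_combine[OF D' represents_diff[OF emp_inner_represents k]])
  obtain c where c: "emp_koopman m xs ys (tensor_space n \<psi> k) (combine n' \<phi> k ?b) = combine n \<psi> k c"
    and Gc: "\<forall>i\<in>multi_indices n k. (\<Sum>j\<in>multi_indices n k. tensor_gramian (emp_inner m xs) \<psi> k i j * c j) =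
      (\<Sum>j\<in>multi_indices n' k. cross_gramian m xs ys \<psi> \<phi> k i j * ?b j)"
    using emp_koopman_combine[OF E] by blast
  have "ortho_proj (emp_inner m xs) (spectral_subspace (emp_inner m xs) n \<psi> r k) (combine n \<psi> k c) =
      combine n \<psi> k (galerkin_coef (multi_indices n k) (ext_rank r k) T D
        (\<lambda>i. \<Sum>j\<in>multi_indices n k. tensor_gramian (emp_inner m xs) \<psi> k i j * c j))"
    unfolding F by (rule ortho_proj_combine[OF D represents_diff[OF emp_inner_represents k]])
  also have "galerkin_coef (multi_indices n k) (ext_rank r k) T D
        (\<lambda>i. \<Sum>j\<in>multi_indices n k. tensor_gramian (emp_inner m xs) \<psi> k i j * c j) =
      galerkin_coef (multi_indices n k) (ext_rank r k) T D
        (\<lambda>i. \<Sum>j\<in>multi_indices n' k. cross_gramian m xs ys \<psi> \<phi> k i j * ?b j)"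
    using Gc by (intro galerkin_coef_cong) blast
  finally show ?thesis unfolding emp_koopman_proj_def 1 c koopman_coef_def .
qed

lemma koopman_proj_combine:
  assumes k: "k \<in> {1..p}"
    and rep: "represents (L2_inner \<rho>\<^sub>0) n \<psi> p G" "symmetric_form G"
    and rep': "represents (L2_inner \<rho>\<^sub>1) n' \<phi> p G'" "symmetric_form G'"
    and T: "coef_tuple G n r k T" and T': "coef_tuple G' n' r k T'"
    and D: "inverse_on {..<ext_rank r k} (subspace_gramian (multi_indices n k) (G k) T) D"
    and D': "inverse_on {..<ext_rank r k} (subspace_gramian (multi_indices n' k) (G' k) T') D'"
    and K: "\<And>u a c. L2_inner \<rho>\<^sub>0 (combine n \<psi> k u) (\<lambda>x. koopman \<kappa> (combine n' \<phi> k a) x - combine n \<psi> k c x) =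
      (\<Sum>i\<in>multi_indices n k. u i * ((\<Sum>j\<in>multi_indices n' k. X i j * a j) - (\<Sum>j\<in>multi_indices n k. G k i j * c j)))"
  shows "koopman_proj \<kappa> \<rho>\<^sub>0 \<rho>\<^sub>1 (spectral_subspace (L2_inner \<rho>\<^sub>0) n \<psi> r k)
      (spectral_subspace (L2_inner \<rho>\<^sub>1) n' \<phi> r k) (combine n' \<phi> k a) =
    combine n \<psi> k (koopman_coef (multi_indices n k) (multi_indices n' k) (ext_rank r k) T D X T' D' (G' k) a)"
proof -
  have kp: "k \<le> p" using k by simp
  let ?b = "galerkin_coef (multi_indices n' k) (ext_rank r k) T' D' (\<lambda>j. \<Sum>l\<in>multi_indices n' k. G' k j l * a l)"
  have F: "spectral_subspace (L2_inner \<rho>\<^sub>0) n \<psi> r k = fun_span {..<ext_rank r k} (\<lambda>l. combine n \<psi> k (\<lambda>i. T i l))"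
    by (rule spectral_subspace_eq[OF rep kp T])
  have F': "spectral_subspace (L2_inner \<rho>\<^sub>1) n' \<phi> r k = fun_span {..<ext_rank r k} (\<lambda>l. combine n' \<phi> k (\<lambda>i. T' i l))"
    by (rule spectral_subspace_eq[OF rep' kp T'])
  have 1: "ortho_proj (L2_inner \<rho>\<^sub>1) (spectral_subspace (L2_inner \<rho>\<^sub>1) n' \<phi> r k) (combine n' \<phi> k a) = combine n' \<phi> k ?b"
    unfolding F' by (rule ortho_proj_combine[OF D' represents_diff[OF rep'(1) k]])
  show ?thesis
    unfolding koopman_proj_def 1 koopman_coef_def unfolding F by (rule ortho_proj_combine[OF D K])
qed

lemma ennreal_tendsto_0_by_contradiction:
  fixes a :: "nat \<Rightarrow> ennreal"
  assumes "\<And>\<epsilon> s. 0 < \<epsilon> \<Longrightarrow> strict_mono (s :: nat \<Rightarrow> nat) \<Longrightarrow> (\<And>m. ennreal \<epsilon> < a (s m)) \<Longrightarrow> False"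
  shows "a \<longlonglongrightarrow> 0"
proof (rule order_tendstoI)
  fix e :: ennreal assume e: "0 < e"
  then obtain \<epsilon> where \<epsilon>: "0 < \<epsilon>" "ennreal \<epsilon> < e"
  proof (cases e)
    case (real t)
    then have "0 < t / 2" "ennreal (t / 2) < e" using e by (auto simp: ennreal_less_iff)
    then show thesis by (rule that)
  next
    case top
    then show thesis by (intro that[of 1]) auto
  qed
  have "\<forall>\<^sub>F m in sequentially. a m \<le> ennreal \<epsilon>"
  proof (rule ccontr)
    assume "\<not> ?thesis"
    from not_eventually_sequentiallyD[OF this] obtain s where "strict_mono (s :: nat \<Rightarrow> nat)"
      "\<And>m. \<not> a (s m) \<le> ennreal \<epsilon>" by blast
    then show False using assms[OF \<epsilon>(1)] by (auto simp: not_le)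
  qed
  then show "\<forall>\<^sub>F m in sequentially. a m < e"
    by (rule eventually_mono) (rule le_less_trans[OF _ \<epsilon>(2)])
qed simp

text \<open>Otherwise there are \<open>\<epsilon> > 0\<close> and, along a subsequence, functions in the unit ball on which the operators
  differ by more than \<open>\<epsilon>\<close>. Along a further subsequence their coefficients and the coefficients of
  the empirical tuples converge, the latter to tuples of the limit inner products. Then both operators
  give asymptotically the same coefficients by \<open>koopman_coef\<close>, a contradiction. Choosing a
  subsequence is harmless: the limit operator is the same for all limit tuples.\<close>

theorem koopman_proj_op_norm_tendsto_0:
  fixes \<psi> \<phi> :: "nat \<Rightarrow> nat \<Rightarrow> 'a::euclidean_space \<Rightarrow> real"
  assumes k: "k \<in> {1..p}"
    and rep: "represents (L2_inner \<rho>\<^sub>0) n \<psi> p G" "symmetric_form G"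
    and rep': "represents (L2_inner \<rho>\<^sub>1) n' \<phi> p G'" "symmetric_form G'"
    and conv: "forms_converge n p (\<lambda>m. tensor_gramian (emp_inner m xs) \<psi>) G"
    and conv': "forms_converge n' p (\<lambda>m. tensor_gramian (emp_inner m ys) \<phi>) G'"
    and convX: "\<And>i j. i \<in> multi_indices n k \<Longrightarrow> j \<in> multi_indices n' k \<Longrightarrow>
      (\<lambda>m. cross_gramian m xs ys \<psi> \<phi> k i j) \<longlonglongrightarrow> X i j"
    and pd: "positive_definite_on (multi_indices n k) (G k)"
    and pd': "positive_definite_on (multi_indices n' k) (G' k)"
    and ex: "coef_tuple G n r k T0" and ex': "coef_tuple G' n' r k T0'"
    and K: "\<And>u a c. L2_inner \<rho>\<^sub>0 (combine n \<psi> k u) (\<lambda>x. koopman \<kappa> (combine n' \<phi> k a) x - combine n \<psi> k c x) =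
      (\<Sum>i\<in>multi_indices n k. u i * ((\<Sum>j\<in>multi_indices n' k. X i j * a j) - (\<Sum>j\<in>multi_indices n k. G k i j * c j)))"
  shows "(\<lambda>m. op_norm \<rho>\<^sub>1 \<rho>\<^sub>0 (tensor_space n' \<phi> k)
      (\<lambda>f u. emp_koopman_proj m xs ys (tensor_space n \<psi> k)
          (spectral_subspace (emp_inner m xs) n \<psi> r k) (spectral_subspace (emp_inner m ys) n' \<phi> r k) f u
        - koopman_proj \<kappa> \<rho>\<^sub>0 \<rho>\<^sub>1 (spectral_subspace (L2_inner \<rho>\<^sub>0) n \<psi> r k)
          (spectral_subspace (L2_inner \<rho>\<^sub>1) n' \<phi> r k) f u)) \<longlonglongrightarrow> 0"
    (is "(\<lambda>m. op_norm \<rho>\<^sub>1 \<rho>\<^sub>0 ?W (\<lambda>f u. ?emp m f u - ?lim f u)) \<longlonglongrightarrow> 0")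
proof (rule ennreal_tendsto_0_by_contradiction)
  fix \<epsilon> :: real and s0 :: "nat \<Rightarrow> nat"
  assume \<epsilon>: "0 < \<epsilon>" and s0: "strict_mono s0"
    and big: "\<And>m. ennreal \<epsilon> < op_norm \<rho>\<^sub>1 \<rho>\<^sub>0 ?W (\<lambda>f u. ?emp (s0 m) f u - ?lim f u)"
  have kp: "k \<le> p" using k by simp
  let ?I = "multi_indices n k" and ?J = "multi_indices n' k" and ?\<rho> = "ext_rank r k"
  let ?Gm = "\<lambda>m. tensor_gramian (emp_inner m xs) \<psi>" and ?Gm' = "\<lambda>m. tensor_gramian (emp_inner m ys) \<phi>"
  have "\<exists>f. f \<in> ?W \<and> L2_norm \<rho>\<^sub>1 f \<le> 1 \<and> \<epsilon> < L2_norm \<rho>\<^sub>0 (\<lambda>u. ?emp (s0 m) f u - ?lim f u)" for m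
    using big[of m] \<epsilon> unfolding op_norm_def less_SUP_iff by (auto simp: ennreal_less_iff)
  then have "\<exists>a. L2_norm \<rho>\<^sub>1 (combine n' \<phi> k a) \<le> 1 \<and>
      \<epsilon> < L2_norm \<rho>\<^sub>0 (\<lambda>u. ?emp (s0 m) (combine n' \<phi> k a) u - ?lim (combine n' \<phi> k a) u)" for m
    unfolding tensor_space_eq[of n' \<phi>] by blast
  then obtain a where a1: "\<And>m. L2_norm \<rho>\<^sub>1 (combine n' \<phi> k (a m)) \<le> 1"
    and a2: "\<And>m. \<epsilon> < L2_norm \<rho>\<^sub>0 (\<lambda>u. ?emp (s0 m) (combine n' \<phi> k (a m)) u - ?lim (combine n' \<phi> k (a m)) u)"
    by metis
  have norm0: "L2_norm \<rho>\<^sub>0 (combine n \<psi> k c) = sqrt (\<Sum>i\<in>?I. \<Sum>j\<in>?I. c i * c j * G k i j)" for c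
    using rep(1) k unfolding L2_norm_def represents_def by simp
  have norm1: "L2_norm \<rho>\<^sub>1 (combine n' \<phi> k c) = sqrt (\<Sum>i\<in>?J. \<Sum>j\<in>?J. c i * c j * G' k i j)" for c
    using rep'(1) k unfolding L2_norm_def represents_def by simp
  obtain B where B: "\<And>m i. i \<in> ?J \<Longrightarrow> \<bar>a m i\<bar> \<le> B"
    using positive_definite_on_coef_bound[OF finite_multi_indices pd'] rep'(2) a1
    unfolding norm1 symmetric_form_def real_sqrt_le_1_iff by blast
  have "\<forall>\<^sub>F m in sequentially. (\<exists>T. coef_tuple (?Gm m) n r k T) \<and> (\<exists>T. coef_tuple (?Gm' m) n' r k T)"
    using coef_tuple_eventually_exists[OF rep(2) symmetric_form_emp conv kp ex]
      coef_tuple_eventually_exists[OF rep'(2) symmetric_form_emp conv' kp ex'] by (rule eventually_conj)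
  then obtain M where M: "\<And>m. M \<le> m \<Longrightarrow> (\<exists>T. coef_tuple (?Gm m) n r k T) \<and> (\<exists>T. coef_tuple (?Gm' m) n' r k T)"
    unfolding eventually_sequentially by blast
  \<comment> \<open>Shifting the index makes the empirical tuples exist for all \<open>m\<close>.\<close>
  define s1 where "s1 m = s0 (m + M)" for m
  have s1: "strict_mono s1" using s0 by (auto simp: s1_def strict_mono_def)
  have "M \<le> s1 m" for m using seq_suble[OF s0, of "m + M"] by (simp add: s1_def)
  then have "\<forall>m. \<exists>T. coef_tuple (?Gm (s1 m)) n r k T" "\<forall>m. \<exists>T. coef_tuple (?Gm' (s1 m)) n' r k T"
    using M by blast+
  then obtain T1 T1' where T1: "\<And>m. coef_tuple (?Gm (s1 m)) n r k (T1 m)"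
    and T1': "\<And>m. coef_tuple (?Gm' (s1 m)) n' r k (T1' m)" by metis
  obtain s2 T where s2: "strict_mono (s2 :: nat \<Rightarrow> nat)" and T: "coef_tuple G n r k T"
    and Tl: "\<forall>i\<in>?I. \<forall>l<?\<rho>. (\<lambda>m. T1 (s2 m) i l) \<longlonglongrightarrow> T i l"
    using coef_tuple_convergent_subsequence[OF rep(2) symmetric_form_emp forms_converge_subseq[OF conv s1] kp ex T1]
    by blast
  have s12: "strict_mono (s1 \<circ> s2)" using s1 s2 by (rule strict_mono_o)
  have conv'2: "forms_converge n' p (\<lambda>m. ?Gm' (s1 (s2 m))) G'"
    using forms_converge_subseq[OF conv' s12] by (simp add: o_def)
  obtain s3 T' where s3: "strict_mono (s3 :: nat \<Rightarrow> nat)" and T': "coef_tuple G' n' r k T'"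
    and Tl': "\<forall>i\<in>?J. \<forall>l<?\<rho>. (\<lambda>m. T1' (s2 (s3 m)) i l) \<longlonglongrightarrow> T' i l"
    using coef_tuple_convergent_subsequence[OF rep'(2) symmetric_form_emp conv'2 kp ex' T1'] by blast
  obtain s4 b where s4: "strict_mono (s4 :: nat \<Rightarrow> nat)"
    and bl: "\<And>i. i \<in> ?J \<Longrightarrow> (\<lambda>m. a (s2 (s3 (s4 m)) + M) i) \<longlonglongrightarrow> b i"
  proof -
    have "\<exists>s l. strict_mono (s :: nat \<Rightarrow> nat) \<and> (\<forall>i\<in>?J. (\<lambda>m. a (s2 (s3 (s m)) + M) i) \<longlonglongrightarrow> l i)"
      by (rule bounded_family_convergent_subsequence[of ?J "\<lambda>m i. a (s2 (s3 m) + M) i"]) (use B in auto)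
    then show thesis using that by blast
  qed
  define s where "s m = s2 (s3 (s4 m))" for m
  have s: "strict_mono s" using s2 s3 s4 by (auto simp: s_def strict_mono_def)
  define \<sigma> where "\<sigma> m = s1 (s m)" for m
  have \<sigma>: "strict_mono \<sigma>" using s1 s by (auto simp: \<sigma>_def strict_mono_def)
  define T2 T2' where "T2 m = T1 (s m)" and "T2' m = T1' (s m)" for m
  have T2: "coef_tuple (?Gm (\<sigma> m)) n r k (T2 m)" and T2': "coef_tuple (?Gm' (\<sigma> m)) n' r k (T2' m)" for m
    unfolding \<sigma>_def T2_def T2'_def by (rule T1 T1')+
  have s34: "strict_mono (s3 \<circ> s4)" using s3 s4 by (rule strict_mono_o)
  have T2l: "\<forall>i\<in>?I. \<forall>l<?\<rho>. (\<lambda>m. T2 m i l) \<longlonglongrightarrow> T i l"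
    using Tl LIMSEQ_subseq_LIMSEQ[OF _ s34] unfolding T2_def s_def o_def by blast
  have T2l': "\<forall>i\<in>?J. \<forall>l<?\<rho>. (\<lambda>m. T2' m i l) \<longlonglongrightarrow> T' i l"
    using Tl' LIMSEQ_subseq_LIMSEQ[OF _ s4] unfolding T2'_def s_def o_def by blast
  have Gl: "\<forall>i\<in>?I. \<forall>j\<in>?I. (\<lambda>m. ?Gm (\<sigma> m) k i j) \<longlonglongrightarrow> G k i j"
    using forms_converge_subseq[OF conv \<sigma>] k unfolding forms_converge_def by blast
  have Gl': "\<forall>i\<in>?J. \<forall>j\<in>?J. (\<lambda>m. ?Gm' (\<sigma> m) k i j) \<longlonglongrightarrow> G' k i j"
    using forms_converge_subseq[OF conv' \<sigma>] k unfolding forms_converge_def by blast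
  have Xl: "(\<lambda>m. cross_gramian (\<sigma> m) xs ys \<psi> \<phi> k i j) \<longlonglongrightarrow> X i j" if "i \<in> ?I" "j \<in> ?J" for i j
    using LIMSEQ_subseq_LIMSEQ[OF convX[OF that] \<sigma>] by (simp add: o_def)
  \<comment> \<open>The empirical Gram matrices become invertible, so the empirical Koopman operator is well-defined.\<close>
  obtain Em where E: "\<forall>\<^sub>F m in sequentially. inverse_on ?I (?Gm (\<sigma> m) k) (Em m)"
    using convergent_inverses[OF finite_multi_indices Gl positive_definite_on_nondegenerate[OF pd]] by blast
  obtain Dm D where D: "inverse_on {..<?\<rho>} (subspace_gramian ?I (G k) T) D"
    and Dm: "\<forall>\<^sub>F m in sequentially. inverse_on {..<?\<rho>} (subspace_gramian ?I (?Gm (\<sigma> m) k) (T2 m)) (Dm m)"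
    and Dl: "\<forall>l\<in>{..<?\<rho>}. \<forall>l'\<in>{..<?\<rho>}. (\<lambda>m. Dm m l l') \<longlonglongrightarrow> D l l'"
    using convergent_subspace_inverses[OF pd coef_tuple_orthonormal[OF T] T2l Gl] by blast
  obtain Dm' D' where D': "inverse_on {..<?\<rho>} (subspace_gramian ?J (G' k) T') D'"
    and Dm': "\<forall>\<^sub>F m in sequentially. inverse_on {..<?\<rho>} (subspace_gramian ?J (?Gm' (\<sigma> m) k) (T2' m)) (Dm' m)"
    and Dl': "\<forall>l\<in>{..<?\<rho>}. \<forall>l'\<in>{..<?\<rho>}. (\<lambda>m. Dm' m l l') \<longlonglongrightarrow> D' l l'"
    using convergent_subspace_inverses[OF pd' coef_tuple_orthonormal[OF T'] T2l' Gl'] by blast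
  define f where "f m = a (s m + M)" for m
  have fl: "\<And>i. i \<in> ?J \<Longrightarrow> (\<lambda>m. f m i) \<longlonglongrightarrow> b i" using bl by (simp add: f_def s_def)
  define ce where "ce m = koopman_coef ?I ?J ?\<rho> (T2 m) (Dm m) (cross_gramian (\<sigma> m) xs ys \<psi> \<phi> k) (T2' m) (Dm' m) (?Gm' (\<sigma> m) k) (f m)" for m
  define cl where "cl m = koopman_coef ?I ?J ?\<rho> T D X T' D' (G' k) (f m)" for m
  have cel: "(\<lambda>m. ce m i) \<longlonglongrightarrow> koopman_coef ?I ?J ?\<rho> T D X T' D' (G' k) b i" if "i \<in> ?I" for i
    unfolding ce_def koopman_coef_def
    using Gl' by (intro galerkin_coef_tendsto[OF T2l Dl _ that] tendsto_sum tendsto_mult Xl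
        galerkin_coef_tendsto[OF T2l' Dl'] fl) auto
  have cll: "(\<lambda>m. cl m i) \<longlonglongrightarrow> koopman_coef ?I ?J ?\<rho> T D X T' D' (G' k) b i" if "i \<in> ?I" for i
    unfolding cl_def koopman_coef_def galerkin_coef_def
    by (intro tendsto_sum tendsto_mult tendsto_const fl)
  have "(\<lambda>m. sqrt (\<Sum>i\<in>?I. \<Sum>j\<in>?I. (ce m i - cl m i) * (ce m j - cl m j) * G k i j))
      \<longlonglongrightarrow> sqrt (\<Sum>i\<in>?I. \<Sum>j\<in>?I. 0 * 0 * G k i j)"
  proof (intro tendsto_real_sqrt tendsto_sum tendsto_mult tendsto_const)
    have *: "(\<lambda>m. ce m i - cl m i) \<longlonglongrightarrow> 0" if "i \<in> ?I" for i
      using tendsto_diff[OF cel[OF that] cll[OF that]] by simp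
    show "(\<lambda>m. ce m i - cl m i) \<longlonglongrightarrow> 0" "(\<lambda>m. ce m j - cl m j) \<longlonglongrightarrow> 0" if "i \<in> ?I" "j \<in> ?I" for i j
      using * that by auto
  qed
  then have "\<forall>\<^sub>F m in sequentially. sqrt (\<Sum>i\<in>?I. \<Sum>j\<in>?I. (ce m i - cl m i) * (ce m j - cl m j) * G k i j) < \<epsilon>"
    using \<epsilon> by (intro order_tendstoD(2)) auto
  then have "\<forall>\<^sub>F m in sequentially. False"
    using E Dm Dm'
  proof eventually_elim
    case (elim m)
    have "?emp (\<sigma> m) (combine n' \<phi> k (f m)) = combine n \<psi> k (ce m)"
      unfolding ce_def by (rule emp_koopman_proj_combine[OF k T2 T2' elim(2,3,4)])
    moreover have "?lim (combine n' \<phi> k (f m)) = combine n \<psi> k (cl m)"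
      unfolding cl_def by (rule koopman_proj_combine[OF k rep rep' T T' D D' K])
    ultimately have "\<epsilon> < L2_norm \<rho>\<^sub>0 (combine n \<psi> k (\<lambda>i. ce m i - cl m i))"
      using a2[of "s m + M"] by (simp add: f_def[symmetric] \<sigma>_def[symmetric] s1_def[symmetric] combine_diff)
    then show False using elim(1) unfolding norm0 by simp
  qed
  then show False by simp
qed

section \<open>Joint law and Koopman operator\<close>

lemma measurable_return_pair:
  fixes \<kappa> :: "'a::euclidean_space \<Rightarrow> 'a measure"
  assumes "\<kappa> \<in> borel \<rightarrow>\<^sub>M prob_algebra borel" and \<mu>: "sets \<mu> = sets borel"
  shows "(\<lambda>x. \<kappa> x \<bind> (\<lambda>y. return (borel \<Otimes>\<^sub>M borel) (x, y))) \<in> \<mu> \<rightarrow>\<^sub>M subprob_algebra (borel \<Otimes>\<^sub>M borel)"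
proof -
  have \<kappa>: "\<kappa> \<in> \<mu> \<rightarrow>\<^sub>M subprob_algebra borel"
    using measurable_prob_algebraD[OF assms(1)] measurable_cong_sets[OF \<mu> refl] by blast
  have "(\<lambda>z. return (borel \<Otimes>\<^sub>M borel) (fst z, snd z)) \<in> \<mu> \<Otimes>\<^sub>M borel \<rightarrow>\<^sub>M subprob_algebra (borel \<Otimes>\<^sub>M (borel :: 'a measure))"
    using \<mu> by (intro measurable_compose[OF _ return_measurable]) (simp add: measurable_cong_sets[OF sets_pair_measure_cong[OF \<mu> refl] refl])
  then show ?thesis by (rule measurable_bind[OF \<kappa>])
qed

lemma nn_integral_joint_law:
  fixes \<kappa> :: "'a::euclidean_space \<Rightarrow> 'a measure"
  assumes \<kappa>: "\<kappa> \<in> borel \<rightarrow>\<^sub>M prob_algebra borel" and \<mu>: "sets \<mu> = sets borel"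
    and F: "F \<in> borel_measurable (borel \<Otimes>\<^sub>M borel)"
  shows "(\<integral>\<^sup>+z. F z \<partial>joint_law \<mu> \<kappa>) = (\<integral>\<^sup>+x. \<integral>\<^sup>+y. F (x, y) \<partial>\<kappa> x \<partial>\<mu>)"
proof -
  have "(\<integral>\<^sup>+z. F z \<partial>(\<kappa> x \<bind> (\<lambda>y. return (borel \<Otimes>\<^sub>M borel) (x, y)))) = (\<integral>\<^sup>+y. F (x, y) \<partial>\<kappa> x)" for x
  proof -
    have s: "sets (\<kappa> x) = sets borel"
      using sets_kernel[OF measurable_prob_algebraD[OF \<kappa>]] by simp
    have "(\<integral>\<^sup>+z. F z \<partial>(\<kappa> x \<bind> (\<lambda>y. return (borel \<Otimes>\<^sub>M borel) (x, y)))) =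
        (\<integral>\<^sup>+y. \<integral>\<^sup>+z. F z \<partial>return (borel \<Otimes>\<^sub>M borel) (x, y) \<partial>\<kappa> x)"
      by (rule nn_integral_bind[OF F], rule measurable_compose[OF _ return_measurable])
         (simp add: measurable_cong_sets[OF s refl])
    also have "\<dots> = (\<integral>\<^sup>+y. F (x, y) \<partial>\<kappa> x)"
      using F by (intro nn_integral_cong nn_integral_return) (auto simp: space_pair_measure)
    finally show ?thesis .
  qed
  then show ?thesis
    unfolding joint_law_def using nn_integral_bind[OF F measurable_return_pair[OF \<kappa> \<mu>]] by simp
qed

text \<open>Fubini's theorem for the kernel, obtained from the case of nonnegative functions by splitting into
  positive and negative part. The inner integral may fail to exist on a null set.\<close>

lemma integral_joint_law:
  fixes \<kappa> :: "'a::euclidean_space \<Rightarrow> 'a measure" and F :: "'a \<times> 'a \<Rightarrow> real"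
  assumes \<kappa>: "\<kappa> \<in> borel \<rightarrow>\<^sub>M prob_algebra borel" and \<mu>: "sets \<mu> = sets borel"
    and F: "F \<in> borel_measurable (borel \<Otimes>\<^sub>M borel)" and int: "integrable (joint_law \<mu> \<kappa>) F"
  shows "integrable \<mu> (\<lambda>x. \<integral>y. F (x, y) \<partial>\<kappa> x)"
    and "(\<integral>x. \<integral>y. F (x, y) \<partial>\<kappa> x \<partial>\<mu>) = (\<integral>z. F z \<partial>joint_law \<mu> \<kappa>)"
proof -
  have \<kappa>s: "\<kappa> \<in> borel \<rightarrow>\<^sub>M subprob_algebra borel" by (rule measurable_prob_algebraD[OF \<kappa>])
  have s: "sets (\<kappa> x) = sets borel" for x using sets_kernel[OF \<kappa>s] by simp
  define P where "P x = (\<integral>\<^sup>+y. ennreal (F (x, y)) \<partial>\<kappa> x)" for x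
  define N where "N x = (\<integral>\<^sup>+y. ennreal (- F (x, y)) \<partial>\<kappa> x)" for x
  have Fx: "(\<lambda>y. F (x, y)) \<in> borel_measurable (\<kappa> x)" for x
    using F by (simp add: measurable_cong_sets[OF s refl])
  have Pm: "P \<in> borel_measurable \<mu>"
  proof -
    have "P \<in> borel_measurable borel"
      unfolding P_def by (rule nn_integral_measurable_subprob_algebra2[OF _ \<kappa>s]) (use F in simp)
    then show ?thesis by (simp add: measurable_cong_sets[OF \<mu> refl])
  qed
  have Nm: "N \<in> borel_measurable \<mu>"
  proof -
    have "N \<in> borel_measurable borel"
      unfolding N_def by (rule nn_integral_measurable_subprob_algebra2[OF _ \<kappa>s]) (use F in simp)
    then show ?thesis by (simp add: measurable_cong_sets[OF \<mu> refl])
  qed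
  have Pi: "(\<integral>\<^sup>+x. P x \<partial>\<mu>) = (\<integral>\<^sup>+z. ennreal (F z) \<partial>joint_law \<mu> \<kappa>)"
    unfolding P_def using F by (subst nn_integral_joint_law[OF \<kappa> \<mu>]) auto
  have Ni: "(\<integral>\<^sup>+x. N x \<partial>\<mu>) = (\<integral>\<^sup>+z. ennreal (- F z) \<partial>joint_law \<mu> \<kappa>)"
    unfolding N_def using F by (subst nn_integral_joint_law[OF \<kappa> \<mu>]) auto
  have fin: "(\<integral>\<^sup>+x. P x \<partial>\<mu>) \<noteq> \<infinity>" "(\<integral>\<^sup>+x. N x \<partial>\<mu>) \<noteq> \<infinity>"
    using int unfolding Pi Ni real_integrable_def by auto
  have PN: "AE x in \<mu>. P x \<noteq> \<infinity>" "AE x in \<mu>. N x \<noteq> \<infinity>"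
    by (rule nn_integral_PInf_AE[OF Pm fin(1)], rule nn_integral_PInf_AE[OF Nm fin(2)])
  have eq: "AE x in \<mu>. (\<integral>y. F (x, y) \<partial>\<kappa> x) = enn2real (P x) - enn2real (N x)"
    using PN
  proof eventually_elim
    case (elim x)
    then have "integrable (\<kappa> x) (\<lambda>y. F (x, y))"
      unfolding real_integrable_def using Fx by (simp add: P_def N_def)
    then show ?case by (simp add: real_lebesgue_integral_def P_def N_def)
  qed
  \<comment> \<open>\<open>enn2real\<close> sends \<open>\<infinity>\<close> to \<open>0\<close>, which is harmless because the value \<open>\<infinity>\<close> occurs on a null set only.\<close>
  have iu: "integrable \<mu> (\<lambda>x. enn2real (u x)) \<and> (\<integral>x. enn2real (u x) \<partial>\<mu>) = enn2real (\<integral>\<^sup>+x. u x \<partial>\<mu>)"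
    if um: "u \<in> borel_measurable \<mu>" and uf: "AE x in \<mu>. u x \<noteq> \<infinity>" and ui: "(\<integral>\<^sup>+x. u x \<partial>\<mu>) \<noteq> \<infinity>" for u
  proof -
    have "(\<integral>\<^sup>+x. ennreal (enn2real (u x)) \<partial>\<mu>) = (\<integral>\<^sup>+x. u x \<partial>\<mu>)"
      by (rule nn_integral_cong_AE) (use uf in \<open>eventually_elim, simp add: ennreal_enn2real less_top\<close>)
    moreover from this have "integrable \<mu> (\<lambda>x. enn2real (u x))"
      using um ui by (intro integrableI_nonneg) (auto simp: less_top)
    ultimately show ?thesis using um by (subst integral_eq_nn_integral) auto
  qed
  note iP = iu[OF Pm PN(1) fin(1)] and iN = iu[OF Nm PN(2) fin(2)]
  have mK: "(\<lambda>x. \<integral>y. F (x, y) \<partial>\<kappa> x) \<in> borel_measurable \<mu>"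
  proof -
    have "(\<integral>z. F z \<partial>(\<kappa> x \<bind> (\<lambda>y. return (borel \<Otimes>\<^sub>M borel) (x, y)))) = (\<integral>y. F (x, y) \<partial>\<kappa> x)" for x
    proof -
      have m: "(\<lambda>y. (x, y)) \<in> \<kappa> x \<rightarrow>\<^sub>M borel \<Otimes>\<^sub>M borel" by (simp add: measurable_cong_sets[OF s refl])
      have "space (\<kappa> x) \<noteq> {}" using sets_eq_imp_space_eq[OF s[of x]] by simp
      from bind_return_distr'[OF this m] integral_distr[OF m F] show ?thesis by simp
    qed
    then show ?thesis
      using measurable_compose[OF measurable_return_pair[OF \<kappa> \<mu>] integral_measurable_subprob_algebra[OF F]] by simp
  qed
  have mPN: "(\<lambda>x. enn2real (P x) - enn2real (N x)) \<in> borel_measurable \<mu>" using Pm Nm by simp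
  show "integrable \<mu> (\<lambda>x. \<integral>y. F (x, y) \<partial>\<kappa> x)"
    using integrable_cong_AE[OF mK mPN eq] iP iN by simp
  have "(\<integral>x. \<integral>y. F (x, y) \<partial>\<kappa> x \<partial>\<mu>) = (\<integral>x. enn2real (P x) - enn2real (N x) \<partial>\<mu>)"
    by (rule integral_cong_AE[OF mK mPN eq])
  also have "\<dots> = enn2real (\<integral>\<^sup>+x. P x \<partial>\<mu>) - enn2real (\<integral>\<^sup>+x. N x \<partial>\<mu>)"
    using iP iN by simp
  also have "\<dots> = (\<integral>z. F z \<partial>joint_law \<mu> \<kappa>)"
    unfolding Pi Ni real_lebesgue_integral_def[OF int] ..
  finally show "(\<integral>x. \<integral>y. F (x, y) \<partial>\<kappa> x \<partial>\<mu>) = (\<integral>z. F z \<partial>joint_law \<mu> \<kappa>)" .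
qed

text \<open>The joint law has the marginals \<open>\<rho>\<^sub>0\<close> and \<open>\<rho>\<^sub>1\<close>; this links the samples, which follow the joint law, to
  the two weighted spaces.\<close>

lemma dynamical_system_marginals:
  assumes "dynamical_system P X \<tau> \<kappa> \<rho>\<^sub>0 \<rho>\<^sub>1" "\<tau> > 0"
  shows "\<kappa> \<in> borel \<rightarrow>\<^sub>M prob_algebra borel"
    and "sets (joint_law (density lborel \<rho>\<^sub>0) \<kappa>) = sets (borel \<Otimes>\<^sub>M borel)"
    and "density lborel \<rho>\<^sub>0 = distr (joint_law (density lborel \<rho>\<^sub>0) \<kappa>) borel fst"
    and "density lborel \<rho>\<^sub>1 = distr (joint_law (density lborel \<rho>\<^sub>0) \<kappa>) borel snd"
proof -
  let ?\<theta> = "joint_law (density lborel \<rho>\<^sub>0) \<kappa>"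
  have X: "\<And>t. 0 \<le> t \<Longrightarrow> X t \<in> borel_measurable P"
    and d0: "distr P lborel (X 0) = density lborel \<rho>\<^sub>0" and d1: "distr P lborel (X \<tau>) = density lborel \<rho>\<^sub>1"
    and \<theta>: "distr P (borel \<Otimes>\<^sub>M borel) (\<lambda>\<omega>. (X 0 \<omega>, X \<tau> \<omega>)) = ?\<theta>"
    using assms(1) unfolding dynamical_system_def distributed_def by auto
  have [measurable]: "X 0 \<in> borel_measurable P" "X \<tau> \<in> borel_measurable P" using X assms(2) by auto
  show "\<kappa> \<in> borel \<rightarrow>\<^sub>M prob_algebra borel" using assms(1) unfolding dynamical_system_def by blast
  show "sets ?\<theta> = sets (borel \<Otimes>\<^sub>M borel)" unfolding \<theta>[symmetric] by simp
  show "density lborel \<rho>\<^sub>0 = distr ?\<theta> borel fst"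
  proof -
    have "distr ?\<theta> borel fst = distr P borel (X 0)"
      unfolding \<theta>[symmetric] by (subst distr_distr) (auto simp: o_def)
    also have "\<dots> = distr P lborel (X 0)" by (rule distr_cong) auto
    finally show ?thesis unfolding d0 by simp
  qed
  show "density lborel \<rho>\<^sub>1 = distr ?\<theta> borel snd"
  proof -
    have "distr ?\<theta> borel snd = distr P borel (X \<tau>)"
      unfolding \<theta>[symmetric] by (subst distr_distr) (auto simp: o_def)
    also have "\<dots> = distr P lborel (X \<tau>)" by (rule distr_cong) auto
    finally show ?thesis unfolding d1 by simp
  qed
qed

lemma abs_mult_le_sum_squares: "\<bar>a * b\<bar> \<le> a\<^sup>2 + (b :: real)\<^sup>2"
proof -
  have "2 * (\<bar>a\<bar> * \<bar>b\<bar>) \<le> a\<^sup>2 + b\<^sup>2" using sum_squares_bound[of "\<bar>a\<bar>" "\<bar>b\<bar>"] by simp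
  moreover have "0 \<le> \<bar>a\<bar> * \<bar>b\<bar>" by simp
  ultimately show ?thesis unfolding abs_mult by linarith
qed

lemma L2_mult_integrable:
  assumes "f \<in> L2 \<rho>" "g \<in> L2 \<rho>"
  shows "integrable (density lborel \<rho>) (\<lambda>x. f x * g x)"
proof (rule Bochner_Integration.integrable_bound)
  show "integrable (density lborel \<rho>) (\<lambda>x. (f x)\<^sup>2 + (g x)\<^sup>2)"
    using assms by (intro Bochner_Integration.integrable_add) (auto simp: L2_def)
  show "(\<lambda>x. f x * g x) \<in> borel_measurable (density lborel \<rho>)"
    using assms by (auto simp: L2_def)
  show "AE x in density lborel \<rho>. norm (f x * g x) \<le> norm ((f x)\<^sup>2 + (g x)\<^sup>2)"
    by (simp add: abs_mult_le_sum_squares)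
qed

lemma combine_in_L2:
  assumes "tensor_space n \<psi> k \<subseteq> L2 \<rho>"
  shows "combine n \<psi> k a \<in> L2 \<rho>"
  using assms unfolding tensor_space_eq by blast

lemma tensor_basis_eq_combine:
  assumes "i \<in> multi_indices n k"
  shows "tensor_basis \<psi> k i = combine n \<psi> k (\<lambda>j. if j = i then 1 else 0)"
proof
  fix x
  have "combine n \<psi> k (\<lambda>j. if j = i then 1 else 0) x =
      (\<Sum>j\<in>multi_indices n k. if j = i then tensor_basis \<psi> k j x else 0)"
    unfolding combine_def by (intro sum.cong refl) auto
  then show "tensor_basis \<psi> k i x = combine n \<psi> k (\<lambda>j. if j = i then 1 else 0) x"
    using assms by simp
qed

lemma tensor_basis_in_L2:
  assumes "tensor_space n \<psi> k \<subseteq> L2 \<rho>" "i \<in> multi_indices n k"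
  shows "tensor_basis \<psi> k i \<in> L2 \<rho>"
  unfolding tensor_basis_eq_combine[OF assms(2)] by (rule combine_in_L2[OF assms(1)])

lemma L2_inner_represents:
  assumes "\<And>k. k \<in> {1..p} \<Longrightarrow> tensor_space n \<psi> k \<subseteq> L2 \<rho>"
  shows "represents (L2_inner \<rho>) n \<psi> p (tensor_gramian (L2_inner \<rho>) \<psi>)"
  unfolding represents_def
proof (intro ballI allI)
  fix k a b assume k: "k \<in> {1..p}"
  let ?I = "multi_indices n k"
  have int: "integrable (density lborel \<rho>) (\<lambda>x. a i * b j * (tensor_basis \<psi> k i x * tensor_basis \<psi> k j x))"
    if "i \<in> ?I" "j \<in> ?I" for i j
    using that by (intro integrable_mult_right L2_mult_integrable tensor_basis_in_L2[OF assms[OF k]])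
  have "L2_inner \<rho> (combine n \<psi> k a) (combine n \<psi> k b) =
      (\<integral>x. (\<Sum>i\<in>?I. \<Sum>j\<in>?I. a i * b j * (tensor_basis \<psi> k i x * tensor_basis \<psi> k j x)) \<partial>density lborel \<rho>)"
    unfolding L2_inner_def combine_def sum_product by (simp add: mult_ac)
  also have "\<dots> = (\<Sum>i\<in>?I. \<Sum>j\<in>?I. \<integral>x. a i * b j * (tensor_basis \<psi> k i x * tensor_basis \<psi> k j x) \<partial>density lborel \<rho>)"
    using int by (simp add: Bochner_Integration.integral_sum Bochner_Integration.integrable_sum)
  finally show "L2_inner \<rho> (combine n \<psi> k a) (combine n \<psi> k b) =
      (\<Sum>i\<in>?I. \<Sum>j\<in>?I. a i * b j * tensor_gramian (L2_inner \<rho>) \<psi> k i j)"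
    by (simp add: tensor_gramian_def L2_inner_def)
qed

lemma symmetric_form_L2: "symmetric_form (tensor_gramian (L2_inner \<rho>) \<psi>)"
  by (simp add: symmetric_form_def tensor_gramian_def L2_inner_def mult.commute)

lemma L2_gramian_positive_definite:
  assumes sub: "\<And>k. k \<in> {1..p} \<Longrightarrow> tensor_space n \<psi> k \<subseteq> L2 \<rho>" and k: "k \<in> {1..p}"
    and indep: "L2_independent \<rho> (multi_indices n k) (tensor_basis \<psi> k)"
  shows "positive_definite_on (multi_indices n k) (tensor_gramian (L2_inner \<rho>) \<psi> k)"
  unfolding positive_definite_on_def
proof (intro allI conjI impI)
  fix c
  let ?f = "combine n \<psi> k c"
  have rep: "represents (L2_inner \<rho>) n \<psi> p (tensor_gramian (L2_inner \<rho>) \<psi>)"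
    by (rule L2_inner_represents, erule sub)
  have eq: "(\<Sum>i\<in>multi_indices n k. \<Sum>j\<in>multi_indices n k. c i * c j * tensor_gramian (L2_inner \<rho>) \<psi> k i j) =
      (\<integral>x. ?f x * ?f x \<partial>density lborel \<rho>)"
    using rep k unfolding represents_def L2_inner_def[of \<rho> ?f ?f, symmetric] by simp
  show "0 \<le> (\<Sum>i\<in>multi_indices n k. \<Sum>j\<in>multi_indices n k. c i * c j * tensor_gramian (L2_inner \<rho>) \<psi> k i j)"
    unfolding eq by (rule integral_nonneg_AE) simp
  assume "(\<Sum>i\<in>multi_indices n k. \<Sum>j\<in>multi_indices n k. c i * c j * tensor_gramian (L2_inner \<rho>) \<psi> k i j) = 0"
  then have "AE x in density lborel \<rho>. ?f x * ?f x = 0"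
    unfolding eq
    by (subst (asm) integral_nonneg_eq_0_iff_AE)
       (auto intro: L2_mult_integrable[OF combine_in_L2[OF sub[OF k]] combine_in_L2[OF sub[OF k]]])
  then have "AE x in density lborel \<rho>. (\<Sum>i\<in>multi_indices n k. c i * tensor_basis \<psi> k i x) = 0"
    by (simp add: combine_def)
  then show "\<forall>i\<in>multi_indices n k. c i = 0" using indep unfolding L2_independent_def by blast
qed

definition cross_integral where
  "cross_integral \<theta> \<psi> \<phi> k i j = (\<integral>z. tensor_basis \<psi> k i (fst z) * tensor_basis \<phi> k j (snd z) \<partial>\<theta>)"

lemma L2_marginal_integrable:
  fixes g :: "'a::euclidean_space \<Rightarrow> real" and \<theta> :: "('a \<times> 'a) measure"
  assumes s: "sets \<theta> = sets (borel \<Otimes>\<^sub>M borel)"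
    and d0: "density lborel \<rho>\<^sub>0 = distr \<theta> borel fst" and d1: "density lborel \<rho>\<^sub>1 = distr \<theta> borel snd"
    and f: "f \<in> L2 \<rho>\<^sub>0" and g: "g \<in> L2 \<rho>\<^sub>1"
  shows "integrable \<theta> (\<lambda>z. f (fst z) * g (snd z))"
proof (rule Bochner_Integration.integrable_bound)
  have [measurable]: "fst \<in> \<theta> \<rightarrow>\<^sub>M borel" "snd \<in> \<theta> \<rightarrow>\<^sub>M borel"
    by (simp_all add: measurable_cong_sets[OF s refl])
  have [measurable]: "f \<in> borel_measurable borel" "g \<in> borel_measurable borel" using f g by (auto simp: L2_def)
  have "integrable (distr \<theta> borel fst) (\<lambda>x. (f x)\<^sup>2)" "integrable (distr \<theta> borel snd) (\<lambda>x. (g x)\<^sup>2)"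
    using f g unfolding d0[symmetric] d1[symmetric] by (auto simp: L2_def)
  then show "integrable \<theta> (\<lambda>z. (f (fst z))\<^sup>2 + (g (snd z))\<^sup>2)"
    by (intro Bochner_Integration.integrable_add) (simp_all add: integrable_distr_eq)
  show "(\<lambda>z. f (fst z) * g (snd z)) \<in> borel_measurable \<theta>" by measurable
  show "AE z in \<theta>. norm (f (fst z) * g (snd z)) \<le> norm ((f (fst z))\<^sup>2 + (g (snd z))\<^sup>2)"
    by (simp add: abs_mult_le_sum_squares)
qed

text \<open>Pairing with an image under the Koopman operator is integration of a product against the joint
  law. Hence \<open>cross_integral\<close>, the limit of the cross Gram matrices, determines the projected operator.\<close>

lemma koopman_weak_form:
  fixes \<kappa> :: "'a::euclidean_space \<Rightarrow> 'a measure"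
  assumes \<kappa>: "\<kappa> \<in> borel \<rightarrow>\<^sub>M prob_algebra borel"
    and s: "sets (joint_law (density lborel \<rho>\<^sub>0) \<kappa>) = sets (borel \<Otimes>\<^sub>M borel)"
    and d0: "density lborel \<rho>\<^sub>0 = distr (joint_law (density lborel \<rho>\<^sub>0) \<kappa>) borel fst"
    and d1: "density lborel \<rho>\<^sub>1 = distr (joint_law (density lborel \<rho>\<^sub>0) \<kappa>) borel snd"
    and sub: "\<And>k. k \<in> {1..p} \<Longrightarrow> tensor_space n \<psi> k \<subseteq> L2 \<rho>\<^sub>0"
    and sub': "\<And>k. k \<in> {1..p} \<Longrightarrow> tensor_space n' \<phi> k \<subseteq> L2 \<rho>\<^sub>1" and k: "k \<in> {1..p}"
  shows "L2_inner \<rho>\<^sub>0 (combine n \<psi> k u) (\<lambda>x. koopman \<kappa> (combine n' \<phi> k a) x - combine n \<psi> k c x) =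
      (\<Sum>i\<in>multi_indices n k. u i *
        ((\<Sum>j\<in>multi_indices n' k. cross_integral (joint_law (density lborel \<rho>\<^sub>0) \<kappa>) \<psi> \<phi> k i j * a j)
        - (\<Sum>j\<in>multi_indices n k. tensor_gramian (L2_inner \<rho>\<^sub>0) \<psi> k i j * c j)))"
proof -
  let ?\<mu> = "density lborel \<rho>\<^sub>0" and ?\<theta> = "joint_law (density lborel \<rho>\<^sub>0) \<kappa>"
  let ?I = "multi_indices n k" and ?J = "multi_indices n' k"
  let ?f = "combine n \<psi> k u" and ?g = "combine n' \<phi> k a" and ?h = "combine n \<psi> k c"
  have rep: "represents (L2_inner \<rho>\<^sub>0) n \<psi> p (tensor_gramian (L2_inner \<rho>\<^sub>0) \<psi>)"
    by (rule L2_inner_represents, erule sub)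
  have f: "?f \<in> L2 \<rho>\<^sub>0" and h: "?h \<in> L2 \<rho>\<^sub>0" by (rule combine_in_L2[OF sub[OF k]])+
  have g: "?g \<in> L2 \<rho>\<^sub>1" by (rule combine_in_L2[OF sub'[OF k]])
  have fm: "?f \<in> borel_measurable borel" and gm: "?g \<in> borel_measurable borel" using f g by (auto simp: L2_def)
  define F where "F z = ?f (fst z) * ?g (snd z)" for z
  have Fm: "F \<in> borel_measurable (borel \<Otimes>\<^sub>M borel)" unfolding F_def using fm gm by measurable
  have Fi: "integrable ?\<theta> F" unfolding F_def by (rule L2_marginal_integrable[OF s d0 d1 f g])
  have FK: "(\<integral>y. F (x, y) \<partial>\<kappa> x) = ?f x * koopman \<kappa> ?g x" for x by (simp add: F_def koopman_def)
  have s\<mu>: "sets ?\<mu> = sets borel" by simp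
  note I = integral_joint_law[OF \<kappa> s\<mu> Fm Fi, unfolded FK]
  have "(\<integral>z. F z \<partial>?\<theta>) = (\<integral>z. (\<Sum>i\<in>?I. \<Sum>j\<in>?J. u i * a j * (tensor_basis \<psi> k i (fst z) * tensor_basis \<phi> k j (snd z))) \<partial>?\<theta>)"
    unfolding F_def combine_def sum_product by (simp add: mult_ac)
  also have "\<dots> = (\<Sum>i\<in>?I. \<Sum>j\<in>?J. \<integral>z. u i * a j * (tensor_basis \<psi> k i (fst z) * tensor_basis \<phi> k j (snd z)) \<partial>?\<theta>)"
  proof -
    have "integrable ?\<theta> (\<lambda>z. u i * a j * (tensor_basis \<psi> k i (fst z) * tensor_basis \<phi> k j (snd z)))"
      if "i \<in> ?I" "j \<in> ?J" for i j
      using that by (intro integrable_mult_right L2_marginal_integrable[OF s d0 d1]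
          tensor_basis_in_L2[OF sub[OF k]] tensor_basis_in_L2[OF sub'[OF k]])
    then show ?thesis by (simp add: Bochner_Integration.integral_sum Bochner_Integration.integrable_sum)
  qed
  finally have Fsum: "(\<integral>z. F z \<partial>?\<theta>) = (\<Sum>i\<in>?I. \<Sum>j\<in>?J. u i * a j * cross_integral ?\<theta> \<psi> \<phi> k i j)"
    by (simp add: cross_integral_def)
  have hsum: "(\<integral>x. ?f x * ?h x \<partial>?\<mu>) = (\<Sum>i\<in>?I. \<Sum>j\<in>?I. u i * c j * tensor_gramian (L2_inner \<rho>\<^sub>0) \<psi> k i j)"
    using rep k unfolding represents_def L2_inner_def[of \<rho>\<^sub>0 ?f ?h, symmetric] by simp
  have "L2_inner \<rho>\<^sub>0 ?f (\<lambda>x. koopman \<kappa> ?g x - ?h x) = (\<integral>x. ?f x * koopman \<kappa> ?g x - ?f x * ?h x \<partial>?\<mu>)"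
    by (simp add: L2_inner_def right_diff_distrib)
  also have "\<dots> = (\<integral>x. ?f x * koopman \<kappa> ?g x \<partial>?\<mu>) - (\<integral>x. ?f x * ?h x \<partial>?\<mu>)"
    by (rule Bochner_Integration.integral_diff[OF I(1) L2_mult_integrable[OF f h]])
  finally show ?thesis
    unfolding I(2) Fsum hsum
    by (simp add: right_diff_distrib sum_subtractf sum_distrib_left mult_ac)
qed

section \<open>Almost sure convergence\<close>

lemma strong_lawD:
  assumes "strong_law M \<theta> z" "integrable \<theta> f"
  shows "AE \<omega> in M. (\<lambda>m. (\<Sum>k<m. f (z k \<omega>)) / real m) \<longlonglongrightarrow> (\<integral>u. f u \<partial>\<theta>)"
  using assms unfolding strong_law_def by blast

lemma strong_law_emp_inner:
  assumes SL: "strong_law M \<theta> z" and \<pi>: "\<pi> \<in> \<theta> \<rightarrow>\<^sub>M borel"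
    and marg: "density lborel \<rho> = distr \<theta> borel \<pi>" and fg: "f \<in> L2 \<rho>" "g \<in> L2 \<rho>"
  shows "AE \<omega> in M. (\<lambda>m. emp_inner m (\<lambda>j. \<pi> (z j \<omega>)) f g) \<longlonglongrightarrow> L2_inner \<rho> f g"
proof -
  have m: "(\<lambda>u. f u * g u) \<in> borel_measurable borel" using fg by (auto simp: L2_def)
  have "integrable (distr \<theta> borel \<pi>) (\<lambda>u. f u * g u)"
    unfolding marg[symmetric] by (rule L2_mult_integrable[OF fg])
  then have "integrable \<theta> (\<lambda>u. f (\<pi> u) * g (\<pi> u))" by (simp add: integrable_distr_eq[OF \<pi> m])
  from strong_lawD[OF SL this] show ?thesis
    unfolding emp_inner_def L2_inner_def marg integral_distr[OF \<pi> m] .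
qed

theorem theorem1:
  fixes P :: "'s measure" and X :: "real \<Rightarrow> 's \<Rightarrow> 'a::euclidean_space" and \<tau> :: real
    and \<kappa> :: "'a \<Rightarrow> 'a measure" and \<rho>\<^sub>0 \<rho>\<^sub>1 :: "'a \<Rightarrow> ennreal"
    and M :: "'w measure" and x y :: "nat \<Rightarrow> 'w \<Rightarrow> 'a"
    and p :: nat and n\<^sub>V n\<^sub>W r :: "nat \<Rightarrow> nat"
    and \<psi> \<phi> :: "nat \<Rightarrow> nat \<Rightarrow> 'a \<Rightarrow> real"
  assumes "\<tau> > 0" and "dynamical_system P X \<tau> \<kappa> \<rho>\<^sub>0 \<rho>\<^sub>1"
    and "prob_space M"
    and "\<And>k. x k \<in> borel_measurable M" and "\<And>k. y k \<in> borel_measurable M"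
    and "strong_law M (joint_law (density lborel \<rho>\<^sub>0) \<kappa>) (\<lambda>k \<omega>. (x k \<omega>, y k \<omega>))"
    and "\<And>k i. k \<in> {1..p} \<Longrightarrow> i < n\<^sub>V k \<Longrightarrow> \<psi> k i \<in> borel_measurable borel"
    and "\<And>k i. k \<in> {1..p} \<Longrightarrow> i < n\<^sub>W k \<Longrightarrow> \<phi> k i \<in> borel_measurable borel"
    and "\<And>k. k \<in> {1..p} \<Longrightarrow> tensor_space n\<^sub>V \<psi> k \<subseteq> L2 \<rho>\<^sub>0"
    and "\<And>k. k \<in> {1..p} \<Longrightarrow> tensor_space n\<^sub>W \<phi> k \<subseteq> L2 \<rho>\<^sub>1"
    and "\<And>k. k \<in> {1..p} \<Longrightarrow> L2_independent \<rho>\<^sub>0 (multi_indices n\<^sub>V k) (tensor_basis \<psi> k)"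
    and "\<And>k. k \<in> {1..p} \<Longrightarrow> L2_independent \<rho>\<^sub>1 (multi_indices n\<^sub>W k) (tensor_basis \<phi> k)"
    and "spectral_subspaces_welldef (L2_inner \<rho>\<^sub>0) n\<^sub>V \<psi> r p"
    and "spectral_subspaces_welldef (L2_inner \<rho>\<^sub>1) n\<^sub>W \<phi> r p"
  shows "AE \<omega> in M. \<forall>k\<in>{1..p}.
    (\<lambda>m. op_norm \<rho>\<^sub>1 \<rho>\<^sub>0 (tensor_space n\<^sub>W \<phi> k)
      (\<lambda>f u.
        emp_koopman_proj m (\<lambda>j. x j \<omega>) (\<lambda>j. y j \<omega>) (tensor_space n\<^sub>V \<psi> k)
          (spectral_subspace (emp_inner m (\<lambda>j. x j \<omega>)) n\<^sub>V \<psi> r k)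
          (spectral_subspace (emp_inner m (\<lambda>j. y j \<omega>)) n\<^sub>W \<phi> r k) f u
        - koopman_proj \<kappa> \<rho>\<^sub>0 \<rho>\<^sub>1
          (spectral_subspace (L2_inner \<rho>\<^sub>0) n\<^sub>V \<psi> r k)
          (spectral_subspace (L2_inner \<rho>\<^sub>1) n\<^sub>W \<phi> r k) f u))
    \<longlonglongrightarrow> 0"
proof -
  let ?\<theta> = "joint_law (density lborel \<rho>\<^sub>0) \<kappa>"
  let ?G = "tensor_gramian (L2_inner \<rho>\<^sub>0) \<psi>" and ?G' = "tensor_gramian (L2_inner \<rho>\<^sub>1) \<phi>"
  note marg = dynamical_system_marginals[OF assms(2,1)]
  note sub = assms(9) and sub' = assms(10)
  have rep: "represents (L2_inner \<rho>\<^sub>0) n\<^sub>V \<psi> p ?G" and rep': "represents (L2_inner \<rho>\<^sub>1) n\<^sub>W \<phi> p ?G'"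
    by (rule L2_inner_represents, erule sub, rule L2_inner_represents, erule sub')
  have fst: "fst \<in> ?\<theta> \<rightarrow>\<^sub>M borel" and snd: "snd \<in> ?\<theta> \<rightarrow>\<^sub>M borel"
    by (simp_all add: measurable_cong_sets[OF marg(2) refl])
  have limV: "AE \<omega> in M. (\<lambda>m. tensor_gramian (emp_inner m (\<lambda>j. x j \<omega>)) \<psi> k i j) \<longlonglongrightarrow> ?G k i j"
    if k: "k \<in> {1..p}" and ij: "i \<in> multi_indices n\<^sub>V k" "j \<in> multi_indices n\<^sub>V k" for k i j
    using strong_law_emp_inner[OF assms(6) fst marg(3)
        tensor_basis_in_L2[OF sub[OF k] ij(1)] tensor_basis_in_L2[OF sub[OF k] ij(2)]]
    unfolding tensor_gramian_def by simp
  have limW: "AE \<omega> in M. (\<lambda>m. tensor_gramian (emp_inner m (\<lambda>j. y j \<omega>)) \<phi> k i j) \<longlonglongrightarrow> ?G' k i j"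
    if k: "k \<in> {1..p}" and ij: "i \<in> multi_indices n\<^sub>W k" "j \<in> multi_indices n\<^sub>W k" for k i j
    using strong_law_emp_inner[OF assms(6) snd marg(4)
        tensor_basis_in_L2[OF sub'[OF k] ij(1)] tensor_basis_in_L2[OF sub'[OF k] ij(2)]]
    unfolding tensor_gramian_def by simp
  have limX: "AE \<omega> in M. (\<lambda>m. cross_gramian m (\<lambda>j. x j \<omega>) (\<lambda>j. y j \<omega>) \<psi> \<phi> k i j) \<longlonglongrightarrow> cross_integral ?\<theta> \<psi> \<phi> k i j"
    if k: "k \<in> {1..p}" and ij: "i \<in> multi_indices n\<^sub>V k" "j \<in> multi_indices n\<^sub>W k" for k i j
    using strong_lawD[OF assms(6) L2_marginal_integrable[OF marg(2-4)
        tensor_basis_in_L2[OF sub[OF k] ij(1)] tensor_basis_in_L2[OF sub'[OF k] ij(2)]]]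
    unfolding cross_gramian_def cross_integral_def by simp
  have "AE \<omega> in M. \<forall>k\<in>{1..p}. \<forall>i\<in>multi_indices n\<^sub>V k. \<forall>j\<in>multi_indices n\<^sub>V k.
      (\<lambda>m. tensor_gramian (emp_inner m (\<lambda>j. x j \<omega>)) \<psi> k i j) \<longlonglongrightarrow> ?G k i j"
    using limV by (intro AE_finite_allI) auto
  moreover have "AE \<omega> in M. \<forall>k\<in>{1..p}. \<forall>i\<in>multi_indices n\<^sub>W k. \<forall>j\<in>multi_indices n\<^sub>W k.
      (\<lambda>m. tensor_gramian (emp_inner m (\<lambda>j. y j \<omega>)) \<phi> k i j) \<longlonglongrightarrow> ?G' k i j"
    using limW by (intro AE_finite_allI) auto
  moreover have "AE \<omega> in M. \<forall>k\<in>{1..p}. \<forall>i\<in>multi_indices n\<^sub>V k. \<forall>j\<in>multi_indices n\<^sub>W k.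
      (\<lambda>m. cross_gramian m (\<lambda>j. x j \<omega>) (\<lambda>j. y j \<omega>) \<psi> \<phi> k i j) \<longlonglongrightarrow> cross_integral ?\<theta> \<psi> \<phi> k i j"
    using limX by (intro AE_finite_allI) auto
  ultimately show ?thesis
  proof eventually_elim
    case (elim \<omega>)
    show ?case
    proof (rule ballI, goal_cases)
      case k: (1 k)
      obtain Tp where "coef_tuple ?G n\<^sub>V r p Tp"
        using assms(13) spectral_tuple_iff_coef_tuple[OF rep order_refl]
        unfolding spectral_subspaces_welldef_def by blast
      then obtain T where T: "coef_tuple ?G n\<^sub>V r k T" using coef_tuple_prefix k by fastforce
      obtain Tp' where "coef_tuple ?G' n\<^sub>W r p Tp'"
        using assms(14) spectral_tuple_iff_coef_tuple[OF rep' order_refl]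
        unfolding spectral_subspaces_welldef_def by blast
      then obtain T' where T': "coef_tuple ?G' n\<^sub>W r k T'" using coef_tuple_prefix k by fastforce
      show ?case
      proof (rule koopman_proj_op_norm_tendsto_0[OF k rep symmetric_form_L2 rep' symmetric_form_L2 _ _ _ _ _ T T'])
        show "forms_converge n\<^sub>V p (\<lambda>m. tensor_gramian (emp_inner m (\<lambda>j. x j \<omega>)) \<psi>) ?G"
          using elim(1) by (simp add: forms_converge_def)
        show "forms_converge n\<^sub>W p (\<lambda>m. tensor_gramian (emp_inner m (\<lambda>j. y j \<omega>)) \<phi>) ?G'"
          using elim(2) by (simp add: forms_converge_def)
        show "(\<lambda>m. cross_gramian m (\<lambda>j. x j \<omega>) (\<lambda>j. y j \<omega>) \<psi> \<phi> k i j) \<longlonglongrightarrow> cross_integral ?\<theta> \<psi> \<phi> k i j"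
          if "i \<in> multi_indices n\<^sub>V k" "j \<in> multi_indices n\<^sub>W k" for i j
          using elim(3) k that by blast
        show "positive_definite_on (multi_indices n\<^sub>V k) (?G k)"
          by (rule L2_gramian_positive_definite[OF _ k assms(11)[OF k]], erule sub)
        show "positive_definite_on (multi_indices n\<^sub>W k) (?G' k)"
          by (rule L2_gramian_positive_definite[OF _ k assms(12)[OF k]], erule sub')
      qed (rule koopman_weak_form[OF marg _ _ k], erule sub, erule sub')
    qed
  qed
qed

end
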